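(* Let $(\mathcal G,\rho)$ be a locally compact Hausdorff Real groupoid and let $(\mathrm S,\bar{\ })$ be an abelian Real group. Then the Real Čech cohomology group $\check{H}R^1(\mathcal G_\bullet,\mathrm S)$ is isomorphic to the abelian group $\operatorname{Hom}_{\mathfrak{RG}}(\mathcal G,\mathrm S)$ of isomorphism classes of Real generalized homomorphisms $(\mathcal G,\rho)\to(\mathrm S,\bar{\ })$.
   Context: **Real groupoids.** A Real space is a locally compact Hausdorff space with a homeomorphism of square the identity (its Real structure). Groupoids $\mathcal G\rightrightarrows X$ are topological, locally compact, Hausdorff, with open range and source maps $r,s$. A Real groupoid $(\mathcal G,\rho)$ is a groupoid with a homeomorphism $\rho:\mathcal G\to\mathcal G$ which is a functor and satisfies $\rho^2=\mathrm{id}$; $\rho$ also denotes the induced involution of $X$. An abelian Real group $\mathrm S$ is a (locally compact Hausdorff) abelian topological group with an involutive automorphism $t\mapsto\bar t$; it is a Real groupoid with one unit. **Real generalized homomorphisms.** A Real generalized homomorphism from $(\mathcal G,\rho)$ to $(\mathrm S,\bar{\ })$ is a Real space $(Z,\tau)$ with a continuous map $\mathfrak r:Z\to X$ satisfying $\mathfrak r\circ\tau=\rho\circ\mathfrak r$, a continuous left action of $\mathcal G$ on $Z$ with respect to $\mathfrak r$ (so $gz$ is defined when $s(g)=\mathfrak r(z)$, and $\mathfrak r(gz)=r(g)$) and a continuous right action of $\mathrm S$ on $Z$, the two actions commuting, with $\mathfrak r(zt)=\mathfrak r(z)$, $\tau(gz)=\rho(g)\tau(z)$, $\tau(zt)=\tau(z)\bar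 t$, such that $\mathfrak r:Z\to X$ is a locally trivial principal $\mathrm S$-bundle. Two such are isomorphic if there is a $\mathcal G$-$\mathrm S$-equivariant homeomorphism over $X$ intertwining the Real structures. The sum in $\operatorname{Hom}_{\mathfrak{RG}}(\mathcal G,\mathrm S)$ is induced by $(Z,\tau)+(Z',\tau'):=(Z\times_X Z')/\sim$, where $(z,z')\sim(zt^{-1},z't)$ for $t\in\mathrm S$, with the Real structure $\tau\times\tau'$; the inverse of $(Z,\tau)$ is the same Real $\mathcal G$-space with $\mathrm S$-action $z\cdot_{\rm new}t=zt^{-1}$. **Real Čech cohomology.** Let $\Delta$ (resp. $\Delta'$) be the category of the sets $[n]=\{0,\dots,n\}$ with nondecreasing (resp. strictly increasing) maps. Let $\mathcal G_0=X$ and, for $n\ge1$, $\mathcal G_n=\{(g_1,\dots,g_n): s(g_i)=r(g_{i+1})\}$, with the componentwise Real structure $\rho_n$. Identify $\vec g\in\mathcal G_n$ with the functor $[n]\times[n]\to\mathcal G$ from the pair groupoid of $[n]$ with $\vec g(i-1,i)=g_i$; a map $f:[m]\to[n]$ in $\Delta$ induces $\tilde f:\mathcal G_n\to\mathcal G_m$, $\tilde f(\vec g)=\vec g\circ(f\times f)$. Let $\varepsilon_k:[n]\to[n+1]$ be the increasing map omitting $k$. A Real open cover $\mathcal U_\bullet$ of $(\mathcal G_\bullet,\rho_\bullet)$ is a sequence of open covers $\mathcal U_n=(U^n_j)_{j\in J_n}$ of $\mathcal G_n$, where $J_n$ is a set with an involution $j\mapsto\bar j$ such that $U^n_{\bar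 j}=\rho_n(U^n_j)$. Let $\mathcal P_n^k=\operatorname{Hom}_{\Delta'}([k],[n])$ and let $\Lambda_n$ be the set of maps $\lambda:\bigcup_{k\le n}\mathcal P_n^k\to\bigcup_k J_k$ with $\lambda(\mathcal P^k_n)\subset J_k$, with involution $\bar\lambda(\varphi)=\overline{\lambda(\varphi)}$, and put $U^n_\lambda=\bigcap_{k\le n}\bigcap_{\varphi\in\mathcal P_n^k}\tilde\varphi^{-1}(U^k_{\lambda(\varphi)})$. For $f\in\operatorname{Hom}_{\Delta'}([m],[n])$ put $(\tilde f\lambda)(\varphi)=\lambda(f\circ\varphi)$, so $\tilde f(U^n_\lambda)\subset U^m_{\tilde f\lambda}$. The group $CR^n(\mathcal U_\bullet,\mathrm S)$ consists of families $(c_\lambda)_{\lambda\in\Lambda_n}$ of continuous maps $c_\lambda:U^n_\lambda\to\mathrm S$ with $c_{\bar\lambda}(\rho_n(\vec g))=\overline{c_\lambda(\vec g)}$; the differential is (additively) $(dc)_\lambda=\sum_{k=0}^{n+1}(-1)^k c_{\tilde\varepsilon_k\lambda}\circ\tilde\varepsilon_k$ on $U^{n+1}_\lambda$. $HR^n(\mathcal U_\bullet,\mathrm S)$ is the $n$-th cohomology of this complex. Let $\mathfrak N(n)$ be the collection of Real open covers $\mathcal U_\bullet$ for which there is $N\ge n+1$ such that the index sets $(J_k)_{k\le N}$ admit an $N$-truncated simplicial structure by involution-preserving maps with $\tilde f(U^p_j)\subset U^m_{\tilde f(j)}$ for all $f\in\operatorname{Hom}_\Delta([m],[p])$, $m,p\le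 N$. It is preordered by refinement: $\mathcal V_\bullet=(V^k_i)_{i\in I_k}$ is finer than $\mathcal U_\bullet$ if there are involution-preserving maps $\theta_k:I_k\to J_k$ with $V_i^k\subset U^k_{\theta_k(i)}$. Refinement induces, by restriction, a map $HR^n(\mathcal U_\bullet,\mathrm S)\to HR^n(\mathcal V_\bullet,\mathrm S)$ independent of the choice of $\theta_\bullet$, and $\check HR^n(\mathcal G_\bullet,\mathrm S):=\varinjlim_{\mathcal U_\bullet\in\mathfrak N(n)}HR^n(\mathcal U_\bullet,\mathrm S)$. *)

theory Defs
  imports "HOL-Analysis.Analysis" "HOL-Algebra.Coset" "HOL-Algebra.FiniteProduct"
begin

section \<open>Real groupoids and abelian Real groups\<close>

text \<open>
  Spaces are abstract topologies, so that carriers are arbitrary (possibly empty) sets.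
  The assertion \<open>homeomorphic_maps X X f f\<close> says that \<open>f\<close> is a homeomorphism of \<open>X\<close>
  whose square is the identity.
\<close>

definition real_space :: "'a topology \<Rightarrow> ('a \<Rightarrow> 'a) \<Rightarrow> bool" where
  "real_space X \<tau> \<longleftrightarrow>
     locally_compact_space X \<and> Hausdorff_space X \<and> homeomorphic_maps X X \<tau> \<tau>"

record ('x, 'g) groupoid_data =
  Obj :: "'x topology"
  Arr :: "'g topology"
  rng :: "'g \<Rightarrow> 'x"
  src :: "'g \<Rightarrow> 'x"
  unt :: "'x \<Rightarrow> 'g"
  mul :: "'g \<Rightarrow> 'g \<Rightarrow> 'g"
  ginv :: "'g \<Rightarrow> 'g"
  rho :: "'g \<Rightarrow> 'g"

text \<open>The involution induced by \<open>\<rho>\<close> on the unit space.\<close>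

definition rho_obj :: "('x, 'g) groupoid_data \<Rightarrow> 'x \<Rightarrow> 'x" where
  "rho_obj G x = rng G (rho G (unt G x))"

abbreviation arrows :: "('x, 'g) groupoid_data \<Rightarrow> 'g set" where
  "arrows G \<equiv> topspace (Arr G)"

abbreviation objects :: "('x, 'g) groupoid_data \<Rightarrow> 'x set" where
  "objects G \<equiv> topspace (Obj G)"

locale real_groupoid =
  fixes G :: "('x, 'g) groupoid_data"
  assumes obj_locally_compact: "locally_compact_space (Obj G)"
    and obj_Hausdorff: "Hausdorff_space (Obj G)"
    and arr_locally_compact: "locally_compact_space (Arr G)"
    and arr_Hausdorff: "Hausdorff_space (Arr G)"
    and rng_continuous: "continuous_map (Arr G) (Obj G) (rng G)"
    and src_continuous: "continuous_map (Arr G) (Obj G) (src G)"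
    and rng_open: "open_map (Arr G) (Obj G) (rng G)"
    and src_open: "open_map (Arr G) (Obj G) (src G)"
    and unt_continuous: "continuous_map (Obj G) (Arr G) (unt G)"
    and mul_continuous:
      "continuous_map (subtopology (prod_topology (Arr G) (Arr G)) {(g, h). src G g = rng G h})
         (Arr G) (\<lambda>(g, h). mul G g h)"
    and ginv_continuous: "continuous_map (Arr G) (Arr G) (ginv G)"
    and rng_unt: "x \<in> objects G \<Longrightarrow> rng G (unt G x) = x"
    and src_unt: "x \<in> objects G \<Longrightarrow> src G (unt G x) = x"
    and rng_mul: "\<lbrakk>g \<in> arrows G; h \<in> arrows G; src G g = rng G h\<rbrakk>
      \<Longrightarrow> rng G (mul G g h) = rng G g"
    and src_mul: "\<lbrakk>g \<in> arrows G; h \<in> arrows G; src G g = rng G h\<rbrakk>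
      \<Longrightarrow> src G (mul G g h) = src G h"
    and mul_assoc: "\<lbrakk>g \<in> arrows G; h \<in> arrows G; k \<in> arrows G; src G g = rng G h; src G h = rng G k\<rbrakk>
      \<Longrightarrow> mul G (mul G g h) k = mul G g (mul G h k)"
    and unt_mul: "g \<in> arrows G \<Longrightarrow> mul G (unt G (rng G g)) g = g"
    and mul_unt: "g \<in> arrows G \<Longrightarrow> mul G g (unt G (src G g)) = g"
    and rng_ginv: "g \<in> arrows G \<Longrightarrow> rng G (ginv G g) = src G g"
    and src_ginv: "g \<in> arrows G \<Longrightarrow> src G (ginv G g) = rng G g"
    and mul_ginv: "g \<in> arrows G \<Longrightarrow> mul G g (ginv G g) = unt G (rng G g)"
    and ginv_mul: "g \<in> arrows G \<Longrightarrow> mul G (ginv G g) g = unt G (src G g)"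
    and rho_involution: "homeomorphic_maps (Arr G) (Arr G) (rho G) (rho G)"
    and rng_rho: "g \<in> arrows G \<Longrightarrow> rng G (rho G g) = rho_obj G (rng G g)"
    and src_rho: "g \<in> arrows G \<Longrightarrow> src G (rho G g) = rho_obj G (src G g)"
    and rho_unt: "x \<in> objects G \<Longrightarrow> rho G (unt G x) = unt G (rho_obj G x)"
    and rho_mul: "\<lbrakk>g \<in> arrows G; h \<in> arrows G; src G g = rng G h\<rbrakk>
      \<Longrightarrow> rho G (mul G g h) = mul G (rho G g) (rho G h)"

record 's group_data = "'s monoid" +
  top_of :: "'s topology"
  bar :: "'s \<Rightarrow> 's"

locale abelian_real_group = comm_group S for S :: "'s group_data" (structure) +
  assumes topspace_top_of: "topspace (top_of S) = carrier S"
    and locally_compact_top_of: "locally_compact_space (top_of S)"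
    and Hausdorff_top_of: "Hausdorff_space (top_of S)"
    and mult_continuous:
      "continuous_map (prod_topology (top_of S) (top_of S)) (top_of S) (\<lambda>(s, t). s \<otimes> t)"
    and inv_continuous: "continuous_map (top_of S) (top_of S) (\<lambda>t. inv t)"
    and bar_hom: "bar S \<in> hom S S"
    and bar_involution: "homeomorphic_maps (top_of S) (top_of S) (bar S) (bar S)"


section \<open>Real generalized homomorphisms\<close>

record ('x, 'g, 's, 'z) gen_hom_data =
  Top :: "'z topology"
  tau :: "'z \<Rightarrow> 'z"
  anchor :: "'z \<Rightarrow> 'x"
  lact :: "'g \<Rightarrow> 'z \<Rightarrow> 'z"
  ract :: "'z \<Rightarrow> 's \<Rightarrow> 'z"

abbreviation points :: "('x, 'g, 's, 'z) gen_hom_data \<Rightarrow> 'z set" where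
  "points Z \<equiv> topspace (Top Z)"

definition locally_trivial_principal_bundle ::
  "'x topology \<Rightarrow> 's group_data \<Rightarrow> 'z topology \<Rightarrow> ('z \<Rightarrow> 'x) \<Rightarrow> ('z \<Rightarrow> 's \<Rightarrow> 'z) \<Rightarrow> bool" where
  "locally_trivial_principal_bundle X S P p act \<longleftrightarrow>
     (\<forall>x \<in> topspace X. \<exists>U h. openin X U \<and> x \<in> U \<and>
        homeomorphic_map (prod_topology (subtopology X U) (top_of S))
          (subtopology P {z \<in> topspace P. p z \<in> U}) h \<and>
        (\<forall>y \<in> U. \<forall>s \<in> carrier S. p (h (y, s)) = y \<and>
           (\<forall>t \<in> carrier S. h (y, s \<otimes>\<^bsub>S\<^esub> t) = act (h (y, s)) t)))"

locale real_gen_hom =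
  fixes G :: "('x, 'g) groupoid_data"
    and S :: "'s group_data"
    and Z :: "('x, 'g, 's, 'z) gen_hom_data"
  assumes real_space_Top: "real_space (Top Z) (tau Z)"
    and anchor_continuous: "continuous_map (Top Z) (Obj G) (anchor Z)"
    and anchor_tau: "z \<in> points Z \<Longrightarrow> anchor Z (tau Z z) = rho_obj G (anchor Z z)"
    and lact_continuous:
      "continuous_map (subtopology (prod_topology (Arr G) (Top Z)) {(g, z). src G g = anchor Z z})
         (Top Z) (\<lambda>(g, z). lact Z g z)"
    and anchor_lact: "\<lbrakk>g \<in> arrows G; z \<in> points Z; src G g = anchor Z z\<rbrakk>
      \<Longrightarrow> anchor Z (lact Z g z) = rng G g"
    and lact_unt: "z \<in> points Z \<Longrightarrow> lact Z (unt G (anchor Z z)) z = z"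
    and lact_mul: "\<lbrakk>g \<in> arrows G; h \<in> arrows G; z \<in> points Z; src G g = rng G h; src G h = anchor Z z\<rbrakk>
      \<Longrightarrow> lact Z (mul G g h) z = lact Z g (lact Z h z)"
    and ract_continuous:
      "continuous_map (prod_topology (Top Z) (top_of S)) (Top Z) (\<lambda>(z, t). ract Z z t)"
    and anchor_ract: "\<lbrakk>z \<in> points Z; t \<in> carrier S\<rbrakk> \<Longrightarrow> anchor Z (ract Z z t) = anchor Z z"
    and ract_one: "z \<in> points Z \<Longrightarrow> ract Z z \<one>\<^bsub>S\<^esub> = z"
    and ract_mult: "\<lbrakk>z \<in> points Z; s \<in> carrier S; t \<in> carrier S\<rbrakk>
      \<Longrightarrow> ract Z z (s \<otimes>\<^bsub>S\<^esub> t) = ract Z (ract Z z s) t"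
    and lact_ract: "\<lbrakk>g \<in> arrows G; z \<in> points Z; t \<in> carrier S; src G g = anchor Z z\<rbrakk>
      \<Longrightarrow> lact Z g (ract Z z t) = ract Z (lact Z g z) t"
    and tau_lact: "\<lbrakk>g \<in> arrows G; z \<in> points Z; src G g = anchor Z z\<rbrakk>
      \<Longrightarrow> tau Z (lact Z g z) = lact Z (rho G g) (tau Z z)"
    and tau_ract: "\<lbrakk>z \<in> points Z; t \<in> carrier S\<rbrakk>
      \<Longrightarrow> tau Z (ract Z z t) = ract Z (tau Z z) (bar S t)"
    and principal: "locally_trivial_principal_bundle (Obj G) S (Top Z) (anchor Z) (ract Z)"

text \<open>The two underlying types may differ; this is used to compare a sum with its summands.\<close>

definition gen_hom_iso ::
  "('x, 'g) groupoid_data \<Rightarrow> 's group_data \<Rightarrow>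
   ('x, 'g, 's, 'z) gen_hom_data \<Rightarrow> ('x, 'g, 's, 'w) gen_hom_data \<Rightarrow> bool" where
  "gen_hom_iso G S Z W \<longleftrightarrow>
     (\<exists>f. homeomorphic_map (Top Z) (Top W) f \<and>
        (\<forall>z \<in> points Z. anchor W (f z) = anchor Z z \<and> f (tau Z z) = tau W (f z) \<and>
           (\<forall>g \<in> arrows G. src G g = anchor Z z \<longrightarrow> f (lact Z g z) = lact W g (f z)) \<and>
           (\<forall>t \<in> carrier S. f (ract Z z t) = ract W (f z) t)))"

definition quotient_topology :: "'a topology \<Rightarrow> ('a \<Rightarrow> 'b) \<Rightarrow> 'b topology" where
  "quotient_topology X q =
     topology (\<lambda>V. V \<subseteq> q ` topspace X \<and> openin X {x \<in> topspace X. q x \<in> V})"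

lemma openin_quotient_topology:
  "openin (quotient_topology X q) V \<longleftrightarrow>
     V \<subseteq> q ` topspace X \<and> openin X {x \<in> topspace X. q x \<in> V}"
proof -
  have "istopology (\<lambda>V. V \<subseteq> q ` topspace X \<and> openin X {x \<in> topspace X. q x \<in> V})"
    unfolding istopology_def
  proof (intro conjI allI impI)
    fix A B
    assume A: "A \<subseteq> q ` topspace X \<and> openin X {x \<in> topspace X. q x \<in> A}"
      and B: "B \<subseteq> q ` topspace X \<and> openin X {x \<in> topspace X. q x \<in> B}"
    have "{x \<in> topspace X. q x \<in> A \<inter> B} =
        {x \<in> topspace X. q x \<in> A} \<inter> {x \<in> topspace X. q x \<in> B}" by auto
    with A B show "openin X {x \<in> topspace X. q x \<in> A \<inter> B}" by auto
    show "A \<inter> B \<subseteq> q ` topspace X" using A by auto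
  next
    fix \<K>
    assume K: "\<forall>K\<in>\<K>. K \<subseteq> q ` topspace X \<and> openin X {x \<in> topspace X. q x \<in> K}"
    have "{x \<in> topspace X. q x \<in> \<Union>\<K>} = (\<Union>K\<in>\<K>. {x \<in> topspace X. q x \<in> K})" by auto
    with K show "openin X {x \<in> topspace X. q x \<in> \<Union>\<K>}" by auto
    show "\<Union>\<K> \<subseteq> q ` topspace X" using K by auto
  qed
  then show ?thesis by (simp add: quotient_topology_def)
qed

lemma topspace_quotient_topology: "topspace (quotient_topology X q) = q ` topspace X"
proof
  show "topspace (quotient_topology X q) \<subseteq> q ` topspace X"
    using openin_topspace[of "quotient_topology X q"]
    unfolding openin_quotient_topology by (rule conjunct1)
  have "{x \<in> topspace X. q x \<in> q ` topspace X} = topspace X" by auto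
  then have "openin (quotient_topology X q) (q ` topspace X)"
    by (simp add: openin_quotient_topology)
  then show "q ` topspace X \<subseteq> topspace (quotient_topology X q)"
    by (rule openin_subset)
qed

lemma quotient_map_quotient_topology: "quotient_map X (quotient_topology X q) q"
  by (simp add: quotient_map_def topspace_quotient_topology openin_quotient_topology)

text \<open>
  The points of a sum are equivalence classes of pairs, and the structure maps act on such a
  class elementwise: \<open>g[z, w] = [gz, gw]\<close> and \<open>[z, w]t = [z, wt]\<close> (which is \<open>[zt, w]\<close>).
\<close>

definition sum_class ::
  "'s group_data \<Rightarrow> ('x, 'g, 's, 'z) gen_hom_data \<Rightarrow> ('x, 'g, 's, 'w) gen_hom_data \<Rightarrow>
   'z \<times> 'w \<Rightarrow> ('z \<times> 'w) set" where
  "sum_class S Z W = (\<lambda>(z, w). {(ract Z z (inv\<^bsub>S\<^esub> t), ract W w t) | t. t \<in> carrier S})"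

definition gen_hom_sum ::
  "'s group_data \<Rightarrow> ('x, 'g, 's, 'z) gen_hom_data \<Rightarrow> ('x, 'g, 's, 'w) gen_hom_data \<Rightarrow>
   ('x, 'g, 's, ('z \<times> 'w) set) gen_hom_data" where
  "gen_hom_sum S Z W = \<lparr>
     Top = quotient_topology
       (subtopology (prod_topology (Top Z) (Top W)) {(z, w). anchor Z z = anchor W w})
       (sum_class S Z W),
     tau = (\<lambda>A. map_prod (tau Z) (tau W) ` A),
     anchor = (\<lambda>A. the_elem ((\<lambda>(z, w). anchor Z z) ` A)),
     lact = (\<lambda>g A. (\<lambda>(z, w). (lact Z g z, lact W g w)) ` A),
     ract = (\<lambda>A t. (\<lambda>(z, w). (z, ract W w t)) ` A)\<rparr>"

definition gen_hom_opposite ::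
  "'s group_data \<Rightarrow> ('x, 'g, 's, 'z) gen_hom_data \<Rightarrow> ('x, 'g, 's, 'z) gen_hom_data" where
  "gen_hom_opposite S Z = Z\<lparr>ract := (\<lambda>z t. ract Z z (inv\<^bsub>S\<^esub> t))\<rparr>"

definition gen_hom_trivial ::
  "('x, 'g) groupoid_data \<Rightarrow> 's group_data \<Rightarrow> ('x, 'g, 's, 'x \<times> 's) gen_hom_data" where
  "gen_hom_trivial G S = \<lparr>
     Top = prod_topology (Obj G) (top_of S),
     tau = (\<lambda>(x, t). (rho_obj G x, bar S t)),
     anchor = fst,
     lact = (\<lambda>g (x, t). (rng G g, t)),
     ract = (\<lambda>(x, s) t. (x, s \<otimes>\<^bsub>S\<^esub> t))\<rparr>"

text \<open>
  Isomorphism classes are formed inside a type \<open>'z\<close> serving as a universe. The total space of a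
  generalized homomorphism is in bijection with the product of the object space and \<open>S\<close>, so any
  \<open>'z\<close> into which this product embeds contains a copy of every generalized homomorphism.
\<close>

definition gen_hom_class ::
  "'z itself \<Rightarrow> ('x, 'g) groupoid_data \<Rightarrow> 's group_data \<Rightarrow>
   ('x, 'g, 's, 'w) gen_hom_data \<Rightarrow> ('x, 'g, 's, 'z) gen_hom_data set" where
  "gen_hom_class T G S Z = {W. real_gen_hom G S W \<and> gen_hom_iso G S Z W}"

definition Hom_RG ::
  "'z itself \<Rightarrow> ('x, 'g) groupoid_data \<Rightarrow> 's group_data \<Rightarrow>
   ('x, 'g, 's, 'z) gen_hom_data set monoid" where
  "Hom_RG T G S = \<lparr>
     carrier = {gen_hom_class T G S Z | Z :: ('x, 'g, 's, 'z) gen_hom_data. real_gen_hom G S Z},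
     mult = (\<lambda>A B. \<Union>Z\<in>A. \<Union>W\<in>B. gen_hom_class T G S (gen_hom_sum S Z W)),
     one = gen_hom_class T G S (gen_hom_trivial G S)\<rparr>"


section \<open>The simplicial space of a groupoid\<close>

text \<open>
  A map of \<open>\<Delta>\<close> from \<open>[m]\<close> to \<open>[n]\<close> is the list of its \<open>m + 1\<close> values. Lists (unlike
  functions restricted to \<open>{..m}\<close>) determine \<open>m\<close>, so hom-sets with distinct sources are disjoint.
\<close>

definition Hom_Delta :: "nat \<Rightarrow> nat \<Rightarrow> nat list set" where
  "Hom_Delta m n = {f. length f = Suc m \<and> set f \<subseteq> {..n} \<and> sorted_wrt (\<le>) f}"

definition Hom_Delta' :: "nat \<Rightarrow> nat \<Rightarrow> nat list set" where
  "Hom_Delta' m n = {f. length f = Suc m \<and> set f \<subseteq> {..n} \<and> sorted_wrt (<) f}"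

definition dom_ord :: "nat list \<Rightarrow> nat" where
  "dom_ord f = length f - 1"

definition after :: "nat list \<Rightarrow> nat list \<Rightarrow> nat list" where
  "after f h = map (\<lambda>i. f ! i) h"

definition id_map :: "nat \<Rightarrow> nat list" where
  "id_map n = [0..<Suc n]"

definition eps :: "nat \<Rightarrow> nat \<Rightarrow> nat list" where
  "eps n k = map (\<lambda>i. if i < k then i else Suc i) [0..<Suc n]"

abbreviation square :: "nat \<Rightarrow> (nat \<times> nat) set" where
  "square n \<equiv> {..n} \<times> {..n}"

text \<open>
  The functors from the pair groupoid of \<open>[n]\<close>, where \<open>(i, j)\<close> has range \<open>i\<close> and source \<open>j\<close>.
  With the topology of pointwise convergence they form the space of composable \<open>n\<close>-tuples (the
  object space if \<open>n = 0\<close>), see \<open>nerve_0\<close> and \<open>nerve_tuples\<close> below.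
\<close>

definition pair_functor :: "('x, 'g) groupoid_data \<Rightarrow> nat \<Rightarrow> (nat \<times> nat \<Rightarrow> 'g) \<Rightarrow> bool" where
  "pair_functor G n \<gamma> \<longleftrightarrow>
     (\<forall>i\<le>n. \<gamma> (i, i) = unt G (rng G (\<gamma> (i, i)))) \<and>
     (\<forall>i\<le>n. \<forall>j\<le>n. rng G (\<gamma> (i, j)) = rng G (\<gamma> (i, i)) \<and> src G (\<gamma> (i, j)) = rng G (\<gamma> (j, j))) \<and>
     (\<forall>i\<le>n. \<forall>j\<le>n. \<forall>k\<le>n. \<gamma> (i, k) = mul G (\<gamma> (i, j)) (\<gamma> (j, k)))"

definition nerve :: "('x, 'g) groupoid_data \<Rightarrow> nat \<Rightarrow> (nat \<times> nat \<Rightarrow> 'g) topology" where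
  "nerve G n =
     subtopology (product_topology (\<lambda>_. Arr G) (square n)) {\<gamma>. pair_functor G n \<gamma>}"

definition nerve_rho ::
  "('x, 'g) groupoid_data \<Rightarrow> nat \<Rightarrow> (nat \<times> nat \<Rightarrow> 'g) \<Rightarrow> (nat \<times> nat \<Rightarrow> 'g)" where
  "nerve_rho G n \<gamma> = restrict (\<lambda>p. rho G (\<gamma> p)) (square n)"

definition pull :: "nat list \<Rightarrow> (nat \<times> nat \<Rightarrow> 'g) \<Rightarrow> (nat \<times> nat \<Rightarrow> 'g)" where
  "pull f \<gamma> = restrict (\<lambda>(i, j). \<gamma> (f ! i, f ! j)) (square (dom_ord f))"

lemma pair_functorD:
  assumes "pair_functor G n \<gamma>" "i \<le> n" "j \<le> n"
  shows "\<gamma> (i, i) = unt G (rng G (\<gamma> (i, i)))"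
    and "rng G (\<gamma> (i, j)) = rng G (\<gamma> (i, i))"
    and "src G (\<gamma> (i, j)) = rng G (\<gamma> (j, j))"
    and "k \<le> n \<Longrightarrow> mul G (\<gamma> (i, j)) (\<gamma> (j, k)) = \<gamma> (i, k)"
  using assms unfolding pair_functor_def by metis+

lemma (in real_groupoid) nerve_0:
  "homeomorphic_map (nerve G 0) (Obj G) (\<lambda>\<gamma>. rng G (\<gamma> (0, 0)))"
proof -
  let ?P = "product_topology (\<lambda>_. Arr G) (square 0)"
  let ?f = "\<lambda>\<gamma>. rng G (\<gamma> (0, 0))"
  let ?g = "\<lambda>x. restrict (\<lambda>_. unt G x) (square 0)"
  have unt_in: "unt G x \<in> arrows G" if "x \<in> objects G" for x
    using unt_continuous that by (auto simp: continuous_map_def)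
  have f: "continuous_map (nerve G 0) (Obj G) ?f"
  proof -
    have "continuous_map ?P (Arr G) (\<lambda>\<gamma>. \<gamma> (0, 0))"
      by (rule continuous_map_product_projection) auto
    then have "continuous_map ?P (Obj G) (rng G \<circ> (\<lambda>\<gamma>. \<gamma> (0, 0)))"
      by (rule continuous_map_compose) (rule rng_continuous)
    then show ?thesis
      unfolding nerve_def by (simp add: comp_def continuous_map_from_subtopology)
  qed
  have g: "continuous_map (Obj G) (nerve G 0) ?g"
    unfolding nerve_def continuous_map_in_subtopology
  proof (intro conjI)
    show "continuous_map (Obj G) ?P ?g"
      by (auto simp: continuous_map_componentwise unt_continuous[unfolded eta_contract_eq])
    show "?g \<in> topspace (Obj G) \<rightarrow> {\<gamma>. pair_functor G 0 \<gamma>}"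
    proof
      fix x assume x: "x \<in> topspace (Obj G)"
      then have "mul G (unt G x) (unt G x) = unt G x"
        using unt_mul[OF unt_in[OF x]] by (simp add: rng_unt)
      then show "?g x \<in> {\<gamma>. pair_functor G 0 \<gamma>}"
        using x by (simp add: pair_functor_def rng_unt src_unt)
    qed
  qed
  have "homeomorphic_maps (nerve G 0) (Obj G) ?f ?g"
    unfolding homeomorphic_maps_def
  proof (intro conjI ballI)
    fix \<gamma> assume "\<gamma> \<in> topspace (nerve G 0)"
    then have "\<gamma> \<in> extensional (square 0)" and "pair_functor G 0 \<gamma>"
      by (auto simp: nerve_def PiE_def)
    then show "?g (?f \<gamma>) = \<gamma>"
      by (intro extensionalityI[of _ "square 0"]) (auto simp: pair_functor_def)
  next
    fix x assume "x \<in> topspace (Obj G)"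
    then show "?f (?g x) = x" by (simp add: rng_unt)
  qed (use f g in auto)
  then show ?thesis by (rule homeomorphic_maps_map[THEN iffD1, THEN conjunct1])
qed

lemma (in real_groupoid) nerve_tuples:
  assumes "n \<ge> 1"
  shows "homeomorphic_map (nerve G n)
    (subtopology (product_topology (\<lambda>_. Arr G) {1..n})
       {g. \<forall>i\<in>{1..<n}. src G (g i) = rng G (g (Suc i))})
    (\<lambda>\<gamma>. \<lambda>i\<in>{1..n}. \<gamma> (i - 1, i))"
proof -
  let ?P = "product_topology (\<lambda>_. Arr G) (square n)"
  let ?T = "subtopology (product_topology (\<lambda>_. Arr G) {1..n})
       {g. \<forall>i\<in>{1..<n}. src G (g i) = rng G (g (Suc i))}"
  let ?f = "\<lambda>\<gamma>. \<lambda>i\<in>{1..n}. \<gamma> (i - 1, i)"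
  define a where "a g j = rec_nat (unt G (rng G (g 1))) (\<lambda>j x. mul G x (g (Suc j))) j"
    for g :: "nat \<Rightarrow> 'g" and j
  have a0: "a g 0 = unt G (rng G (g 1))"
    and aS: "a g (Suc j) = mul G (a g j) (g (Suc j))" for g j
    by (simp_all add: a_def)
  define v where "v g j = (if j = 0 then rng G (g 1) else src G (g j))"
    for g :: "nat \<Rightarrow> 'g" and j :: nat
  let ?g = "\<lambda>g. restrict (\<lambda>(i, j). mul G (ginv G (a g i)) (a g j)) (square n)"
  have unt_in: "unt G x \<in> arrows G" if "x \<in> objects G" for x
    using unt_continuous that by (auto simp: continuous_map_def)
  have rng_in: "rng G g \<in> objects G" and src_in: "src G g \<in> objects G"
    and ginv_in: "ginv G g \<in> arrows G" if "g \<in> arrows G" for g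
    using that rng_continuous src_continuous ginv_continuous by (auto simp: continuous_map_def)
  have mul_in: "mul G g h \<in> arrows G"
    if "g \<in> arrows G" "h \<in> arrows G" "src G g = rng G h" for g h
  proof -
    have "(\<lambda>(g, h). mul G g h) (g, h) \<in> arrows G"
      by (rule funcset_mem[OF continuous_map_funspace[OF mul_continuous]]) (use that in simp)
    then show ?thesis by simp
  qed
  have T_in: "g i \<in> arrows G" if "g \<in> topspace ?T" "1 \<le> i" "i \<le> n" for g i
    using that by (auto simp: PiE_iff)
  have T_comp: "src G (g i) = rng G (g (Suc i))" if "g \<in> topspace ?T" "1 \<le> i" "i < n" for g i
    using that by auto
  have comp_v: "v g j = rng G (g (Suc j))" if "g \<in> topspace ?T" "j < n" for g j
    using T_comp[OF that(1), of j] that(2) by (cases j) (auto simp: v_def)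
  have a_props: "a g j \<in> arrows G \<and> rng G (a g j) = rng G (g 1) \<and> src G (a g j) = v g j"
    if "g \<in> topspace ?T" "j \<le> n" for g j
    using that(2)
  proof (induction j)
    case 0
    have "rng G (g 1) \<in> objects G" using T_in[OF that(1), of 1] assms rng_in by auto
    then show ?case by (simp add: a0 v_def unt_in rng_unt src_unt)
  next
    case (Suc j)
    have "g (Suc j) \<in> arrows G" using T_in[OF that(1)] Suc.prems by auto
    moreover have "v g j = rng G (g (Suc j))" using comp_v[OF that(1)] Suc.prems by auto
    ultimately show ?case using Suc
      by (simp add: aS mul_in rng_mul src_mul v_def)
  qed
  have mul_cont: "continuous_map X (Arr G) (\<lambda>x. mul G (p x) (q x))"
    if "continuous_map X (Arr G) p" "continuous_map X (Arr G) q"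
      "\<And>x. x \<in> topspace X \<Longrightarrow> src G (p x) = rng G (q x)" for X :: "(nat \<Rightarrow> 'g) topology" and p q
  proof -
    have "continuous_map X (subtopology (prod_topology (Arr G) (Arr G)) {(g, h). src G g = rng G h})
        (\<lambda>x. (p x, q x))"
      using that by (auto simp: continuous_map_in_subtopology continuous_map_pairwise comp_def)
    from continuous_map_compose[OF this mul_continuous] show ?thesis by (simp add: comp_def)
  qed
  have proj: "continuous_map ?T (Arr G) (\<lambda>g. g i)" if "1 \<le> i" "i \<le> n" for i
    by (rule continuous_map_from_subtopology, rule continuous_map_product_projection)
      (use that in auto)
  have a_cont: "continuous_map ?T (Arr G) (\<lambda>g. a g j)" if "j \<le> n" for j
    using that
  proof (induction j)
    case 0
    have "continuous_map ?T (Arr G) (unt G \<circ> (rng G \<circ> (\<lambda>g. g 1)))"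
      by (rule continuous_map_compose[OF continuous_map_compose[OF proj rng_continuous] unt_continuous])
        (use assms in auto)
    then show ?case by (simp add: a0 comp_def)
  next
    case (Suc j)
    show ?case unfolding aS
    proof (rule mul_cont)
      show "src G (a g j) = rng G (g (Suc j))" if "g \<in> topspace ?T" for g
        using a_props[OF that, of j] comp_v[OF that, of j] Suc.prems by auto
    qed (use Suc proj in auto)
  qed
  have gT: "mul G (ginv G (a g i)) (a g j) \<in> arrows G \<and>
      rng G (mul G (ginv G (a g i)) (a g j)) = v g i \<and>
      src G (mul G (ginv G (a g i)) (a g j)) = v g j"
    if "g \<in> topspace ?T" "i \<le> n" "j \<le> n" for g i j
    using a_props[OF that(1,2)] a_props[OF that(1,3)]
    by (simp add: mul_in ginv_in rng_ginv src_ginv rng_mul src_mul)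
  have g_cont: "continuous_map ?T (nerve G n) ?g"
    unfolding nerve_def continuous_map_in_subtopology
  proof (intro conjI)
    have "continuous_map ?T (Arr G) (\<lambda>g. mul G (ginv G (a g i)) (a g j))"
      if "i \<le> n" "j \<le> n" for i j
    proof (rule mul_cont)
      show "continuous_map ?T (Arr G) (\<lambda>g. ginv G (a g i))"
        using continuous_map_compose[OF a_cont[OF that(1)] ginv_continuous] by (simp add: comp_def)
      show "src G (ginv G (a g i)) = rng G (a g j)" if "g \<in> topspace ?T" for g
        using a_props[OF that \<open>i \<le> n\<close>] a_props[OF that \<open>j \<le> n\<close>] by (simp add: src_ginv)
    qed (rule a_cont[OF that(2)])
    then show "continuous_map ?T ?P ?g"
      by (auto simp: continuous_map_componentwise)
    show "?g \<in> topspace ?T \<rightarrow> {\<gamma>. pair_functor G n \<gamma>}"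
    proof
      fix g assume g: "g \<in> topspace ?T"
      have diag: "mul G (ginv G (a g i)) (a g i) = unt G (v g i)" if "i \<le> n" for i
        using a_props[OF g that] by (simp add: ginv_mul)
      have comp: "mul G (ginv G (a g i)) (a g k) =
          mul G (mul G (ginv G (a g i)) (a g j)) (mul G (ginv G (a g j)) (a g k))"
        if "i \<le> n" "j \<le> n" "k \<le> n" for i j k
      proof -
        note p = a_props[OF g that(1)] a_props[OF g that(2)] a_props[OF g that(3)]
        have "mul G (mul G (ginv G (a g i)) (a g j)) (mul G (ginv G (a g j)) (a g k)) =
            mul G (ginv G (a g i)) (mul G (a g j) (mul G (ginv G (a g j)) (a g k)))"
          using p by (intro mul_assoc) (auto simp: mul_in ginv_in rng_ginv src_ginv rng_mul)
        also have "mul G (a g j) (mul G (ginv G (a g j)) (a g k)) =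
            mul G (mul G (a g j) (ginv G (a g j))) (a g k)"
          using p by (intro mul_assoc[symmetric]) (auto simp: ginv_in rng_ginv src_ginv)
        also have "\<dots> = a g k"
          using p unt_mul[of "a g k"] by (simp add: mul_ginv)
        finally show ?thesis by simp
      qed
      have val: "?g g (i, j) = mul G (ginv G (a g i)) (a g j)" if "i \<le> n" "j \<le> n" for i j
        using that by simp
      have "pair_functor G n (?g g)"
        unfolding pair_functor_def
      proof (intro conjI allI impI)
        fix i assume i: "i \<le> n"
        show "?g g (i, i) = unt G (rng G (?g g (i, i)))"
          unfolding val[OF i i] using diag[OF i] gT[OF g i i] by metis
        fix j assume j: "j \<le> n"
        show "rng G (?g g (i, j)) = rng G (?g g (i, i))"
          unfolding val[OF i i] val[OF i j] using gT[OF g i i] gT[OF g i j] by metis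
        show "src G (?g g (i, j)) = rng G (?g g (j, j))"
          unfolding val[OF j j] val[OF i j] using gT[OF g j j] gT[OF g i j] by metis
        fix k assume k: "k \<le> n"
        show "?g g (i, k) = mul G (?g g (i, j)) (?g g (j, k))"
          unfolding val[OF i k] val[OF i j] val[OF j k] by (rule comp[OF i j k])
      qed
      then show "?g g \<in> {\<gamma>. pair_functor G n \<gamma>}" by simp
    qed
  qed
  have f_cont: "continuous_map (nerve G n) ?T ?f"
    unfolding continuous_map_in_subtopology
  proof (intro conjI)
    have "continuous_map (nerve G n) (Arr G) (\<lambda>\<gamma>. \<gamma> (i - 1, i))" if "1 \<le> i" "i \<le> n" for i
      unfolding nerve_def
      by (rule continuous_map_from_subtopology, rule continuous_map_product_projection)
        (use that in auto)
    then show "continuous_map (nerve G n) (product_topology (\<lambda>_. Arr G) {1..n}) ?f"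
      by (auto simp: continuous_map_componentwise)
    show "?f \<in> topspace (nerve G n) \<rightarrow> {g. \<forall>i\<in>{1..<n}. src G (g i) = rng G (g (Suc i))}"
    proof
      fix \<gamma> assume "\<gamma> \<in> topspace (nerve G n)"
      then have "pair_functor G n \<gamma>" by (simp add: nerve_def)
      then have F: "rng G (\<gamma> (i, j)) = rng G (\<gamma> (i, i)) \<and> src G (\<gamma> (i, j)) = rng G (\<gamma> (j, j))"
        if "i \<le> n" "j \<le> n" for i j using pair_functorD(2,3) that by metis
      have "src G (\<gamma> (i - 1, i)) = rng G (\<gamma> (i, Suc i))" if "1 \<le> i" "i < n" for i
        using F[of "i - 1" i] F[of i "Suc i"] that by simp
      then show "?f \<gamma> \<in> {g. \<forall>i\<in>{1..<n}. src G (g i) = rng G (g (Suc i))}" by simp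
    qed
  qed
  have "homeomorphic_maps (nerve G n) ?T ?f ?g"
    unfolding homeomorphic_maps_def
  proof (intro conjI ballI)
    fix \<gamma> assume \<gamma>: "\<gamma> \<in> topspace (nerve G n)"
    then have ext: "\<gamma> \<in> extensional (square n)" and pf: "pair_functor G n \<gamma>"
      and arr: "\<And>i j. i \<le> n \<Longrightarrow> j \<le> n \<Longrightarrow> \<gamma> (i, j) \<in> arrows G"
      by (auto simp: nerve_def PiE_iff)
    have F1: "\<gamma> (i, i) = unt G (rng G (\<gamma> (i, i)))" if "i \<le> n" for i
      by (rule pair_functorD(1)[OF pf that that])
    have F2: "rng G (\<gamma> (i, j)) = rng G (\<gamma> (i, i))" "src G (\<gamma> (i, j)) = rng G (\<gamma> (j, j))"
      if "i \<le> n" "j \<le> n" for i j using pair_functorD(2,3)[OF pf that] .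
    have F3: "mul G (\<gamma> (i, j)) (\<gamma> (j, k)) = \<gamma> (i, k)" if "i \<le> n" "j \<le> n" "k \<le> n" for i j k
      by (rule pair_functorD(4)[OF pf that])
    have aj: "a (?f \<gamma>) j = \<gamma> (0, j)" if "j \<le> n" for j
      using that
    proof (induction j)
      case 0
      have "rng G (?f \<gamma> 1) = rng G (\<gamma> (0, 0))" using assms F2(1)[of 0 1] by simp
      then show ?case unfolding a0 using F1[of 0] by (metis zero_le)
    next
      case (Suc j)
      then show ?case by (simp add: aS F3)
    qed
    have "mul G (ginv G (\<gamma> (0, i))) (\<gamma> (0, j)) = \<gamma> (i, j)" if "i \<le> n" "j \<le> n" for i j
    proof -
      have "mul G (ginv G (\<gamma> (0, i))) (mul G (\<gamma> (0, i)) (\<gamma> (i, j))) =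
          mul G (mul G (ginv G (\<gamma> (0, i))) (\<gamma> (0, i))) (\<gamma> (i, j))"
        using that arr F2(1)[of i j] F2(2)[of 0 i]
        by (intro mul_assoc[symmetric]) (auto simp: ginv_in src_ginv)
      also have "\<dots> = \<gamma> (i, j)"
        using that arr F2(1)[of i j] F2(2)[of 0 i] unt_mul[of "\<gamma> (i, j)"] by (simp add: ginv_mul)
      finally show ?thesis using that F3[of 0 i j] by simp
    qed
    with aj have eq: "mul G (ginv G (a (?f \<gamma>) i)) (a (?f \<gamma>) j) = \<gamma> (i, j)"
      if "i \<le> n" "j \<le> n" for i j
      using that by simp
    show "?g (?f \<gamma>) = \<gamma>"
    proof (rule extensionalityI[OF restrict_extensional ext])
      fix p assume "p \<in> square n"
      then show "?g (?f \<gamma>) p = \<gamma> p" using eq by (cases p) simp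
    qed
  next
    fix g assume g: "g \<in> topspace ?T"
    then have ext: "g \<in> extensional {1..n}" by (auto simp: PiE_iff)
    have eq: "mul G (ginv G (a g j)) (a g (Suc j)) = g (Suc j)" if "j < n" for j
    proof -
      note p = a_props[OF g, of j] comp_v[OF g that] T_in[OF g, of "Suc j"]
      have "mul G (ginv G (a g j)) (mul G (a g j) (g (Suc j))) =
          mul G (mul G (ginv G (a g j)) (a g j)) (g (Suc j))"
        using p that by (intro mul_assoc[symmetric]) (auto simp: ginv_in src_ginv)
      also have "\<dots> = g (Suc j)"
        using p that unt_mul[of "g (Suc j)"] by (simp add: ginv_mul)
      finally show ?thesis by (simp add: aS)
    qed
    show "?f (?g g) = g"
    proof (rule extensionalityI[OF restrict_extensional ext])
      fix i assume "i \<in> {1..n}"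
      then obtain j where "i = Suc j" "j < n" by (cases i) auto
      then show "?f (?g g) i = g i" using eq by simp
    qed
  qed (use f_cont g_cont in auto)
  then show ?thesis by (rule homeomorphic_maps_map[THEN iffD1, THEN conjunct1])
qed

section \<open>Real open covers\<close>

record ('g, 'j) cover_data =
  Idx :: "nat \<Rightarrow> 'j set"
  ibar :: "nat \<Rightarrow> 'j \<Rightarrow> 'j"
  Opn :: "nat \<Rightarrow> 'j \<Rightarrow> (nat \<times> nat \<Rightarrow> 'g) set"

definition real_open_cover :: "('x, 'g) groupoid_data \<Rightarrow> ('g, 'j) cover_data \<Rightarrow> bool" where
  "real_open_cover G U \<longleftrightarrow>
     (\<forall>n. (\<forall>j \<in> Idx U n. openin (nerve G n) (Opn U n j)) \<and>
          topspace (nerve G n) = (\<Union>j \<in> Idx U n. Opn U n j) \<and>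
          (\<forall>j \<in> Idx U n. ibar U n j \<in> Idx U n \<and> ibar U n (ibar U n j) = j \<and>
             Opn U n (ibar U n j) = nerve_rho G n ` Opn U n j))"

text \<open>\<open>\<sigma> p f\<close> is the map of index sets \<open>J_p \<rightarrow> J_m\<close> attached to \<open>f : [m] \<rightarrow> [p]\<close>.\<close>

definition truncated_simplicial ::
  "nat \<Rightarrow> ('g, 'j) cover_data \<Rightarrow> (nat \<Rightarrow> nat list \<Rightarrow> 'j \<Rightarrow> 'j) \<Rightarrow> bool" where
  "truncated_simplicial N U \<sigma> \<longleftrightarrow>
     (\<forall>p\<le>N. \<forall>j \<in> Idx U p. \<sigma> p (id_map p) j = j) \<and>
     (\<forall>m\<le>N. \<forall>p\<le>N. \<forall>f \<in> Hom_Delta m p. \<forall>j \<in> Idx U p.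
        \<sigma> p f j \<in> Idx U m \<and>
        \<sigma> p f (ibar U p j) = ibar U m (\<sigma> p f j) \<and>
        pull f ` Opn U p j \<subseteq> Opn U m (\<sigma> p f j) \<and>
        (\<forall>l\<le>N. \<forall>h \<in> Hom_Delta l m. \<sigma> p (after f h) j = \<sigma> m h (\<sigma> p f j)))"

definition admissible_covers ::
  "nat \<Rightarrow> ('x, 'g) groupoid_data \<Rightarrow> ('g, 'j) cover_data set" where
  "admissible_covers n G =
     {U. real_open_cover G U \<and> (\<exists>N\<ge>n + 1. \<exists>\<sigma>. truncated_simplicial N U \<sigma>)}"

definition refinement ::
  "('g, 'j) cover_data \<Rightarrow> ('g, 'j) cover_data \<Rightarrow> (nat \<Rightarrow> 'j \<Rightarrow> 'j) \<Rightarrow> bool" where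
  "refinement U V \<theta> \<longleftrightarrow>
     (\<forall>k. \<forall>i \<in> Idx V k. \<theta> k i \<in> Idx U k \<and> \<theta> k (ibar V k i) = ibar U k (\<theta> k i) \<and>
        Opn V k i \<subseteq> Opn U k (\<theta> k i))"

definition finer :: "('g, 'j) cover_data \<Rightarrow> ('g, 'j) cover_data \<Rightarrow> bool" where
  "finer U V \<longleftrightarrow> (\<exists>\<theta>. refinement U V \<theta>)"


section \<open>Real Cech cohomology\<close>

definition faces :: "nat \<Rightarrow> nat list set" where
  "faces n = (\<Union>k\<le>n. Hom_Delta' k n)"

definition Lam :: "('g, 'j) cover_data \<Rightarrow> nat \<Rightarrow> (nat list \<Rightarrow> 'j) set" where
  "Lam U n = (\<Pi>\<^sub>E \<phi> \<in> faces n. Idx U (dom_ord \<phi>))"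

definition lam_conj :: "('g, 'j) cover_data \<Rightarrow> nat \<Rightarrow> (nat list \<Rightarrow> 'j) \<Rightarrow> (nat list \<Rightarrow> 'j)" where
  "lam_conj U n l = (\<lambda>\<phi>\<in>faces n. ibar U (dom_ord \<phi>) (l \<phi>))"

definition lam_pull :: "nat list \<Rightarrow> (nat list \<Rightarrow> 'j) \<Rightarrow> (nat list \<Rightarrow> 'j)" where
  "lam_pull f l = (\<lambda>\<phi>\<in>faces (dom_ord f). l (after f \<phi>))"

definition Opn_lam ::
  "('x, 'g) groupoid_data \<Rightarrow> ('g, 'j) cover_data \<Rightarrow> nat \<Rightarrow> (nat list \<Rightarrow> 'j) \<Rightarrow>
   (nat \<times> nat \<Rightarrow> 'g) set" where
  "Opn_lam G U n l =
     {\<gamma> \<in> topspace (nerve G n). \<forall>\<phi>\<in>faces n. pull \<phi> \<gamma> \<in> Opn U (dom_ord \<phi>) (l \<phi>)}"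

type_synonym ('g, 's, 'j) cochain = "(nat list \<Rightarrow> 'j) \<Rightarrow> (nat \<times> nat \<Rightarrow> 'g) \<Rightarrow> 's"

definition CR ::
  "nat \<Rightarrow> ('x, 'g) groupoid_data \<Rightarrow> 's group_data \<Rightarrow> ('g, 'j) cover_data \<Rightarrow>
   ('g, 's, 'j) cochain monoid" where
  "CR n G S U = \<lparr>
     carrier = {c \<in> (\<Pi>\<^sub>E l \<in> Lam U n. \<Pi>\<^sub>E \<gamma> \<in> Opn_lam G U n l. carrier S).
        \<forall>l \<in> Lam U n.
          continuous_map (subtopology (nerve G n) (Opn_lam G U n l)) (top_of S) (c l) \<and>
          (\<forall>\<gamma> \<in> Opn_lam G U n l. c (lam_conj U n l) (nerve_rho G n \<gamma>) = bar S (c l \<gamma>))},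
     mult = (\<lambda>c d. \<lambda>l\<in>Lam U n. \<lambda>\<gamma>\<in>Opn_lam G U n l. c l \<gamma> \<otimes>\<^bsub>S\<^esub> d l \<gamma>),
     one = (\<lambda>l\<in>Lam U n. \<lambda>\<gamma>\<in>Opn_lam G U n l. \<one>\<^bsub>S\<^esub>)\<rparr>"

definition dif ::
  "nat \<Rightarrow> ('x, 'g) groupoid_data \<Rightarrow> 's group_data \<Rightarrow> ('g, 'j) cover_data \<Rightarrow>
   ('g, 's, 'j) cochain \<Rightarrow> ('g, 's, 'j) cochain" where
  "dif n G S U c = (\<lambda>l\<in>Lam U (n + 1). \<lambda>\<gamma>\<in>Opn_lam G U (n + 1) l.
     (\<Otimes>\<^bsub>S\<^esub>k\<in>{..n + 1}.
        c (lam_pull (eps n k) l) (pull (eps n k) \<gamma>) [^]\<^bsub>S\<^esub> ((-1) ^ k :: int)))"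

definition cocycles ::
  "nat \<Rightarrow> ('x, 'g) groupoid_data \<Rightarrow> 's group_data \<Rightarrow> ('g, 'j) cover_data \<Rightarrow>
   ('g, 's, 'j) cochain set" where
  "cocycles n G S U = {c \<in> carrier (CR n G S U). dif n G S U c = \<one>\<^bsub>CR (n + 1) G S U\<^esub>}"

definition coboundaries ::
  "nat \<Rightarrow> ('x, 'g) groupoid_data \<Rightarrow> 's group_data \<Rightarrow> ('g, 'j) cover_data \<Rightarrow>
   ('g, 's, 'j) cochain set" where
  "coboundaries n G S U =
     (case n of 0 \<Rightarrow> {\<one>\<^bsub>CR 0 G S U\<^esub>} | Suc m \<Rightarrow> dif m G S U ` carrier (CR m G S U))"

definition HR ::
  "nat \<Rightarrow> ('x, 'g) groupoid_data \<Rightarrow> 's group_data \<Rightarrow> ('g, 'j) cover_data \<Rightarrow>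
   ('g, 's, 'j) cochain set monoid" where
  "HR n G S U = (CR n G S U)\<lparr>carrier := cocycles n G S U\<rparr> Mod coboundaries n G S U"

definition refine_cochain ::
  "nat \<Rightarrow> ('x, 'g) groupoid_data \<Rightarrow> ('g, 'j) cover_data \<Rightarrow> (nat \<Rightarrow> 'j \<Rightarrow> 'j) \<Rightarrow>
   ('g, 's, 'j) cochain \<Rightarrow> ('g, 's, 'j) cochain" where
  "refine_cochain n G V \<theta> c =
     (\<lambda>l\<in>Lam V n. \<lambda>\<gamma>\<in>Opn_lam G V n l. c (\<lambda>\<phi>\<in>faces n. \<theta> (dom_ord \<phi>) (l \<phi>)) \<gamma>)"

text \<open>
  The map induced on cohomology by one (hence any) refinement map: the image of the coset \<open>a\<close>
  lies in a single coset of the coboundaries, which is recovered as a product of sets.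
\<close>

definition HR_restriction ::
  "nat \<Rightarrow> ('x, 'g) groupoid_data \<Rightarrow> 's group_data \<Rightarrow> ('g, 'j) cover_data \<Rightarrow>
   ('g, 'j) cover_data \<Rightarrow> ('g, 's, 'j) cochain set \<Rightarrow> ('g, 's, 'j) cochain set" where
  "HR_restriction n G S U V a =
     coboundaries n G S V <#>\<^bsub>CR n G S V\<^esub>
       (refine_cochain n G V (SOME \<theta>. refinement U V \<theta>) ` a)"

text \<open>
  The direct limit of a system of groups \<open>H i\<close> with maps \<open>f i j : H i \<rightarrow> H j\<close> for \<open>r i j\<close> over a
  directed preorder: germs of elements, multiplied by passing to a common upper bound.
\<close>

definition germ ::
  "'i set \<Rightarrow> ('i \<Rightarrow> 'i \<Rightarrow> bool) \<Rightarrow> ('i \<Rightarrow> 'a monoid) \<Rightarrow> ('i \<Rightarrow> 'i \<Rightarrow> 'a \<Rightarrow> 'a) \<Rightarrow>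
   'i \<Rightarrow> 'a \<Rightarrow> ('i \<times> 'a) set" where
  "germ I r H f i a =
     {(j, b). j \<in> I \<and> b \<in> carrier (H j) \<and> (\<exists>k\<in>I. r i k \<and> r j k \<and> f i k a = f j k b)}"

definition direct_limit ::
  "'i set \<Rightarrow> ('i \<Rightarrow> 'i \<Rightarrow> bool) \<Rightarrow> ('i \<Rightarrow> 'a monoid) \<Rightarrow> ('i \<Rightarrow> 'i \<Rightarrow> 'a \<Rightarrow> 'a) \<Rightarrow>
   ('i \<times> 'a) set monoid" where
  "direct_limit I r H f = \<lparr>
     carrier = {germ I r H f i a | i a. i \<in> I \<and> a \<in> carrier (H i)},
     mult = (\<lambda>A B. \<Union>{germ I r H f i (a \<otimes>\<^bsub>H i\<^esub> b) | i a b. (i, a) \<in> A \<and> (i, b) \<in> B}),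
     one = \<Union>{germ I r H f i \<one>\<^bsub>H i\<^esub> | i. i \<in> I}\<rparr>"

text \<open>
  The type \<open>'j\<close> is a universe for the index sets of the covers. If it is infinite and the arrow
  space embeds into it, then every admissible cover, with index sets of any size, has an
  admissible refinement indexed by subsets of \<open>'j\<close>.
\<close>

definition Cech_HR ::
  "'j itself \<Rightarrow> nat \<Rightarrow> ('x, 'g) groupoid_data \<Rightarrow> 's group_data \<Rightarrow>
   (('g, 'j) cover_data \<times> ('g, 's, 'j) cochain set) set monoid" where
  "Cech_HR T n G S =
     direct_limit (admissible_covers n G) finer (HR n G S) (HR_restriction n G S)"

end

theory Submission
  imports Defs
begin

text \<open>
  A cocycle of degree one on a cover is a family of continuous functions \<open>c\<^sub>i\<^sub>j\<close>, defined on the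
  arrows with range in \<open>U\<^sub>i\<close> and source in \<open>U\<^sub>j\<close>, with \<open>c\<^sub>i\<^sub>k(gh) = c\<^sub>i\<^sub>j(g) c\<^sub>j\<^sub>k(h)\<close>; composing an arrow
  with a unit shows that the cover of the arrow space plays no role. A space \<open>Z\<close> with the operations
  of a generalized homomorphism represents \<open>c\<close> if it has Real charts \<open>h\<^sub>i\<close> over the \<open>U\<^sub>i\<close> with
  \<open>g h\<^sub>j(s(g), t) = h\<^sub>i(r(g), c\<^sub>i\<^sub>j(g) t)\<close>. Gluing trivial bundles shows that every cocycle is represented,
  and local trivializations together with their conjugates under \<open>\<tau>\<close> show that every Real generalized
  homomorphism represents a cocycle on some cover. Two spaces which represent the same cocycle are
  isomorphic, the cocycles represented by \<open>Z\<close> on a given cover fill exactly one cohomology class,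
  charts restrict to finer covers, and a sum represents the product of the cocycles. Hence the
  isomorphism class of \<open>Z\<close> corresponds to the germ of the cohomology classes that \<open>Z\<close> represents.
\<close>

text \<open>The link between the two groups is the relation \<open>represents Z U c\<close>,
  formulated for \<open>Z\<close> over an arbitrary type of points. Sums change that type, so the
  two bracketings of a triple sum, for instance, are compared through a cocycle which both represent
  and not through a map between nested quotients. For fixed \<open>Z\<close> and \<open>U\<close>
  the represented cocycles are either none or a full cohomology class, and the collection of these
  classes over all admissible covers is literally the element of the direct limit attached to
  \<open>Z\<close>. Both group structures can therefore be computed with equalities of sets. The
  embedding \<open>\<kappa>\<close> provides points in \<open>'z\<close> for a bundle glued from a
  cocycle. The embedding \<open>\<iota>\<close> and the infinitude of \<open>'j\<close> provide
  indices: a trivialization and its conjugate for every object, tuples of indices for the higher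
  degrees of a cover, pairs of indices for common refinements.\<close>

lemma continuous_map_locallyI:
  assumes "\<And>x. x \<in> topspace X \<Longrightarrow>
    \<exists>W g. openin X W \<and> x \<in> W \<and> continuous_map (subtopology X W) Y g \<and> (\<forall>y\<in>W. f y = g y)"
  shows "continuous_map X Y f"
proof -
  let ?I = "{W. openin X W \<and> continuous_map (subtopology X W) Y f}"
  show ?thesis
  proof (rule pasting_lemma[of ?I X "\<lambda>W. W" Y "\<lambda>_. f"])
    fix x assume "x \<in> topspace X"
    then obtain W g where W: "openin X W" "x \<in> W" "continuous_map (subtopology X W) Y g"
      "\<forall>y\<in>W. f y = g y" using assms by blast
    have "continuous_map (subtopology X W) Y f"
      by (rule continuous_map_eq[OF W(3)]) (use W(4) in auto)
    then show "\<exists>j. j \<in> ?I \<and> x \<in> j \<and> f x = f x" using W by auto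
  qed auto
qed

locale real_groupoid_with_coefficients =
  real_groupoid G + abelian_real_group S
  for G :: "('x, 'g) groupoid_data" and S :: "'s group_data" (structure)
begin

section \<open>Arrows and the nerve in low degrees\<close>

abbreviation "\<rho> \<equiv> rho_obj G"

lemma unt_in [simp]: "x \<in> objects G \<Longrightarrow> unt G x \<in> arrows G"
  using unt_continuous by (auto simp: continuous_map_def)

lemma rng_in [simp]: "g \<in> arrows G \<Longrightarrow> rng G g \<in> objects G"
  using rng_continuous by (auto simp: continuous_map_def)

lemma src_in [simp]: "g \<in> arrows G \<Longrightarrow> src G g \<in> objects G"
  using src_continuous by (auto simp: continuous_map_def)

lemma ginv_in [simp]: "g \<in> arrows G \<Longrightarrow> ginv G g \<in> arrows G"
  using ginv_continuous by (auto simp: continuous_map_def)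

lemma rho_in [simp]: "g \<in> arrows G \<Longrightarrow> rho G g \<in> arrows G"
  using rho_involution by (auto simp: homeomorphic_maps_def continuous_map_def)

lemma rho_rho [simp]: "g \<in> arrows G \<Longrightarrow> rho G (rho G g) = g"
  using rho_involution by (auto simp: homeomorphic_maps_def)

lemma mul_in [simp]:
  assumes "g \<in> arrows G" "h \<in> arrows G" "src G g = rng G h"
  shows "mul G g h \<in> arrows G"
proof -
  have "(\<lambda>(g, h). mul G g h) (g, h) \<in> arrows G"
    by (rule funcset_mem[OF continuous_map_funspace[OF mul_continuous]]) (use assms in simp)
  then show ?thesis by simp
qed

declare rng_unt [simp] src_unt [simp] unt_mul [simp] mul_unt [simp] rng_ginv [simp] src_ginv [simp]
  rng_rho [simp] src_rho [simp] rng_mul [simp] src_mul [simp] mul_ginv [simp] ginv_mul [simp]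

lemma rho_obj_in [simp]: "x \<in> objects G \<Longrightarrow> \<rho> x \<in> objects G"
  by (simp add: rho_obj_def del: rng_rho src_rho)

lemma rho_unt' [simp]: "x \<in> objects G \<Longrightarrow> rho G (unt G x) = unt G (\<rho> x)"
  by (rule rho_unt)

lemma rho_obj_rho_obj [simp]: "x \<in> objects G \<Longrightarrow> \<rho> (\<rho> x) = x"
  by (metis rho_rho rho_unt' rho_obj_in rng_unt unt_in)

lemma rho_obj_continuous: "continuous_map (Obj G) (Obj G) \<rho>"
proof -
  have "continuous_map (Arr G) (Arr G) (rho G)"
    using rho_involution by (simp add: homeomorphic_maps_def)
  from continuous_map_compose[OF unt_continuous this]
  have "continuous_map (Obj G) (Obj G) (rng G \<circ> (rho G \<circ> unt G))"
    using rng_continuous by (rule continuous_map_compose)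
  then show ?thesis by (simp add: rho_obj_def[abs_def] comp_def)
qed

text \<open>Functoriality of \<open>rho\<close> is given on products and units; the statement for
  inverses follows by cancelling \<open>rho G g\<close> on the left.\<close>

lemma rho_ginv: "g \<in> arrows G \<Longrightarrow> rho G (ginv G g) = ginv G (rho G g)"
proof -
  assume g: "g \<in> arrows G"
  have "mul G (ginv G (rho G g)) (mul G (rho G g) (rho G (ginv G g))) =
      mul G (mul G (ginv G (rho G g)) (rho G g)) (rho G (ginv G g))"
    using g by (intro mul_assoc[symmetric]) auto
  also have "\<dots> = rho G (ginv G g)"
    using g unt_mul[of "rho G (ginv G g)"] by simp
  also have "mul G (rho G g) (rho G (ginv G g)) = unt G (\<rho> (rng G g))"
    using g rho_mul[of g "ginv G g"] by simp
  finally show ?thesis using g mul_unt[of "ginv G (rho G g)"] by simp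
qed

section \<open>The involution and continuity in the coefficient group\<close>

lemma bar_in [simp]: "t \<in> carrier S \<Longrightarrow> bar S t \<in> carrier S"
  using bar_hom by (auto simp: hom_def)

lemma bar_mult [simp]:
  "s \<in> carrier S \<Longrightarrow> t \<in> carrier S \<Longrightarrow> bar S (s \<otimes> t) = bar S s \<otimes> bar S t"
  using bar_hom by (auto simp: hom_def)

lemma bar_bar [simp]: "t \<in> carrier S \<Longrightarrow> bar S (bar S t) = t"
  using bar_involution by (auto simp: homeomorphic_maps_def topspace_top_of)

lemma bar_one [simp]: "bar S \<one> = \<one>"
  using bar_hom by (metis hom_one is_group)

lemma bar_inv [simp]: "t \<in> carrier S \<Longrightarrow> bar S (inv t) = inv (bar S t)"
  by (metis bar_in bar_mult bar_one inv_closed inv_equality l_inv)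

lemma bar_continuous: "continuous_map (top_of S) (top_of S) (bar S)"
  using bar_involution by (simp add: homeomorphic_maps_def)

lemma mult_inv_cancel [simp]:
  "s \<in> carrier S \<Longrightarrow> t \<in> carrier S \<Longrightarrow> s \<otimes> (inv s \<otimes> t) = t"
  "s \<in> carrier S \<Longrightarrow> t \<in> carrier S \<Longrightarrow> inv s \<otimes> (s \<otimes> t) = t"
  by (simp_all add: m_assoc[symmetric])

lemma continuous_map_mult:
  assumes "continuous_map X (top_of S) f" "continuous_map X (top_of S) g"
  shows "continuous_map X (top_of S) (\<lambda>x. f x \<otimes> g x)"
  using continuous_map_compose[OF _ mult_continuous, of X "\<lambda>x. (f x, g x)"] assms
  by (simp add: continuous_map_pairwise comp_def)

lemma continuous_map_inv:
  assumes "continuous_map X (top_of S) f"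
  shows "continuous_map X (top_of S) (\<lambda>x. inv (f x))"
  using continuous_map_compose[OF assms inv_continuous] by (simp add: comp_def)

lemma continuous_map_bar:
  assumes "continuous_map X (top_of S) f"
  shows "continuous_map X (top_of S) (\<lambda>x. bar S (f x))"
  using continuous_map_compose[OF assms bar_continuous] by (simp add: comp_def)

text \<open>Inverse of the homeomorphism \<open>nerve_0\<close>; points of the nerve are extensional
  functions, hence the \<open>restrict\<close>. Together with \<open>edge\<close>, its analogue for
  a single arrow, it turns statements about degrees 0 and 1 of the nerve into statements about
  objects and arrows.\<close>

definition vertex :: "'x \<Rightarrow> nat \<times> nat \<Rightarrow> 'g" where
  "vertex x = restrict (\<lambda>_. unt G x) (square 0)"

definition edge :: "'g \<Rightarrow> nat \<times> nat \<Rightarrow> 'g" where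
  "edge g = restrict (\<lambda>(i, j). if i = 0 then if j = 0 then unt G (rng G g) else g
     else if j = 0 then ginv G g else unt G (src G g)) (square 1)"

lemma nerve_in: "\<gamma> \<in> topspace (nerve G n) \<Longrightarrow> i \<le> n \<Longrightarrow> j \<le> n \<Longrightarrow> \<gamma> (i, j) \<in> arrows G"
  by (auto simp: nerve_def PiE_iff)

lemma nerve_pair_functor: "\<gamma> \<in> topspace (nerve G n) \<Longrightarrow> pair_functor G n \<gamma>"
  by (auto simp: nerve_def)

lemma nerveI:
  "\<gamma> \<in> extensional (square n) \<Longrightarrow> (\<And>i j. i \<le> n \<Longrightarrow> j \<le> n \<Longrightarrow> \<gamma> (i, j) \<in> arrows G) \<Longrightarrow>
    pair_functor G n \<gamma> \<Longrightarrow> \<gamma> \<in> topspace (nerve G n)"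
  by (auto simp: nerve_def PiE_iff)

lemma vertex_in [simp]: "x \<in> objects G \<Longrightarrow> vertex x \<in> topspace (nerve G 0)"
  using unt_mul[of "unt G x"] by (intro nerveI) (auto simp: vertex_def pair_functor_def)

lemma nat_le_1: "i \<le> Suc 0 \<longleftrightarrow> i = 0 \<or> i = 1" for i :: nat
  by auto

lemma edge_in [simp]: "g \<in> arrows G \<Longrightarrow> edge g \<in> topspace (nerve G 1)"
proof (rule nerveI)
  assume g: "g \<in> arrows G"
  then show "edge g (i, j) \<in> arrows G" if "i \<le> 1" "j \<le> 1" for i j
    using that by (auto simp: edge_def)
  have 1: "mul G (edge g (i, j)) (edge g (j, k)) = edge g (i, k)"
    if "i \<le> 1" "j \<le> 1" "k \<le> 1" for i j k
  proof -
    have "i = 0 \<or> i = 1" "j = 0 \<or> j = 1" "k = 0 \<or> k = 1" using that by auto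
    then show ?thesis
      using g unt_mul[of "ginv G g"] mul_unt[of "ginv G g"] unt_mul[of "unt G (rng G g)"]
        unt_mul[of "unt G (src G g)"]
      by (elim disjE) (simp_all add: edge_def)
  qed
  have 2: "edge g (i, i) = unt G (rng G (edge g (i, i)))"
    "rng G (edge g (i, j)) = rng G (edge g (i, i))"
    "src G (edge g (i, j)) = rng G (edge g (j, j))" if "i \<le> 1" "j \<le> 1" for i j
  proof -
    have "i = 0 \<or> i = 1" "j = 0 \<or> j = 1" using that by auto
    then show "edge g (i, i) = unt G (rng G (edge g (i, i)))"
      "rng G (edge g (i, j)) = rng G (edge g (i, i))"
      "src G (edge g (i, j)) = rng G (edge g (j, j))"
      using g by (elim disjE; simp add: edge_def)+
  qed
  show "pair_functor G 1 (edge g)"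
    unfolding pair_functor_def using 1 2 by metis
qed (simp add: edge_def)

lemmas edge_in_Suc [simp] = edge_in[unfolded One_nat_def]

lemma vertex_apply: "x \<in> objects G \<Longrightarrow> rng G (vertex x (0, 0)) = x"
  by (simp add: vertex_def)

lemma edge_apply [simp]: "edge g (0, Suc 0) = g"
  by (simp add: edge_def)

lemma nerve0_eq:
  assumes "\<gamma> \<in> topspace (nerve G 0)" shows "\<gamma> = vertex (rng G (\<gamma> (0, 0)))"
proof (rule extensionalityI[of _ "square 0"])
  show "\<gamma> \<in> extensional (square 0)" using assms by (auto simp: nerve_def PiE_def)
  show "\<gamma> p = vertex (rng G (\<gamma> (0, 0))) p" if "p \<in> square 0" for p
    using that pair_functorD(1)[OF nerve_pair_functor[OF assms], of 0 0] by (simp add: vertex_def)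
qed (simp add: vertex_def)

text \<open>Composition gives \<gamma>(i, j)\<gamma>(j, i) = \<gamma>(i, i), which is a unit. Hence
  an element of degree 1 is determined by its entry at (0, 1), see \<open>nerve1_eq\<close>.\<close>

lemma pair_functor_ginv:
  assumes "\<gamma> \<in> topspace (nerve G n)" "i \<le> n" "j \<le> n"
  shows "\<gamma> (j, i) = ginv G (\<gamma> (i, j))"
proof -
  note p = pair_functorD[OF nerve_pair_functor[OF assms(1)]]
  have in_arr: "\<gamma> (i, j) \<in> arrows G" "\<gamma> (j, i) \<in> arrows G" using assms nerve_in by auto
  have e: "mul G (\<gamma> (i, j)) (\<gamma> (j, i)) = \<gamma> (i, i)" using p(4) assms by metis
  have s: "src G (\<gamma> (i, j)) = rng G (\<gamma> (j, j))" "rng G (\<gamma> (j, i)) = rng G (\<gamma> (j, j))"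
    "\<gamma> (i, i) = unt G (rng G (\<gamma> (i, i)))" "rng G (\<gamma> (i, j)) = rng G (\<gamma> (i, i))"
    using p assms by metis+
  have "mul G (ginv G (\<gamma> (i, j))) (mul G (\<gamma> (i, j)) (\<gamma> (j, i)))
      = mul G (mul G (ginv G (\<gamma> (i, j))) (\<gamma> (i, j))) (\<gamma> (j, i))"
    using in_arr s by (intro mul_assoc[symmetric]) auto
  also have "\<dots> = \<gamma> (j, i)" using in_arr s unt_mul[of "\<gamma> (j, i)"] by simp
  finally have "mul G (ginv G (\<gamma> (i, j))) (\<gamma> (i, i)) = \<gamma> (j, i)" unfolding e .
  moreover have "mul G (ginv G (\<gamma> (i, j))) (\<gamma> (i, i)) = ginv G (\<gamma> (i, j))"
    using in_arr s mul_unt[of "ginv G (\<gamma> (i, j))"] by simp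
  ultimately show ?thesis by simp
qed

lemma nerve1_eq:
  assumes "\<gamma> \<in> topspace (nerve G 1)" shows "\<gamma> = edge (\<gamma> (0, 1))"
proof (rule extensionalityI[of _ "square 1"])
  note p = pair_functorD[OF nerve_pair_functor[OF assms]]
  show "\<gamma> \<in> extensional (square 1)" using assms by (auto simp: nerve_def PiE_def)
  show "edge (\<gamma> (0, 1)) \<in> extensional (square 1)" by (simp add: edge_def)
  have "\<gamma> (0, 0) = unt G (rng G (\<gamma> (0, 1)))" "\<gamma> (1, 1) = unt G (src G (\<gamma> (0, 1)))"
    using p by (metis le_refl zero_le)+
  then show "\<gamma> q = edge (\<gamma> (0, 1)) q" if "q \<in> square 1" for q
    using that pair_functor_ginv[OF assms, of 0 1] by (auto simp: edge_def nat_le_1)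
qed

lemma vertex_continuous: "continuous_map (Obj G) (nerve G 0) vertex"
  unfolding nerve_def continuous_map_in_subtopology
proof
  show "continuous_map (Obj G) (product_topology (\<lambda>_. Arr G) (square 0)) vertex"
    unfolding vertex_def
    by (auto simp: continuous_map_componentwise unt_continuous[unfolded eta_contract_eq])
  show "vertex \<in> topspace (Obj G) \<rightarrow> {\<gamma>. pair_functor G 0 \<gamma>}"
    using nerve_pair_functor vertex_in by blast
qed

lemma edge_continuous: "continuous_map (Arr G) (nerve G 1) edge"
  unfolding nerve_def continuous_map_in_subtopology
proof
  have "continuous_map (Arr G) (Arr G) (\<lambda>g. unt G (rng G g))"
    "continuous_map (Arr G) (Arr G) (\<lambda>g. unt G (src G g))"
    using continuous_map_compose[OF rng_continuous unt_continuous]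
      continuous_map_compose[OF src_continuous unt_continuous] by (simp_all add: comp_def)
  then have "continuous_map (Arr G) (Arr G) (\<lambda>g. edge g q)" if "q \<in> square 1" for q
    using that ginv_continuous by (cases q) (auto simp: edge_def nat_le_1 eta_contract_eq)
  then show "continuous_map (Arr G) (product_topology (\<lambda>_. Arr G) (square 1)) edge"
    by (auto simp: continuous_map_componentwise edge_def)
  show "edge \<in> topspace (Arr G) \<rightarrow> {\<gamma>. pair_functor G 1 \<gamma>}"
    using nerve_pair_functor edge_in by blast
qed

lemma nerve_apply_continuous:
  "i \<le> n \<Longrightarrow> j \<le> n \<Longrightarrow> continuous_map (nerve G n) (Arr G) (\<lambda>\<gamma>. \<gamma> (i, j))"
  unfolding nerve_def
  by (rule continuous_map_from_subtopology, rule continuous_map_product_projection) auto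

section \<open>Pulling simplices back along maps of ordinals\<close>

lemma nth_le_if_set_subset:
  assumes "set f \<subseteq> {..n}" "f \<noteq> []" "i \<le> dom_ord f"
  shows "f ! i \<le> n"
proof -
  have "i < length f" using assms(2,3) by (cases f) (auto simp: dom_ord_def)
  then show ?thesis using assms(1) nth_mem by blast
qed

text \<open>Contravariant functoriality. The bound on \<open>h\<close> keeps \<open>nth\<close>
  within the list \<open>f\<close>, and \<open>h \<noteq> []\<close> is asked because
  \<open>dom_ord\<close> is a truncated difference, which is 0 for the empty list.\<close>

lemma pull_pull:
  assumes "set h \<subseteq> {..dom_ord f}" "h \<noteq> []"
  shows "pull h (pull f \<gamma>) = pull (after f h) \<gamma>"
proof -
  have "h ! i \<le> dom_ord f" if "i \<le> dom_ord h" for i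
    by (rule nth_le_if_set_subset[OF assms that])
  moreover have "i < length h" if "i \<le> dom_ord h" for i
    using that assms(2) by (cases h) (auto simp: dom_ord_def)
  moreover have "dom_ord (after f h) = dom_ord h" by (simp add: dom_ord_def after_def)
  ultimately show ?thesis
    by (auto simp: pull_def fun_eq_iff restrict_def after_def)
qed

lemma pull_in:
  assumes "\<gamma> \<in> topspace (nerve G n)" "set f \<subseteq> {..n}" "f \<noteq> []"
  shows "pull f \<gamma> \<in> topspace (nerve G (dom_ord f))"
proof (rule nerveI)
  have f: "f ! i \<le> n" if "i \<le> dom_ord f" for i
    by (rule nth_le_if_set_subset[OF assms(2,3) that])
  then show "pull f \<gamma> (i, j) \<in> arrows G" if "i \<le> dom_ord f" "j \<le> dom_ord f" for i j
    using that nerve_in[OF assms(1)] by (auto simp: pull_def)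
  note p = pair_functorD[OF nerve_pair_functor[OF assms(1)]]
  show "pair_functor G (dom_ord f) (pull f \<gamma>)"
    unfolding pair_functor_def
  proof (intro conjI allI impI)
    fix i assume i: "i \<le> dom_ord f"
    show "pull f \<gamma> (i, i) = unt G (rng G (pull f \<gamma> (i, i)))"
      using i p(1)[OF f[OF i] f[OF i]] by (simp add: pull_def)
    fix j assume j: "j \<le> dom_ord f"
    show "rng G (pull f \<gamma> (i, j)) = rng G (pull f \<gamma> (i, i))"
      using i j p(2)[OF f[OF i] f[OF j]] by (simp add: pull_def)
    show "src G (pull f \<gamma> (i, j)) = rng G (pull f \<gamma> (j, j))"
      using i j p(3)[OF f[OF i] f[OF j]] by (simp add: pull_def)
    fix k assume k: "k \<le> dom_ord f"
    show "pull f \<gamma> (i, k) = mul G (pull f \<gamma> (i, j)) (pull f \<gamma> (j, k))"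
      using i j k p(4)[OF f[OF i] f[OF j] f[OF k]] by (simp add: pull_def)
  qed
qed (simp add: pull_def)

lemma pull_continuous:
  assumes "set f \<subseteq> {..n}" "f \<noteq> []"
  shows "continuous_map (nerve G n) (nerve G (dom_ord f)) (pull f)"
proof -
  have f: "f ! i \<le> n" if "i \<le> dom_ord f" for i
    by (rule nth_le_if_set_subset[OF assms that])
  have "continuous_map (nerve G n) (product_topology (\<lambda>_. Arr G) (square (dom_ord f))) (pull f)"
    unfolding continuous_map_componentwise
    by (auto simp: pull_def nerve_apply_continuous f)
  then show ?thesis
    using pull_in[OF _ assms] unfolding nerve_def[of G "dom_ord f"] continuous_map_in_subtopology
    by (auto simp: nerve_def)
qed

lemma nerve_rho_in:
  assumes "\<gamma> \<in> topspace (nerve G n)" shows "nerve_rho G n \<gamma> \<in> topspace (nerve G n)"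
proof (rule nerveI)
  note p = pair_functorD[OF nerve_pair_functor[OF assms]]
  have a: "\<gamma> (i, j) \<in> arrows G" if "i \<le> n" "j \<le> n" for i j using assms nerve_in that by auto
  show "pair_functor G n (nerve_rho G n \<gamma>)"
    unfolding pair_functor_def
  proof (intro conjI allI impI)
    fix i assume i: "i \<le> n"
    show "nerve_rho G n \<gamma> (i, i) = unt G (rng G (nerve_rho G n \<gamma> (i, i)))"
      using i a[OF i i] rho_unt'[of "rng G (\<gamma> (i,i))"] p(1)[OF i i] by (simp add: nerve_rho_def)
    fix j assume j: "j \<le> n"
    show "rng G (nerve_rho G n \<gamma> (i, j)) = rng G (nerve_rho G n \<gamma> (i, i))"
      using i j a p(2)[OF i j] by (simp add: nerve_rho_def)
    show "src G (nerve_rho G n \<gamma> (i, j)) = rng G (nerve_rho G n \<gamma> (j, j))"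
      using i j a p(3)[OF i j] by (simp add: nerve_rho_def)
    fix k assume k: "k \<le> n"
    have "src G (\<gamma> (i, j)) = rng G (\<gamma> (j, k))" using p(2)[OF j k] p(3)[OF i j] by simp
    then show "nerve_rho G n \<gamma> (i, k) = mul G (nerve_rho G n \<gamma> (i, j)) (nerve_rho G n \<gamma> (j, k))"
      using i j k a p(4)[OF i j k] rho_mul[of "\<gamma> (i, j)" "\<gamma> (j, k)"] by (simp add: nerve_rho_def)
  qed
qed (use assms nerve_in in \<open>auto simp: nerve_rho_def\<close>)

lemma nerve_rho_nerve_rho:
  assumes "\<gamma> \<in> topspace (nerve G n)" shows "nerve_rho G n (nerve_rho G n \<gamma>) = \<gamma>"
proof (rule extensionalityI[of _ "square n"])
  show "\<gamma> \<in> extensional (square n)" using assms by (auto simp: nerve_def PiE_def)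
qed (use assms nerve_in in \<open>auto simp: nerve_rho_def\<close>)

lemma pull_nerve_rho:
  assumes "set f \<subseteq> {..n}" "f \<noteq> []"
  shows "pull f (nerve_rho G n \<gamma>) = nerve_rho G (dom_ord f) (pull f \<gamma>)"
proof -
  have "f ! i \<le> n" if "i \<le> dom_ord f" for i
    by (rule nth_le_if_set_subset[OF assms that])
  then show ?thesis by (auto simp: pull_def nerve_rho_def fun_eq_iff restrict_def)
qed

lemma nerve_rho_vertex: "x \<in> objects G \<Longrightarrow> nerve_rho G 0 (vertex x) = vertex (\<rho> x)"
  by (auto simp: nerve_rho_def vertex_def fun_eq_iff restrict_def)

lemma nerve_rho_edge: "g \<in> arrows G \<Longrightarrow> nerve_rho G 1 (edge g) = edge (rho G g)"
  by (auto simp: nerve_rho_def edge_def fun_eq_iff restrict_def rho_ginv)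

lemma pull_vertex:
  assumes "\<gamma> \<in> topspace (nerve G n)" "k \<le> n"
  shows "pull [k] \<gamma> = vertex (rng G (\<gamma> (k, k)))"
proof -
  have "pull [k] \<gamma> \<in> topspace (nerve G 0)"
    using pull_in[of \<gamma> n "[k]"] assms by (simp add: dom_ord_def)
  from nerve0_eq[OF this] show ?thesis by (simp add: pull_def dom_ord_def)
qed

lemma pull_edge:
  assumes "\<gamma> \<in> topspace (nerve G n)" "j \<le> n" "k \<le> n"
  shows "pull [j, k] \<gamma> = edge (\<gamma> (j, k))"
proof -
  have "pull [j, k] \<gamma> \<in> topspace (nerve G 1)"
    using pull_in[of \<gamma> n "[j, k]"] assms by (simp add: dom_ord_def)
  from nerve1_eq[OF this] show ?thesis by (simp add: pull_def dom_ord_def)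
qed

lemma pull_edge_simps [simp]:
  assumes "g \<in> arrows G"
  shows "pull [0] (edge g) = vertex (rng G g)" "pull [Suc 0] (edge g) = vertex (src G g)"
    "pull [0, Suc 0] (edge g) = edge g"
  using assms pull_vertex[OF edge_in, of g 0] pull_vertex[OF edge_in, of g 1]
    pull_edge[OF edge_in, of g 0 1]
  by (simp_all add: edge_def)

lemma pull_vertex_simp [simp]: "x \<in> objects G \<Longrightarrow> pull [0] (vertex x) = vertex x"
  using pull_vertex[OF vertex_in, of x 0] by (simp add: vertex_apply)

text \<open>Surjectivity in \<open>nerve_tuples\<close> for n = 2 extends a composable pair to a
  2-simplex, whose third edge and vertices are forced by functoriality. These are the simplices on
  which the cocycle identity is evaluated.\<close>

lemma nerve2_exists:
  assumes "g \<in> arrows G" "h \<in> arrows G" "src G g = rng G h"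
  obtains \<gamma> where "\<gamma> \<in> topspace (nerve G 2)" "pull [0, 1] \<gamma> = edge g" "pull [1, 2] \<gamma> = edge h"
    "pull [0, 2] \<gamma> = edge (mul G g h)"
    "pull [0] \<gamma> = vertex (rng G g)" "pull [1] \<gamma> = vertex (rng G h)" "pull [2] \<gamma> = vertex (src G h)"
proof -
  let ?T = "subtopology (product_topology (\<lambda>_. Arr G) {1..2})
       {g. \<forall>i\<in>{1..<2}. src G (g i) = rng G (g (Suc i))}"
  let ?a = "\<lambda>i\<in>{1..2::nat}. if i = 1 then g else h"
  have "?a \<in> topspace ?T" using assms by (auto simp: PiE_iff)
  moreover have "(\<lambda>\<gamma>. \<lambda>i\<in>{1..2}. \<gamma> (i - 1, i)) ` topspace (nerve G 2) = topspace ?T"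
    by (rule homeomorphic_imp_surjective_map[OF nerve_tuples]) simp
  ultimately have "?a \<in> (\<lambda>\<gamma>. \<lambda>i\<in>{1..2}. \<gamma> (i - 1, i)) ` topspace (nerve G 2)" by (rule ssubst[rotated])
  then obtain \<gamma> where \<gamma>: "\<gamma> \<in> topspace (nerve G 2)" and e: "(\<lambda>i\<in>{1..2}. \<gamma> (i - 1, i)) = ?a"
    by (elim imageE) (erule that, erule sym)
  have 1: "\<gamma> (0, 1) = g" "\<gamma> (1, 2) = h"
    using fun_cong[OF e, of 1] fun_cong[OF e, of 2] by auto
  note p = pair_functorD[OF nerve_pair_functor[OF \<gamma>]]
  have 2: "\<gamma> (0, 2) = mul G g h" using p(4)[of 0 1 2] 1 by simp
  have 3: "rng G (\<gamma> (0, 0)) = rng G g" "rng G (\<gamma> (1, 1)) = rng G h" "rng G (\<gamma> (2, 2)) = src G h"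
    using p(2)[of 0 1] p(2)[of 1 2] p(3)[of 1 2] 1 by simp_all
  show ?thesis
  proof (rule that[OF \<gamma>])
    show "pull [0, 1] \<gamma> = edge g" using pull_edge[OF \<gamma>, of 0 1] 1 by simp
    show "pull [1, 2] \<gamma> = edge h" using pull_edge[OF \<gamma>, of 1 2] 1 by simp
    show "pull [0, 2] \<gamma> = edge (mul G g h)" using pull_edge[OF \<gamma>, of 0 2] 2 by simp
    show "pull [0] \<gamma> = vertex (rng G g)" using pull_vertex[OF \<gamma>, of 0] 3 by simp
    show "pull [1] \<gamma> = vertex (rng G h)" using pull_vertex[OF \<gamma>, of 1] 3 by simp
    show "pull [2] \<gamma> = vertex (src G h)" using pull_vertex[OF \<gamma>, of 2] 3 by simp
  qed
qed


section \<open>Cech cocycles of degree one\<close>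

lemma facesI: "k \<le> n \<Longrightarrow> \<phi> \<in> Hom_Delta' k n \<Longrightarrow> \<phi> \<in> faces n"
  by (auto simp: faces_def)

lemma dom_ord_Hom_Delta': "\<phi> \<in> Hom_Delta' k n \<Longrightarrow> dom_ord \<phi> = k"
  by (simp add: Hom_Delta'_def dom_ord_def)

lemma facesD:
  assumes "\<phi> \<in> faces n"
  shows "\<phi> \<noteq> []" "set \<phi> \<subseteq> {..n}" "dom_ord \<phi> \<le> n" "\<phi> \<in> Hom_Delta' (dom_ord \<phi>) n"
  using assms by (auto simp: faces_def Hom_Delta'_def dom_ord_def)

lemma face_singleton [simp]: "k \<le> n \<Longrightarrow> [k] \<in> faces n"
  by (rule facesI[of 0]) (auto simp: Hom_Delta'_def)

lemma face_pair [simp]: "j < k \<Longrightarrow> k \<le> n \<Longrightarrow> [j, k] \<in> faces n"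
  by (rule facesI[of 1]) (auto simp: Hom_Delta'_def)

lemma face_pair_1 [simp]: "[0, Suc 0] \<in> faces (Suc 0)"
  by (rule face_pair) auto

lemma faces_0: "faces 0 = {[0]}"
  by (auto simp: faces_def Hom_Delta'_def length_Suc_conv)

lemma faces_1: "faces (Suc 0) = {[0], [Suc 0], [0, Suc 0]}"
proof
  show "faces (Suc 0) \<subseteq> {[0], [Suc 0], [0, Suc 0]}"
  proof
    fix \<phi> assume "\<phi> \<in> faces (Suc 0)"
    then obtain k where "k = 0 \<or> k = 1" "\<phi> \<in> Hom_Delta' k (Suc 0)"
      by (auto simp: faces_def nat_le_1)
    then show "\<phi> \<in> {[0], [Suc 0], [0, Suc 0]}"
      by (auto simp: Hom_Delta'_def length_Suc_conv nat_le_1)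
  qed
qed auto

lemma after_Hom_Delta':
  assumes "f \<in> Hom_Delta' m n" "\<phi> \<in> Hom_Delta' k m"
  shows "after f \<phi> \<in> Hom_Delta' k n"
proof -
  have *: "i < length f" if "i \<in> set \<phi>" for i
    using that assms by (auto simp: Hom_Delta'_def less_Suc_eq_le)
  have "sorted_wrt (\<lambda>x y. f ! x < f ! y) \<phi>"
    by (rule sorted_wrt_mono_rel[of \<phi> "(<)"])
      (use assms * in \<open>auto simp: Hom_Delta'_def intro: sorted_wrt_nth_less\<close>)
  moreover have "f ! i \<le> n" if "i \<in> set \<phi>" for i
    using nth_mem[OF *[OF that]] assms by (auto simp: Hom_Delta'_def)
  ultimately show ?thesis
    using assms by (auto simp: Hom_Delta'_def after_def sorted_wrt_map)
qed

lemma after_faces: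
  assumes "f \<in> Hom_Delta' m n" "m \<le> n" "\<phi> \<in> faces m"
  shows "after f \<phi> \<in> faces n" "dom_ord (after f \<phi>) = dom_ord \<phi>"
proof -
  show "after f \<phi> \<in> faces n"
    using assms after_Hom_Delta'[OF assms(1)] unfolding faces_def by fastforce
qed (simp add: after_def dom_ord_def)

lemma lam_pull_in:
  assumes "f \<in> Hom_Delta' m n" "m \<le> n" "l \<in> Lam U n"
  shows "lam_pull f l \<in> Lam U m"
proof -
  have "l (after f \<phi>) \<in> Idx U (dom_ord \<phi>)" if "\<phi> \<in> faces m" for \<phi>
    using PiE_mem[OF assms(3)[unfolded Lam_def] after_faces(1)[OF assms(1,2) that]]
      after_faces(2)[OF assms(1,2) that] by simp
  then show ?thesis using dom_ord_Hom_Delta'[OF assms(1)] by (auto simp: lam_pull_def Lam_def)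
qed

lemma Opn_lam_pull:
  assumes "f \<in> Hom_Delta' m n" "m \<le> n" "\<gamma> \<in> Opn_lam G U n l"
  shows "pull f \<gamma> \<in> Opn_lam G U m (lam_pull f l)"
proof -
  have f: "f \<in> faces n" "dom_ord f = m" using assms by (auto intro: facesI simp: dom_ord_Hom_Delta')
  note fd = facesD[OF f(1)]
  have "pull \<phi> (pull f \<gamma>) \<in> Opn U (dom_ord \<phi>) (lam_pull f l \<phi>)" if "\<phi> \<in> faces m" for \<phi>
  proof -
    have "pull (after f \<phi>) \<gamma> \<in> Opn U (dom_ord \<phi>) (l (after f \<phi>))"
      using assms(3) after_faces[OF assms(1,2) that] by (auto simp: Opn_lam_def)
    moreover have "pull \<phi> (pull f \<gamma>) = pull (after f \<phi>) \<gamma>"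
      by (rule pull_pull) (use facesD[OF that] f(2) in auto)
    ultimately show ?thesis using that f(2) by (simp add: lam_pull_def)
  qed
  moreover have "pull f \<gamma> \<in> topspace (nerve G m)"
    using pull_in[of \<gamma> n f] assms(3) fd f(2) by (auto simp: Opn_lam_def)
  ultimately show ?thesis by (simp add: Opn_lam_def)
qed

text \<open>The cover in degree 0, transported from the nerve to the object space; charts and
  cocycles below are indexed by it.\<close>

definition ob :: "('g, 'j) cover_data \<Rightarrow> 'j \<Rightarrow> 'x set" where
  "ob U i = {x \<in> objects G. vertex x \<in> Opn U 0 i}"

lemma obD: "x \<in> ob U i \<Longrightarrow> x \<in> objects G"
  by (simp add: ob_def)

lemma Opn_vertex: "x \<in> objects G \<Longrightarrow> vertex x \<in> Opn U 0 i \<longleftrightarrow> x \<in> ob U i"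
  by (simp add: ob_def)

lemma singleton_Hom_Delta' [simp]: "j \<le> n \<Longrightarrow> [j] \<in> Hom_Delta' 0 n"
  by (simp add: Hom_Delta'_def)

lemma pair_Hom_Delta' [simp]: "j < k \<Longrightarrow> k \<le> n \<Longrightarrow> [j, k] \<in> Hom_Delta' (Suc 0) n"
  by (simp add: Hom_Delta'_def)

lemma eps_1: "eps (Suc 0) 0 = [1, 2]" "eps (Suc 0) (Suc 0) = [0, 2]" "eps (Suc 0) 2 = [0, 1]"
  by (simp_all add: eps_def upt_rec)

lemma eps_0: "eps 0 0 = [1]" "eps 0 (Suc 0) = [0]"
  by (simp_all add: eps_def)

context
  fixes U :: "('g, 'j) cover_data"
  assumes U: "real_open_cover G U"
begin

lemma cover_exists: "\<gamma> \<in> topspace (nerve G n) \<Longrightarrow> \<exists>j\<in>Idx U n. \<gamma> \<in> Opn U n j"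
  using U by (auto simp: real_open_cover_def)

lemma Opn_open: "j \<in> Idx U n \<Longrightarrow> openin (nerve G n) (Opn U n j)"
  using U by (auto simp: real_open_cover_def)

lemma Opn_subset: "j \<in> Idx U n \<Longrightarrow> \<gamma> \<in> Opn U n j \<Longrightarrow> \<gamma> \<in> topspace (nerve G n)"
  using Opn_open openin_subset by blast

lemma ibar_in [simp]: "j \<in> Idx U n \<Longrightarrow> ibar U n j \<in> Idx U n"
  using U by (auto simp: real_open_cover_def)

lemma ibar_ibar [simp]: "j \<in> Idx U n \<Longrightarrow> ibar U n (ibar U n j) = j"
  using U by (auto simp: real_open_cover_def)

lemma Opn_ibar: "j \<in> Idx U n \<Longrightarrow> Opn U n (ibar U n j) = nerve_rho G n ` Opn U n j"
  using U by (auto simp: real_open_cover_def)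

lemma ob_open: "i \<in> Idx U 0 \<Longrightarrow> openin (Obj G) (ob U i)"
  unfolding ob_def by (rule openin_continuous_map_preimage[OF vertex_continuous Opn_open])

lemma ob_cover: "x \<in> objects G \<Longrightarrow> \<exists>i\<in>Idx U 0. x \<in> ob U i"
  using cover_exists[OF vertex_in, of x] by (auto simp: ob_def)

lemma ob_ibar_imp: "i \<in> Idx U 0 \<Longrightarrow> x \<in> ob U i \<Longrightarrow> \<rho> x \<in> ob U (ibar U 0 i)"
  using nerve_rho_vertex[of x] imageI[of "vertex x" "Opn U 0 i" "nerve_rho G 0"]
  by (auto simp: ob_def Opn_ibar)

lemma ob_ibar [simp]: "i \<in> Idx U 0 \<Longrightarrow> x \<in> objects G \<Longrightarrow> \<rho> x \<in> ob U (ibar U 0 i) \<longleftrightarrow> x \<in> ob U i"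
  using ob_ibar_imp[of i x] ob_ibar_imp[of "ibar U 0 i" "\<rho> x"] by auto

lemma ob_ibar' [simp]: "i \<in> Idx U 0 \<Longrightarrow> x \<in> objects G \<Longrightarrow> x \<in> ob U (ibar U 0 i) \<longleftrightarrow> \<rho> x \<in> ob U i"
  using ob_ibar[of i "\<rho> x"] by simp

lemma lam_conj_in: "l \<in> Lam U n \<Longrightarrow> lam_conj U n l \<in> Lam U n"
  by (auto simp: Lam_def lam_conj_def PiE_iff)

lemma Opn_lam_conj:
  assumes "l \<in> Lam U n" "\<gamma> \<in> Opn_lam G U n l"
  shows "nerve_rho G n \<gamma> \<in> Opn_lam G U n (lam_conj U n l)"
proof -
  have "pull \<phi> (nerve_rho G n \<gamma>) \<in> Opn U (dom_ord \<phi>) (lam_conj U n l \<phi>)" if "\<phi> \<in> faces n" for \<phi>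
    using assms that pull_nerve_rho[of \<phi> n \<gamma>] facesD[OF that]
    by (auto simp: Opn_lam_def lam_conj_def Lam_def PiE_iff Opn_ibar)
  then show ?thesis using assms nerve_rho_in by (auto simp: Opn_lam_def)
qed

text \<open>A finite intersection of open preimages: the faces of [n] are lists of bounded length
  with entries at most n, so there are finitely many.\<close>

lemma Opn_lam_open:
  assumes "l \<in> Lam U n" shows "openin (nerve G n) (Opn_lam G U n l)"
proof -
  have "openin (nerve G n) {\<gamma> \<in> topspace (nerve G n). pull \<phi> \<gamma> \<in> Opn U (dom_ord \<phi>) (l \<phi>)}"
    if "\<phi> \<in> faces n" for \<phi>
    by (rule openin_continuous_map_preimage[OF pull_continuous Opn_open])
      (use facesD[OF that] assms that in \<open>auto simp: Lam_def PiE_iff\<close>)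
  moreover have "finite (faces n)"
  proof (rule finite_subset)
    show "faces n \<subseteq> {xs. set xs \<subseteq> {..n} \<and> length xs \<le> Suc n}"
      by (auto simp: faces_def Hom_Delta'_def)
    show "finite {xs. set xs \<subseteq> {..n} \<and> length xs \<le> Suc n}"
      by (rule finite_lists_length_le) simp
  qed
  moreover have "faces n \<noteq> {}" by (metis empty_iff face_singleton le0)
  ultimately have "openin (nerve G n)
    (\<Inter>\<phi>\<in>faces n. {\<gamma> \<in> topspace (nerve G n). pull \<phi> \<gamma> \<in> Opn U (dom_ord \<phi>) (l \<phi>)})"
    by (intro openin_INT2) auto
  moreover have "(\<Inter>\<phi>\<in>faces n. {\<gamma> \<in> topspace (nerve G n). pull \<phi> \<gamma> \<in> Opn U (dom_ord \<phi>) (l \<phi>)})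
      = Opn_lam G U n l"
    using \<open>faces n \<noteq> {}\<close> by (auto simp: Opn_lam_def)
  ultimately show ?thesis by simp
qed

text \<open>The members of the cover that contain the faces of \<gamma> can be chosen independently
  of each other, so choices already made on a set \<open>D\<close> of faces can be kept. This
  freedom is used whenever a cocycle is evaluated with given indices at the vertices.\<close>

lemma Lam_exists:
  assumes "\<gamma> \<in> topspace (nerve G n)"
    and m: "\<And>\<phi>. \<phi> \<in> D \<Longrightarrow> m \<phi> \<in> Idx U (dom_ord \<phi>) \<and> pull \<phi> \<gamma> \<in> Opn U (dom_ord \<phi>) (m \<phi>)"
  obtains l where "l \<in> Lam U n" "\<gamma> \<in> Opn_lam G U n l" "\<And>\<phi>. \<phi> \<in> D \<Longrightarrow> \<phi> \<in> faces n \<Longrightarrow> l \<phi> = m \<phi>"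
proof -
  have "\<exists>i. i \<in> Idx U (dom_ord \<phi>) \<and> pull \<phi> \<gamma> \<in> Opn U (dom_ord \<phi>) i \<and> (\<phi> \<in> D \<longrightarrow> i = m \<phi>)"
    if "\<phi> \<in> faces n" for \<phi>
    using m[of \<phi>] cover_exists[OF pull_in[OF assms(1)]] facesD[OF that] by (cases "\<phi> \<in> D") blast+
  then obtain l where l: "\<And>\<phi>. \<phi> \<in> faces n \<Longrightarrow>
      l \<phi> \<in> Idx U (dom_ord \<phi>) \<and> pull \<phi> \<gamma> \<in> Opn U (dom_ord \<phi>) (l \<phi>) \<and> (\<phi> \<in> D \<longrightarrow> l \<phi> = m \<phi>)"
    by metis
  show ?thesis
    by (rule that[of "restrict l (faces n)"]) (use l assms(1) in \<open>auto simp: Lam_def Opn_lam_def\<close>)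
qed

lemma Opn_lam_1:
  "\<gamma> \<in> Opn_lam G U 1 l \<longleftrightarrow> \<gamma> \<in> topspace (nerve G 1) \<and> rng G (\<gamma> (0, 1)) \<in> ob U (l [0])
     \<and> src G (\<gamma> (0, 1)) \<in> ob U (l [1]) \<and> \<gamma> \<in> Opn U 1 (l [0, 1])"
proof (cases "\<gamma> \<in> topspace (nerve G 1)")
  case True
  then have "\<gamma> (0, 1) \<in> arrows G" "\<gamma> = edge (\<gamma> (0, 1))" using nerve_in nerve1_eq by auto
  then obtain g where "g \<in> arrows G" "\<gamma> = edge g" by blast
  then show ?thesis using True by (auto simp: Opn_lam_def faces_1 dom_ord_def Opn_vertex)
qed (simp add: Opn_lam_def)

lemma Lam_1_in:
  assumes "l \<in> Lam U 1" shows "l [0] \<in> Idx U 0" "l [1] \<in> Idx U 0" "l [0, 1] \<in> Idx U 1"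
  using PiE_mem[OF assms[unfolded Lam_def], of "[0]"] PiE_mem[OF assms[unfolded Lam_def], of "[1]"]
    PiE_mem[OF assms[unfolded Lam_def], of "[0,1]"] by (simp_all add: dom_ord_def)

lemma Lam_1_exists:
  assumes "i \<in> Idx U 0" "j \<in> Idx U 0" "g \<in> arrows G" "rng G g \<in> ob U i" "src G g \<in> ob U j"
  obtains l where "l \<in> Lam U 1" "edge g \<in> Opn_lam G U 1 l" "l [0] = i" "l [1] = j"
proof -
  have "\<phi> \<in> {[0], [1]} \<Longrightarrow> (if \<phi> = [0] then i else j) \<in> Idx U (dom_ord \<phi>)
      \<and> pull \<phi> (edge g) \<in> Opn U (dom_ord \<phi>) (if \<phi> = [0] then i else j)" for \<phi>
    using assms by (auto simp: dom_ord_def Opn_vertex)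
  from Lam_exists[OF edge_in[OF assms(3)] this]
  obtain l where "l \<in> Lam U 1" "edge g \<in> Opn_lam G U 1 l"
      and *: "\<And>\<phi>. \<phi> \<in> {[0], [1]} \<Longrightarrow> \<phi> \<in> faces 1 \<Longrightarrow> l \<phi> = (if \<phi> = [0] then i else j)"
    by blast
  then show ?thesis using *[of "[0]"] *[of "[1]"] by (intro that[of l]) auto
qed

section \<open>The differential in degrees zero and one\<close>

lemma cochain_in:
  "c \<in> carrier (CR n G S U) \<Longrightarrow> l \<in> Lam U n \<Longrightarrow> \<gamma> \<in> Opn_lam G U n l \<Longrightarrow> c l \<gamma> \<in> carrier S"
  by (auto simp: CR_def PiE_iff)

lemma cochain_pull_in:
  "c \<in> carrier (CR m G S U) \<Longrightarrow> f \<in> Hom_Delta' m n \<Longrightarrow> m \<le> n \<Longrightarrow> l \<in> Lam U n \<Longrightarrow>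
    \<gamma> \<in> Opn_lam G U n l \<Longrightarrow> c (lam_pull f l) (pull f \<gamma>) \<in> carrier S"
  by (rule cochain_in[OF _ lam_pull_in Opn_lam_pull])

text \<open>Additively this is the alternating sum c(12) - c(02) + c(01), each face being listed by
  the vertices that it keeps.\<close>

lemma dif_1:
  assumes "c \<in> carrier (CR 1 G S U)" "l \<in> Lam U 2" "\<gamma> \<in> Opn_lam G U 2 l"
  shows "dif 1 G S U c l \<gamma> = c (lam_pull [1, 2] l) (pull [1, 2] \<gamma>) \<otimes>
    (inv (c (lam_pull [0, 2] l) (pull [0, 2] \<gamma>)) \<otimes> c (lam_pull [0, 1] l) (pull [0, 1] \<gamma>))"
proof -
  have [simp]: "c (lam_pull [j, k] l) (pull [j, k] \<gamma>) \<in> carrier S" if "j < k" "k \<le> 2" for j k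
    using cochain_pull_in[OF assms(1), of "[j, k]" 2 l \<gamma>] assms that by simp
  have *: "{..Suc (Suc 0)} = insert 0 (insert (Suc 0) {2::nat})" by auto
  have **: "c (lam_pull (eps (Suc 0) k) l) (pull (eps (Suc 0) k) \<gamma>) \<in> carrier S" if "k \<le> 2" for k
  proof -
    from that have "k = 0 \<or> k = Suc 0 \<or> k = 2" by auto
    then show ?thesis by (elim disjE) (simp_all add: eps_1)
  qed
  have "dif 1 G S U c l \<gamma> = (\<Otimes>k\<in>insert 0 (insert (Suc 0) {2}).
        c (lam_pull (eps (Suc 0) k) l) (pull (eps (Suc 0) k) \<gamma>) [^] ((-1) ^ k :: int))"
    using assms(2,3) unfolding dif_def by (simp add: * numeral_2_eq_2)
  also have "\<dots> = c (lam_pull [1, 2] l) (pull [1, 2] \<gamma>) \<otimes>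
    (inv (c (lam_pull [0, 2] l) (pull [0, 2] \<gamma>)) \<otimes> c (lam_pull [0, 1] l) (pull [0, 1] \<gamma>))"
    using ** by (subst finprod_insert; (simp add: eps_1 int_pow_neg_int int_pow_neg)?)+
  finally show ?thesis .
qed

lemma dif_0:
  assumes "b \<in> carrier (CR 0 G S U)" "l \<in> Lam U 1" "\<gamma> \<in> Opn_lam G U 1 l"
  shows "dif 0 G S U b l \<gamma> = b (lam_pull [1] l) (pull [1] \<gamma>) \<otimes> inv (b (lam_pull [0] l) (pull [0] \<gamma>))"
proof -
  have [simp]: "b (lam_pull [j] l) (pull [j] \<gamma>) \<in> carrier S" if "j \<le> 1" for j
    using cochain_pull_in[OF assms(1), of "[j]" 1 l \<gamma>] assms that by simp
  have *: "{..Suc 0} = insert 0 {Suc 0}" by auto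
  have **: "b (lam_pull (eps 0 k) l) (pull (eps 0 k) \<gamma>) \<in> carrier S" if "k \<le> 1" for k
  proof -
    from that have "k = 0 \<or> k = Suc 0" by auto
    then show ?thesis by (elim disjE) (simp_all add: eps_0)
  qed
  have "dif 0 G S U b l \<gamma> = (\<Otimes>k\<in>insert 0 {Suc 0}.
        b (lam_pull (eps 0 k) l) (pull (eps 0 k) \<gamma>) [^] ((-1) ^ k :: int))"
    using assms(2,3) unfolding dif_def by (simp add: *)
  also have "\<dots> = b (lam_pull [1] l) (pull [1] \<gamma>) \<otimes> inv (b (lam_pull [0] l) (pull [0] \<gamma>))"
    using ** by (subst finprod_insert; (simp add: eps_0 int_pow_neg_int int_pow_neg)?)+
  finally show ?thesis .
qed

lemma cocycles_iff:
  "c \<in> cocycles 1 G S U \<longleftrightarrow> c \<in> carrier (CR 1 G S U) \<and> (\<forall>l\<in>Lam U 2. \<forall>\<gamma>\<in>Opn_lam G U 2 l.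
     c (lam_pull [0, 2] l) (pull [0, 2] \<gamma>) =
     c (lam_pull [0, 1] l) (pull [0, 1] \<gamma>) \<otimes> c (lam_pull [1, 2] l) (pull [1, 2] \<gamma>))"
proof (cases "c \<in> carrier (CR 1 G S U)")
  case True
  have eq: "c (lam_pull [0, 2] l) (pull [0, 2] \<gamma>) =
        c (lam_pull [0, 1] l) (pull [0, 1] \<gamma>) \<otimes> c (lam_pull [1, 2] l) (pull [1, 2] \<gamma>)
      \<longleftrightarrow> dif 1 G S U c l \<gamma> = \<one>"
    if "l \<in> Lam U 2" "\<gamma> \<in> Opn_lam G U 2 l" for l \<gamma>
  proof -
    have c: "c (lam_pull [j, k] l) (pull [j, k] \<gamma>) \<in> carrier S" if "j < k" "k \<le> 2" for j k
      using cochain_pull_in[OF True, of "[j, k]" 2 l \<gamma>] that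
        \<open>l \<in> Lam U 2\<close> \<open>\<gamma> \<in> Opn_lam G U 2 l\<close> by simp
    have "y = z \<otimes> x \<longleftrightarrow> x \<otimes> (inv y \<otimes> z) = \<one>"
      if "x \<in> carrier S" "y \<in> carrier S" "z \<in> carrier S" for x y z
    proof -
      have "x \<otimes> (inv y \<otimes> z) = inv y \<otimes> (z \<otimes> x)" using that by (simp add: m_ac)
      also have "\<dots> = \<one> \<longleftrightarrow> z \<otimes> x = y"
        using that by (metis inv_closed inv_equality inv_inv l_inv m_closed inv_comm)
      finally show ?thesis by auto
    qed
    then show ?thesis using dif_1[OF True that] c[of 1 2] c[of 0 2] c[of 0 1] by simp
  qed
  have "dif 1 G S U c = \<one>\<^bsub>CR 2 G S U\<^esub> \<longleftrightarrow>
      (\<forall>l\<in>Lam U 2. \<forall>\<gamma>\<in>Opn_lam G U 2 l. dif 1 G S U c l \<gamma> = \<one>)"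
  proof
    assume "\<forall>l\<in>Lam U 2. \<forall>\<gamma>\<in>Opn_lam G U 2 l. dif 1 G S U c l \<gamma> = \<one>"
    then show "dif 1 G S U c = \<one>\<^bsub>CR 2 G S U\<^esub>"
      by (auto simp: CR_def fun_eq_iff restrict_def dif_def numeral_2_eq_2)
  qed (simp add: CR_def)
  then show ?thesis using eq True by (simp add: cocycles_def numeral_2_eq_2)
qed (simp add: cocycles_def)

text \<open>The cocycle condition is attached to a single index function on the faces of [2]. Three
  index functions of degree 1 which agree at the common vertices can be joined to such a function,
  so that the identity becomes available for indices chosen separately on the three edges.\<close>

lemma cocycle_triple:
  assumes c: "c \<in> cocycles 1 G S U"
    and l: "l01 \<in> Lam U 1" "l02 \<in> Lam U 1" "l12 \<in> Lam U 1"
    and g: "g \<in> arrows G" "h \<in> arrows G" "src G g = rng G h"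
    and o: "edge g \<in> Opn_lam G U 1 l01" "edge (mul G g h) \<in> Opn_lam G U 1 l02" "edge h \<in> Opn_lam G U 1 l12"
    and e: "l01 [0] = l02 [0]" "l01 [1] = l12 [0]" "l02 [1] = l12 [1]"
  shows "c l02 (edge (mul G g h)) = c l01 (edge g) \<otimes> c l12 (edge h)"
proof -
  obtain \<gamma> where \<gamma>: "\<gamma> \<in> topspace (nerve G 2)" "pull [0, 1] \<gamma> = edge g" "pull [1, 2] \<gamma> = edge h"
    "pull [0, 2] \<gamma> = edge (mul G g h)"
    "pull [0] \<gamma> = vertex (rng G g)" "pull [1] \<gamma> = vertex (rng G h)" "pull [2] \<gamma> = vertex (src G h)"
    using nerve2_exists[OF g] .
  \<comment> \<open>All faces of [2] except [0, 1, 2]. The prescribed values fit together on them by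
    the agreement at vertices; the top face receives any index whose member contains
    \<gamma>.\<close>
  let ?D = "{[0], [1], [2], [0, 1], [1, 2], [0, 2::nat]}"
  let ?m = "\<lambda>\<phi>. if \<phi> = [0] then l01 [0] else if \<phi> = [1] then l12 [0] else if \<phi> = [2] then l12 [1]
    else if \<phi> = [0, 1] then l01 [0, 1] else if \<phi> = [1, 2] then l12 [0, 1] else l02 [0, 1]"
  have "?m \<phi> \<in> Idx U (dom_ord \<phi>) \<and> pull \<phi> \<gamma> \<in> Opn U (dom_ord \<phi>) (?m \<phi>)" if "\<phi> \<in> ?D" for \<phi>
    using that Lam_1_in[OF l(1)] Lam_1_in[OF l(2)] Lam_1_in[OF l(3)] o g \<gamma>
    unfolding Opn_lam_1 by (auto simp: dom_ord_def Opn_vertex obD)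
  from Lam_exists[OF \<gamma>(1) this] obtain l where l': "l \<in> Lam U 2" "\<gamma> \<in> Opn_lam G U 2 l"
    and *: "\<And>\<phi>. \<phi> \<in> ?D \<Longrightarrow> \<phi> \<in> faces 2 \<Longrightarrow> l \<phi> = ?m \<phi>" by blast
  have **: "l [0] = l01 [0]" "l [1] = l12 [0]" "l [2] = l12 [1]" "l [0, 1] = l01 [0, 1]"
    "l [1, 2] = l12 [0, 1]" "l [0, 2] = l02 [0, 1]"
    using *[of "[0]"] *[of "[1]"] *[of "[2]"] *[of "[0,1]"] *[of "[1,2]"] *[of "[0,2]"] by auto
  have ext: "k = k'" if "k \<in> Lam U 1" "k' \<in> Lam U 1" "k [0] = k' [0]" "k [1] = k' [1]" "k [0,1] = k' [0,1]"
    for k k'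
    by (rule PiE_ext[OF that(1,2)[unfolded Lam_def]]) (use that(3-5) in \<open>auto simp: faces_1\<close>)
  have lp: "lam_pull [j, k] l \<in> Lam U 1" "lam_pull [j, k] l [0] = l [j]" "lam_pull [j, k] l [1] = l [k]"
    "lam_pull [j, k] l [0, 1] = l [j, k]" if "j < k" "k \<le> 2" for j k
    using lam_pull_in[OF _ _ l'(1), of "[j, k]" "Suc 0"] that
    by (simp_all add: lam_pull_def dom_ord_def faces_1 after_def)
  have "lam_pull [0, 1] l = l01" "lam_pull [0, 2] l = l02" "lam_pull [1, 2] l = l12"
    using lp[of 0 1] lp[of 0 2] lp[of 1 2] ** e l by (auto intro!: ext)
  moreover have "c (lam_pull [0, 2] l) (pull [0, 2] \<gamma>) =
     c (lam_pull [0, 1] l) (pull [0, 1] \<gamma>) \<otimes> c (lam_pull [1, 2] l) (pull [1, 2] \<gamma>)"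
    using c l' unfolding cocycles_iff by blast
  ultimately show ?thesis using \<gamma> by simp
qed

end


section \<open>Cocycles as families of functions on arrows\<close>

definition over :: "('g, 'j) cover_data \<Rightarrow> 'j \<Rightarrow> 'j \<Rightarrow> 'g set" where
  "over U i j = {g \<in> arrows G. rng G g \<in> ob U i \<and> src G g \<in> ob U j}"

text \<open>The family is constrained only for indices in \<open>Idx U 0\<close> and arrows in
  \<open>over U i j\<close>. Its values elsewhere are arbitrary, so two families are identified by
  applying \<open>mk\<close>, which restricts to the relevant arguments
  (\<open>mk_cong\<close>).\<close>

definition cocycle_on :: "('g, 'j) cover_data \<Rightarrow> ('j \<Rightarrow> 'j \<Rightarrow> 'g \<Rightarrow> 's) \<Rightarrow> bool" where
  "cocycle_on U f \<longleftrightarrow> (\<forall>i\<in>Idx U 0. \<forall>j\<in>Idx U 0.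
     continuous_map (subtopology (Arr G) (over U i j)) (top_of S) (f i j) \<and>
     (\<forall>g\<in>over U i j. f (ibar U 0 i) (ibar U 0 j) (rho G g) = bar S (f i j g) \<and>
       (\<forall>k\<in>Idx U 0. \<forall>h\<in>over U j k. src G g = rng G h \<longrightarrow>
          f i k (mul G g h) = f i j g \<otimes> f j k h)))"

definition cochain0_on :: "('g, 'j) cover_data \<Rightarrow> ('j \<Rightarrow> 'x \<Rightarrow> 's) \<Rightarrow> bool" where
  "cochain0_on U b \<longleftrightarrow> (\<forall>i\<in>Idx U 0.
     continuous_map (subtopology (Obj G) (ob U i)) (top_of S) (b i) \<and>
     (\<forall>x\<in>ob U i. b (ibar U 0 i) (\<rho> x) = bar S (b i x)))"

definition mk :: "('g, 'j) cover_data \<Rightarrow> ('j \<Rightarrow> 'j \<Rightarrow> 'g \<Rightarrow> 's) \<Rightarrow> ('g, 's, 'j) cochain" where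
  "mk U f = (\<lambda>l\<in>Lam U 1. \<lambda>\<gamma>\<in>Opn_lam G U 1 l. f (l [0]) (l [1]) (\<gamma> (0, 1)))"

text \<open>
  The choice does not matter for a cocycle: it does not depend on the index of the cover of the
  arrow space, see \<open>cocycle_val\<close>.
\<close>

definition val :: "('g, 'j) cover_data \<Rightarrow> ('g, 's, 'j) cochain \<Rightarrow> 'j \<Rightarrow> 'j \<Rightarrow> 'g \<Rightarrow> 's" where
  "val U c i j g =
     c (SOME l. l \<in> Lam U 1 \<and> l [0] = i \<and> l [1] = j \<and> edge g \<in> Opn_lam G U 1 l) (edge g)"

lemma overI [intro]:
  "g \<in> arrows G \<Longrightarrow> rng G g \<in> ob U i \<Longrightarrow> src G g \<in> ob U j \<Longrightarrow> g \<in> over U i j"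
  by (simp add: over_def)

lemma overD: "g \<in> over U i j \<Longrightarrow> g \<in> arrows G" "g \<in> over U i j \<Longrightarrow> rng G g \<in> ob U i"
  "g \<in> over U i j \<Longrightarrow> src G g \<in> ob U j"
  by (auto simp: over_def)

lemma unt_over [simp]: "x \<in> ob U i \<Longrightarrow> x \<in> ob U j \<Longrightarrow> unt G x \<in> over U i j"
  by (auto simp: over_def obD)

lemma mul_over [intro]:
  "g \<in> over U i j \<Longrightarrow> h \<in> over U j' k \<Longrightarrow> src G g = rng G h \<Longrightarrow> mul G g h \<in> over U i k"
  by (auto simp: over_def)

lemma cocycle_onD:
  assumes "cocycle_on U f" "i \<in> Idx U 0" "j \<in> Idx U 0"
  shows cocycle_on_continuous: "continuous_map (subtopology (Arr G) (over U i j)) (top_of S) (f i j)"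
    and cocycle_on_rho: "g \<in> over U i j \<Longrightarrow> f (ibar U 0 i) (ibar U 0 j) (rho G g) = bar S (f i j g)"
    and cocycle_on_mul: "g \<in> over U i j \<Longrightarrow> k \<in> Idx U 0 \<Longrightarrow> h \<in> over U j k \<Longrightarrow>
      src G g = rng G h \<Longrightarrow> f i k (mul G g h) = f i j g \<otimes> f j k h"
  using assms by (auto simp: cocycle_on_def)

lemma cocycle_on_in:
  assumes "cocycle_on U f" "i \<in> Idx U 0" "j \<in> Idx U 0" "g \<in> over U i j"
  shows "f i j g \<in> carrier S"
proof -
  have "g \<in> topspace (subtopology (Arr G) (over U i j))" using assms(4) by (auto simp: over_def)
  then show ?thesis
    using continuous_map_funspace[OF cocycle_on_continuous[OF assms(1-3)]] topspace_top_of by auto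
qed

text \<open>A unit is its own square, so its value is an idempotent of a group.\<close>

lemma cocycle_on_unt:
  assumes "cocycle_on U f" "i \<in> Idx U 0" "x \<in> ob U i"
  shows "f i i (unt G x) = \<one>"
proof -
  have x: "unt G x \<in> over U i i" "x \<in> objects G" using assms obD by auto
  then have "f i i (unt G x) = f i i (unt G x) \<otimes> f i i (unt G x)"
    using cocycle_on_mul[OF assms(1,2,2) x(1) assms(2) x(1)] mul_unt[of "unt G x"] by simp
  then show ?thesis using cocycle_on_in[OF assms(1,2,2) x(1)] by (metis r_cancel_one')
qed

context
  fixes U :: "('g, 'j) cover_data"
  assumes U: "real_open_cover G U"
begin

lemma over_ibar: "i \<in> Idx U 0 \<Longrightarrow> j \<in> Idx U 0 \<Longrightarrow> g \<in> over U i j \<Longrightarrow>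
    rho G g \<in> over U (ibar U 0 i) (ibar U 0 j)"
  using ob_ibar[OF U] by (auto simp: over_def)

lemma Opn_lam_1_edge:
  "g \<in> arrows G \<Longrightarrow> edge g \<in> Opn_lam G U 1 l \<longleftrightarrow> g \<in> over U (l [0]) (l [1]) \<and> edge g \<in> Opn U 1 (l [0, 1])"
  using Opn_lam_1[OF U, of "edge g" l] by (auto simp: over_def)

lemma Opn_lam_1_cases:
  assumes "\<gamma> \<in> Opn_lam G U 1 l"
  obtains g where "g \<in> over U (l [0]) (l [1])" "\<gamma> = edge g"
proof -
  have "\<gamma> \<in> topspace (nerve G 1)" using assms by (simp add: Opn_lam_def)
  then have "\<gamma> (0, 1) \<in> arrows G" "\<gamma> = edge (\<gamma> (0, 1))" using nerve_in nerve1_eq by auto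
  then show ?thesis using that Opn_lam_1_edge assms by metis
qed

lemma Lam_1_over:
  assumes "i \<in> Idx U 0" "j \<in> Idx U 0" "g \<in> over U i j"
  obtains l where "l \<in> Lam U 1" "edge g \<in> Opn_lam G U 1 l" "l [0] = i" "l [1] = j"
  using Lam_1_exists[OF U assms(1,2)] overD[OF assms(3)] by metis

text \<open>Write g = g1 with 1 the unit at the source of g, and let l1, l2 have the same values at
  the vertices. Using l1 for the factor g, some m for the unit, and either l1 or l2 for the product,
  \<open>cocycle_triple\<close> gives the same right-hand side twice; hence \<open>c l1\<close> and
  \<open>c l2\<close> agree at g.\<close>

lemma cocycle_val:
  assumes c: "c \<in> cocycles 1 G S U" and l: "l \<in> Lam U 1" and g: "edge g \<in> Opn_lam G U 1 l" "g \<in> arrows G"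
  shows "c l (edge g) = val U c (l [0]) (l [1]) g"
proof -
  have indep: "c l1 (edge g) = c l2 (edge g)"
    if "l1 \<in> Lam U 1" "l2 \<in> Lam U 1" "l1 [0] = l2 [0]" "l1 [1] = l2 [1]"
      "edge g \<in> Opn_lam G U 1 l1" "edge g \<in> Opn_lam G U 1 l2" for l1 l2
  proof -
    let ?x = "unt G (src G g)"
    note l1 = Lam_1_in[OF U that(1)]
    have o: "g \<in> over U (l1 [0]) (l1 [1])" using that g(2) Opn_lam_1_edge by blast
    then have x: "?x \<in> arrows G" "?x \<in> over U (l1 [1]) (l1 [1])" "src G g = rng G ?x"
      using g(2) by (auto simp: over_def)
    obtain m where m: "m \<in> Lam U 1" "edge ?x \<in> Opn_lam G U 1 m" "m [0] = l1 [1]" "m [1] = l1 [1]"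
      using Lam_1_over[OF l1(2,2) x(2)] by metis
    have gx: "mul G g ?x = g" using g(2) by simp
    have cin: "c l \<gamma> \<in> carrier S" if "l \<in> Lam U 1" "\<gamma> \<in> Opn_lam G U 1 l" for l \<gamma>
      using cochain_in[OF U _ that] c by (simp add: cocycles_def)
    have "c l1 (edge g) = c l1 (edge g) \<otimes> c m (edge ?x)"
      using cocycle_triple[OF U c that(1) that(1) m(1) g(2) x(1,3) that(5) _ m(2)] that m gx by simp
    moreover have "c l2 (edge g) = c l1 (edge g) \<otimes> c m (edge ?x)"
      using cocycle_triple[OF U c that(1) that(2) m(1) g(2) x(1,3) that(5) _ m(2)] that m gx by simp
    ultimately show ?thesis by simp
  qed
  show ?thesis
    unfolding val_def
  proof (rule someI2[where a = l])
    show "l \<in> Lam U 1 \<and> l [0] = l [0] \<and> l [1] = l [1] \<and> edge g \<in> Opn_lam G U 1 l"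
      using l g by simp
    show "c l (edge g) = c m (edge g)"
      if "m \<in> Lam U 1 \<and> m [0] = l [0] \<and> m [1] = l [1] \<and> edge g \<in> Opn_lam G U 1 m" for m
      using indep[of l m] l g that by auto
  qed
qed

text \<open>The choice hidden in \<open>val\<close> may change from arrow to arrow, which is
  harmless by \<open>cocycle_val\<close>: each clause is checked with index functions convenient for
  the arrows at hand.\<close>

lemma val_cocycle_on:
  assumes c: "c \<in> cocycles 1 G S U"
  shows "cocycle_on U (val U c)"
  unfolding cocycle_on_def
proof (intro ballI conjI impI)
  fix i j assume ij: "i \<in> Idx U 0" "j \<in> Idx U 0"
  have cc: "c \<in> carrier (CR 1 G S U)" using c by (simp add: cocycles_def)
  show "continuous_map (subtopology (Arr G) (over U i j)) (top_of S) (val U c i j)"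
  proof (rule continuous_map_locallyI)
    fix g assume "g \<in> topspace (subtopology (Arr G) (over U i j))"
    then have g: "g \<in> over U i j" "g \<in> arrows G" by auto
    obtain l where l: "l \<in> Lam U 1" "edge g \<in> Opn_lam G U 1 l" "l [0] = i" "l [1] = j"
      using Lam_1_over[OF ij g(1)] by metis
    \<comment> \<open>On the open set where one fixed \<open>l\<close> is usable,
      \<open>val U c i j\<close> coincides with the continuous map
      \<open>c l \<circ> edge\<close>.\<close>
    let ?W = "{g \<in> arrows G. edge g \<in> Opn_lam G U 1 l}"
    have W: "openin (Arr G) ?W"
      by (rule openin_continuous_map_preimage[OF edge_continuous Opn_lam_open[OF U l(1)]])
    have WO: "?W \<subseteq> over U i j" using Opn_lam_1_edge l by auto
    have "continuous_map (subtopology (nerve G 1) (Opn_lam G U 1 l)) (top_of S) (c l)"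
      using cc l(1) by (simp add: CR_def)
    moreover have "continuous_map (subtopology (Arr G) ?W) (subtopology (nerve G 1) (Opn_lam G U 1 l)) edge"
      using edge_continuous by (auto simp: continuous_map_in_subtopology continuous_map_from_subtopology)
    ultimately have "continuous_map (subtopology (Arr G) ?W) (top_of S) (c l \<circ> edge)"
      using continuous_map_compose by blast
    moreover have "subtopology (subtopology (Arr G) (over U i j)) ?W = subtopology (Arr G) ?W"
      using WO by (simp add: subtopology_subtopology Int_absorb1)
    moreover have "openin (subtopology (Arr G) (over U i j)) ?W"
      using W WO by (auto simp: openin_subtopology)
    ultimately show "\<exists>W f. openin (subtopology (Arr G) (over U i j)) W \<and> g \<in> W \<and>
        continuous_map (subtopology (subtopology (Arr G) (over U i j)) W) (top_of S) f \<and>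
        (\<forall>y\<in>W. val U c i j y = f y)"
      using cocycle_val[OF c l(1)] l g by (intro exI[of _ ?W] exI[of _ "c l \<circ> edge"]) auto
  qed
  fix g assume g: "g \<in> over U i j"
  note gD = overD[OF g]
  obtain l where l: "l \<in> Lam U 1" "edge g \<in> Opn_lam G U 1 l" "l [0] = i" "l [1] = j"
    using Lam_1_over[OF ij g(1)] by metis
  have "c (lam_conj U 1 l) (nerve_rho G 1 (edge g)) = bar S (c l (edge g))"
    using cc l by (simp add: CR_def)
  moreover have "lam_conj U 1 l [0] = ibar U 0 i" "lam_conj U 1 l [1] = ibar U 0 j"
    using l by (simp_all add: lam_conj_def dom_ord_def)
  moreover have "edge (rho G g) \<in> Opn_lam G U 1 (lam_conj U 1 l)"
    using Opn_lam_conj[OF U l(1,2)] nerve_rho_edge gD by simp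
  ultimately show "val U c (ibar U 0 i) (ibar U 0 j) (rho G g) = bar S (val U c i j g)"
    using cocycle_val[OF c l(1,2)] cocycle_val[OF c lam_conj_in[OF U l(1)], of "rho G g"] gD l
    by (simp add: nerve_rho_edge[unfolded One_nat_def])
  fix k h assume k: "k \<in> Idx U 0" and h: "h \<in> over U j k" "src G g = rng G h"
  note hD = overD[OF h(1)]
  have gh: "mul G g h \<in> over U i k" "mul G g h \<in> arrows G" using mul_over g h gD hD by auto
  obtain m where m: "m \<in> Lam U 1" "edge h \<in> Opn_lam G U 1 m" "m [0] = j" "m [1] = k"
    using Lam_1_over[OF ij(2) k h(1)] by metis
  obtain n where n: "n \<in> Lam U 1" "edge (mul G g h) \<in> Opn_lam G U 1 n" "n [0] = i" "n [1] = k"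
    using Lam_1_over[OF ij(1) k gh(1)] by metis
  show "val U c i k (mul G g h) = val U c i j g \<otimes> val U c j k h"
    using cocycle_triple[OF U c l(1) n(1) m(1) gD(1) hD(1) h(2) l(2) n(2) m(2)]
      cocycle_val[OF c l(1,2) gD(1)] cocycle_val[OF c m(1,2) hD(1)] cocycle_val[OF c n(1,2) gh(2)]
      l m n by simp
qed

lemma mk_apply: "l \<in> Lam U 1 \<Longrightarrow> \<gamma> \<in> Opn_lam G U 1 l \<Longrightarrow> mk U f l \<gamma> = f (l [0]) (l [1]) (\<gamma> (0, 1))"
  by (simp add: mk_def)

lemma mk_cong:
  assumes "\<And>i j g. i \<in> Idx U 0 \<Longrightarrow> j \<in> Idx U 0 \<Longrightarrow> g \<in> over U i j \<Longrightarrow> f i j g = f' i j g"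
  shows "mk U f = mk U f'"
proof -
  have "f (l [0]) (l [1]) (\<gamma> (0, 1)) = f' (l [0]) (l [1]) (\<gamma> (0, 1))"
    if l: "l \<in> Lam U 1" and \<gamma>: "\<gamma> \<in> Opn_lam G U 1 l" for l \<gamma>
    using Opn_lam_1_cases[OF \<gamma>] assms[OF Lam_1_in(1,2)[OF U l]] by (metis edge_apply One_nat_def)
  then show ?thesis unfolding mk_def by (intro restrict_ext) auto
qed

lemma mk_val:
  assumes "c \<in> cocycles 1 G S U" shows "mk U (val U c) = c"
proof -
  have c: "c \<in> (\<Pi>\<^sub>E l \<in> Lam U 1. \<Pi>\<^sub>E \<gamma> \<in> Opn_lam G U 1 l. carrier S)"
    using assms by (simp add: cocycles_def CR_def)
  have eq: "mk U (val U c) l \<gamma> = c l \<gamma>" if "l \<in> Lam U 1" "\<gamma> \<in> Opn_lam G U 1 l" for l \<gamma>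
    using Opn_lam_1_cases[OF that(2)] cocycle_val[OF assms that(1)] that
    by (metis edge_apply mk_apply One_nat_def overD(1))
  show ?thesis
  proof (rule extensionalityI[of _ "Lam U 1"])
    show "mk U (val U c) l = c l" if "l \<in> Lam U 1" for l
    proof (rule extensionalityI[of _ "Opn_lam G U 1 l"])
      show "mk U (val U c) l \<in> extensional (Opn_lam G U 1 l)" using that by (simp add: mk_def)
      show "c l \<in> extensional (Opn_lam G U 1 l)" using c that by (auto simp: PiE_iff)
    qed (use eq that in auto)
    show "c \<in> extensional (Lam U 1)" using c by (auto simp: PiE_iff)
  qed (simp add: mk_def)
qed

lemma mk_cocycle:
  assumes f: "cocycle_on U f" shows "mk U f \<in> cocycles 1 G S U"
  unfolding cocycles_iff[OF U]
proof (intro conjI ballI)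
  have fin: "f (l [0]) (l [1]) (\<gamma> (0, 1)) \<in> carrier S"
    if "l \<in> Lam U 1" "\<gamma> \<in> Opn_lam G U 1 l" for l \<gamma>
    using Opn_lam_1_cases[OF that(2)] cocycle_on_in[OF f Lam_1_in(1,2)[OF U that(1)]]
    by (metis edge_apply One_nat_def)
  have cont: "continuous_map (subtopology (nerve G 1) (Opn_lam G U 1 l)) (top_of S) (mk U f l)"
    if l: "l \<in> Lam U 1" for l
  proof -
    have "continuous_map (subtopology (nerve G 1) (Opn_lam G U 1 l)) (subtopology (Arr G) (over U (l [0]) (l [1])))
        (\<lambda>\<gamma>. \<gamma> (0, 1))"
      unfolding continuous_map_in_subtopology
    proof
      show "continuous_map (subtopology (nerve G 1) (Opn_lam G U 1 l)) (Arr G) (\<lambda>\<gamma>. \<gamma> (0, 1))"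
        by (rule continuous_map_from_subtopology[OF nerve_apply_continuous]) auto
      show "(\<lambda>\<gamma>. \<gamma> (0, 1)) \<in> topspace (subtopology (nerve G 1) (Opn_lam G U 1 l)) \<rightarrow> over U (l [0]) (l [1])"
      proof
        fix \<gamma> assume "\<gamma> \<in> topspace (subtopology (nerve G 1) (Opn_lam G U 1 l))"
        then have "\<gamma> \<in> Opn_lam G U 1 l" by simp
        then obtain g where "g \<in> over U (l [0]) (l [1])" "\<gamma> = edge g" by (rule Opn_lam_1_cases)
        then show "\<gamma> (0, 1) \<in> over U (l [0]) (l [1])" by simp
      qed
    qed
    from continuous_map_compose[OF this cocycle_on_continuous[OF f Lam_1_in(1,2)[OF U l]]]
    show ?thesis by (rule continuous_map_eq) (use l in \<open>auto simp: mk_apply\<close>)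
  qed
  have conj: "mk U f (lam_conj U 1 l) (nerve_rho G 1 \<gamma>) = bar S (mk U f l \<gamma>)"
    if l: "l \<in> Lam U 1" and \<gamma>: "\<gamma> \<in> Opn_lam G U 1 l" for l \<gamma>
  proof -
    obtain g where g: "g \<in> over U (l [0]) (l [1])" "\<gamma> = edge g" using Opn_lam_1_cases[OF \<gamma>] .
    have "lam_conj U 1 l [0] = ibar U 0 (l [0])" "lam_conj U 1 l [1] = ibar U 0 (l [1])"
      by (simp_all add: lam_conj_def dom_ord_def)
    then show ?thesis
      using mk_apply[OF l \<gamma>] mk_apply[OF lam_conj_in[OF U l] Opn_lam_conj[OF U l \<gamma>]]
        cocycle_on_rho[OF f Lam_1_in(1,2)[OF U l] g(1)] g nerve_rho_edge[OF overD(1)[OF g(1)]] by simp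
  qed
  show "mk U f \<in> carrier (CR 1 G S U)"
    using cont conj fin by (auto simp: CR_def mk_def)
  fix l \<gamma> assume l: "l \<in> Lam U 2" and \<gamma>: "\<gamma> \<in> Opn_lam G U 2 l"
  have \<gamma>n: "\<gamma> \<in> topspace (nerve G 2)" using \<gamma> by (simp add: Opn_lam_def)
  have lp: "lam_pull [j, k] l \<in> Lam U 1" "pull [j, k] \<gamma> \<in> Opn_lam G U 1 (lam_pull [j, k] l)"
    "lam_pull [j, k] l [0] = l [j]" "lam_pull [j, k] l [1] = l [k]"
    "pull [j, k] \<gamma> (0, 1) = \<gamma> (j, k)"
    "\<gamma> (j, k) \<in> over U (l [j]) (l [k])" if "j < k" "k \<le> 2" for j k
  proof -
    show 1: "lam_pull [j, k] l \<in> Lam U 1" "pull [j, k] \<gamma> \<in> Opn_lam G U 1 (lam_pull [j, k] l)"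
      using lam_pull_in[OF _ _ l, of "[j, k]" "Suc 0"] Opn_lam_pull[OF _ _ \<gamma>, of "[j, k]" "Suc 0"] that by simp_all
    show 2: "lam_pull [j, k] l [0] = l [j]" "lam_pull [j, k] l [1] = l [k]"
        "pull [j, k] \<gamma> (0, 1) = \<gamma> (j, k)"
      using that by (simp_all add: lam_pull_def pull_def dom_ord_def after_def)
    show "\<gamma> (j, k) \<in> over U (l [j]) (l [k])"
      using 1 2 by (metis Opn_lam_1_cases edge_apply One_nat_def)
  qed
  have li: "l [k] \<in> Idx U 0" if "k \<le> 2" for k
    using PiE_mem[OF l[unfolded Lam_def], of "[k]"] that by (simp add: dom_ord_def)
  note p = pair_functorD[OF nerve_pair_functor[OF \<gamma>n]]
  have "f (l [0]) (l [2]) (mul G (\<gamma> (0, 1)) (\<gamma> (1, 2))) =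
      f (l [0]) (l [1]) (\<gamma> (0, 1)) \<otimes> f (l [1]) (l [2]) (\<gamma> (1, 2))"
    using lp[of 0 1] lp[of 1 2] li[of 0] li[of 1] li[of 2] p(2)[of 1 2] p(3)[of 0 1]
    by (intro cocycle_on_mul[OF f]) auto
  then show "mk U f (lam_pull [0, 2] l) (pull [0, 2] \<gamma>) =
     mk U f (lam_pull [0, 1] l) (pull [0, 1] \<gamma>) \<otimes> mk U f (lam_pull [1, 2] l) (pull [1, 2] \<gamma>)"
    using mk_apply[OF lp(1,2)[of 0 1]] mk_apply[OF lp(1,2)[of 0 2]] mk_apply[OF lp(1,2)[of 1 2]]
      lp(3-5)[of 0 1] lp(3-5)[of 0 2] lp(3-5)[of 1 2] p(4)[of 0 1 2] by simp
qed

lemma val_mk: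
  assumes "cocycle_on U f" "i \<in> Idx U 0" "j \<in> Idx U 0" "g \<in> over U i j"
  shows "val U (mk U f) i j g = f i j g"
proof -
  obtain l where l: "l \<in> Lam U 1" "edge g \<in> Opn_lam G U 1 l" "l [0] = i" "l [1] = j"
    using Lam_1_over[OF assms(2-4)] by metis
  then show ?thesis
    using cocycle_val[OF mk_cocycle[OF assms(1)] l(1,2) overD(1)[OF assms(4)]] mk_apply[OF l(1,2), of f]
    by simp
qed

lemma mk_mult: "mk U f \<otimes>\<^bsub>CR 1 G S U\<^esub> mk U f' = mk U (\<lambda>i j g. f i j g \<otimes> f' i j g)"
  unfolding mk_def CR_def by (simp cong: restrict_cong)

lemma mk_one: "\<one>\<^bsub>CR 1 G S U\<^esub> = mk U (\<lambda>i j g. \<one>)"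
  unfolding mk_def CR_def by simp

lemma cocycle_on_mult:
  assumes "cocycle_on U f" "cocycle_on U f'"
  shows "cocycle_on U (\<lambda>i j g. f i j g \<otimes> f' i j g)"
  using cocycle_onD[OF assms(1)] cocycle_onD[OF assms(2)] cocycle_on_in[OF assms(1)] cocycle_on_in[OF assms(2)]
  unfolding cocycle_on_def[of U "\<lambda>i j g. f i j g \<otimes> f' i j g"]
  by (auto intro!: continuous_map_mult simp: m_ac)

lemma cocycle_on_inv:
  assumes "cocycle_on U f"
  shows "cocycle_on U (\<lambda>i j g. inv (f i j g))"
  using cocycle_onD[OF assms(1)] cocycle_on_in[OF assms(1)]
  unfolding cocycle_on_def[of U "\<lambda>i j g. inv (f i j g)"]
  by (auto intro!: continuous_map_inv simp: inv_mult)

lemma cocycle_on_one: "cocycle_on U (\<lambda>i j g. \<one>)"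
  by (simp add: cocycle_on_def topspace_top_of)

lemma cochain0_on_in:
  assumes "cochain0_on U b" "i \<in> Idx U 0" "x \<in> ob U i" shows "b i x \<in> carrier S"
proof -
  have "x \<in> topspace (subtopology (Obj G) (ob U i))" using assms(3) obD by auto
  then show ?thesis
    using assms continuous_map_funspace[of "subtopology (Obj G) (ob U i)" "top_of S" "b i"] topspace_top_of
    by (auto simp: cochain0_on_def)
qed

text \<open>The factors at the intermediate object cancel in a product of two arrows. The source
  carries the positive sign because omitting vertex 0 of an edge leaves its source, see
  \<open>eps_0\<close> and \<open>dif_0\<close>.\<close>

lemma cocycle_on_coboundary:
  assumes b: "cochain0_on U b"
  shows "cocycle_on U (\<lambda>i j g. b j (src G g) \<otimes> inv (b i (rng G g)))"
  unfolding cocycle_on_def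
proof (intro ballI conjI impI)
  fix i j assume ij: "i \<in> Idx U 0" "j \<in> Idx U 0"
  have c: "continuous_map (subtopology (Obj G) (ob U i)) (top_of S) (b i)" if "i \<in> Idx U 0" for i
    using b that by (simp add: cochain0_on_def)
  have "continuous_map (subtopology (Arr G) (over U i j)) (subtopology (Obj G) (ob U j)) (src G)"
    "continuous_map (subtopology (Arr G) (over U i j)) (subtopology (Obj G) (ob U i)) (rng G)"
    by (auto simp: continuous_map_in_subtopology continuous_map_from_subtopology
        src_continuous rng_continuous over_def)
  from continuous_map_compose[OF this(1) c[OF ij(2)]] continuous_map_compose[OF this(2) c[OF ij(1)]]
  show "continuous_map (subtopology (Arr G) (over U i j)) (top_of S)
      (\<lambda>g. b j (src G g) \<otimes> inv (b i (rng G g)))"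
    by (intro continuous_map_mult continuous_map_inv) (simp_all add: comp_def)
  fix g assume g: "g \<in> over U i j"
  note gD = overD[OF g] and bin = cochain0_on_in[OF b]
  show "b (ibar U 0 j) (src G (rho G g)) \<otimes> inv (b (ibar U 0 i) (rng G (rho G g))) =
      bar S (b j (src G g) \<otimes> inv (b i (rng G g)))"
    using b gD ij bin by (simp add: cochain0_on_def)
  fix k h assume k: "k \<in> Idx U 0" and h: "h \<in> over U j k" "src G g = rng G h"
  have [simp]: "b j (rng G h) \<in> carrier S" "b k (src G h) \<in> carrier S" "b i (rng G g) \<in> carrier S"
    using bin ij k overD[OF h(1)] gD by auto
  have "b j (rng G h) \<otimes> inv (b i (rng G g)) \<otimes> (b k (src G h) \<otimes> inv (b j (rng G h))) =
      (b j (rng G h) \<otimes> inv (b j (rng G h))) \<otimes> (b k (src G h) \<otimes> inv (b i (rng G g)))"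
    by (simp only: m_ac m_closed inv_closed \<open>b j (rng G h) \<in> carrier S\<close>
        \<open>b k (src G h) \<in> carrier S\<close> \<open>b i (rng G g) \<in> carrier S\<close>)
  also have "\<dots> = b k (src G h) \<otimes> inv (b i (rng G g))" by simp
  finally show "b k (src G (mul G g h)) \<otimes> inv (b i (rng G (mul G g h))) =
      b j (src G g) \<otimes> inv (b i (rng G g)) \<otimes> (b k (src G h) \<otimes> inv (b j (rng G h)))"
    using gD overD[OF h(1)] h(2) by simp
qed

lemma coboundaries_eq:
  "coboundaries 1 G S U =
     {mk U (\<lambda>i j g. b j (src G g) \<otimes> inv (b i (rng G g))) | b. cochain0_on U b}"
proof (intro subset_antisym subsetI)
  \<comment> \<open>The simplex [0] has a single face, so an index function of degree 0 amounts to
    one index.\<close>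
  let ?lv = "\<lambda>i. \<lambda>\<phi>\<in>faces 0. i"
  have lv: "?lv i \<in> Lam U 0" if "i \<in> Idx U 0" for i
    using that by (auto simp: Lam_def faces_0 dom_ord_def)
  have lv_eq: "l = ?lv (l [0])" if "l \<in> Lam U 0" for l
    using that by (auto simp: Lam_def faces_0 fun_eq_iff PiE_iff extensional_def)
  have olv: "vertex x \<in> Opn_lam G U 0 (?lv i) \<longleftrightarrow> x \<in> ob U i" if "x \<in> objects G" for x i
    using that by (simp add: Opn_lam_def faces_0 dom_ord_def ob_def)
  have lp: "lam_pull [k] l = ?lv (l [k])" for k l
    by (auto simp: lam_pull_def dom_ord_def faces_0 after_def)
  {
    fix c assume "c \<in> coboundaries 1 G S U"
    then obtain b where b: "b \<in> carrier (CR 0 G S U)" "c = dif 0 G S U b"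
      by (auto simp: coboundaries_def)
    let ?b = "\<lambda>i x. b (?lv i) (vertex x)"
    have "cochain0_on U ?b"
      unfolding cochain0_on_def
    proof (intro ballI conjI)
      fix i assume i: "i \<in> Idx U 0"
      have "continuous_map (subtopology (Obj G) (ob U i)) (subtopology (nerve G 0) (Opn_lam G U 0 (?lv i))) vertex"
        using olv by (auto simp: continuous_map_in_subtopology continuous_map_from_subtopology vertex_continuous)
      moreover have "continuous_map (subtopology (nerve G 0) (Opn_lam G U 0 (?lv i))) (top_of S) (b (?lv i))"
        using b(1) lv[OF i] by (simp add: CR_def)
      ultimately have "continuous_map (subtopology (Obj G) (ob U i)) (top_of S) (b (?lv i) \<circ> vertex)"
        by (rule continuous_map_compose)
      then show "continuous_map (subtopology (Obj G) (ob U i)) (top_of S) (?b i)"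
        by (simp add: comp_def)
      fix x assume x: "x \<in> ob U i"
      have "b (lam_conj U 0 (?lv i)) (nerve_rho G 0 (vertex x)) = bar S (b (?lv i) (vertex x))"
        using b(1) lv[OF i] olv[of x i] x obD[OF x] by (simp add: CR_def)
      moreover have "lam_conj U 0 (?lv i) = ?lv (ibar U 0 i)"
        by (auto simp: lam_conj_def faces_0 dom_ord_def)
      ultimately show "?b (ibar U 0 i) (\<rho> x) = bar S (?b i x)"
        using nerve_rho_vertex[OF obD[OF x]] by simp
    qed
    moreover have "c = mk U (\<lambda>i j g. ?b j (src G g) \<otimes> inv (?b i (rng G g)))"
    proof -
      have "dif 0 G S U b l \<gamma> = ?b (l [1]) (src G (\<gamma> (0, 1))) \<otimes> inv (?b (l [0]) (rng G (\<gamma> (0, 1))))"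
        if l: "l \<in> Lam U 1" and \<gamma>: "\<gamma> \<in> Opn_lam G U 1 l" for l \<gamma>
      proof -
        obtain g where g: "g \<in> over U (l [0]) (l [1])" "\<gamma> = edge g" using Opn_lam_1_cases[OF \<gamma>] .
        then show ?thesis using dif_0[OF U b(1) l \<gamma>] overD(1)[OF g(1)] by (simp add: lp)
      qed
      then show ?thesis
        unfolding b(2) by (simp add: mk_def dif_def fun_eq_iff restrict_def)
    qed
    ultimately show "c \<in> {mk U (\<lambda>i j g. b j (src G g) \<otimes> inv (b i (rng G g))) | b. cochain0_on U b}"
      by (intro CollectI exI[of _ ?b] conjI)
  next
    fix c assume "c \<in> {mk U (\<lambda>i j g. b j (src G g) \<otimes> inv (b i (rng G g))) | b. cochain0_on U b}"
    then obtain b where b: "cochain0_on U b" "c = mk U (\<lambda>i j g. b j (src G g) \<otimes> inv (b i (rng G g)))"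
      by blast
    let ?b = "\<lambda>l\<in>Lam U 0. \<lambda>\<gamma>\<in>Opn_lam G U 0 l. b (l [0]) (rng G (\<gamma> (0, 0)))"
    have l0: "l [0] \<in> Idx U 0" if "l \<in> Lam U 0" for l
      using PiE_mem[OF that[unfolded Lam_def], of "[0]"] by (simp add: dom_ord_def)
    have vx: "\<exists>x\<in>ob U (l [0]). \<gamma> = vertex x \<and> rng G (\<gamma> (0, 0)) = x"
      if "l \<in> Lam U 0" "\<gamma> \<in> Opn_lam G U 0 l" for l \<gamma>
    proof -
      have "\<gamma> \<in> topspace (nerve G 0)" using that by (simp add: Opn_lam_def)
      then have 1: "rng G (\<gamma> (0, 0)) \<in> objects G" "\<gamma> = vertex (rng G (\<gamma> (0, 0)))"
        using nerve_in[of \<gamma> 0 0 0] nerve0_eq by auto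
      then have "vertex (rng G (\<gamma> (0, 0))) \<in> Opn_lam G U 0 (?lv (l [0]))"
        using that lv_eq[OF that(1)] by metis
      then show ?thesis using olv[OF 1(1)] 1 by blast
    qed
    have cont: "continuous_map (subtopology (nerve G 0) (Opn_lam G U 0 l)) (top_of S) (?b l)"
      if l: "l \<in> Lam U 0" for l
    proof -
      have "continuous_map (nerve G 0) (Obj G) (\<lambda>\<gamma>. rng G (\<gamma> (0, 0)))"
        using continuous_map_compose[OF nerve_apply_continuous[of 0 0 0] rng_continuous] by (simp add: comp_def)
      then have "continuous_map (subtopology (nerve G 0) (Opn_lam G U 0 l)) (subtopology (Obj G) (ob U (l [0])))
          (\<lambda>\<gamma>. rng G (\<gamma> (0, 0)))"
        unfolding continuous_map_in_subtopology
        using vx[OF l] by (auto simp: continuous_map_from_subtopology)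
      moreover have "continuous_map (subtopology (Obj G) (ob U (l [0]))) (top_of S) (b (l [0]))"
        using b(1) l0[OF l] by (simp add: cochain0_on_def)
      ultimately have "continuous_map (subtopology (nerve G 0) (Opn_lam G U 0 l)) (top_of S)
          (b (l [0]) \<circ> (\<lambda>\<gamma>. rng G (\<gamma> (0, 0))))" by (rule continuous_map_compose)
      then show ?thesis by (rule continuous_map_eq) (use l in auto)
    qed
    have conj: "?b (lam_conj U 0 l) (nerve_rho G 0 \<gamma>) = bar S (?b l \<gamma>)"
      if l: "l \<in> Lam U 0" and \<gamma>: "\<gamma> \<in> Opn_lam G U 0 l" for l \<gamma>
    proof -
      obtain x where x: "x \<in> ob U (l [0])" "\<gamma> = vertex x" "rng G (\<gamma> (0, 0)) = x" using vx[OF l \<gamma>] by blast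
      have "lam_conj U 0 l [0] = ibar U 0 (l [0])" by (simp add: lam_conj_def dom_ord_def)
      moreover have "b (ibar U 0 (l [0])) (\<rho> x) = bar S (b (l [0]) x)"
        using b(1) l0[OF l] x(1) by (simp add: cochain0_on_def)
      moreover have "rng G (nerve_rho G 0 \<gamma> (0, 0)) = \<rho> x"
        using x obD[OF x(1)] by (simp add: nerve_rho_vertex vertex_apply)
      ultimately show ?thesis
        using l \<gamma> lam_conj_in[OF U l] Opn_lam_conj[OF U l \<gamma>] x(3) by simp
    qed
    have "b (l [0]) (rng G (\<gamma> (0, 0))) \<in> carrier S" if "l \<in> Lam U 0" "\<gamma> \<in> Opn_lam G U 0 l" for l \<gamma>
      using vx[OF that] cochain0_on_in[OF b(1) l0[OF that(1)]] by auto
    then have bC: "?b \<in> carrier (CR 0 G S U)"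
      unfolding CR_def using cont conj by auto
    moreover have "c = dif 0 G S U ?b"
    proof -
      have "dif 0 G S U ?b l \<gamma> = b (l [1]) (src G (\<gamma> (0, 1))) \<otimes> inv (b (l [0]) (rng G (\<gamma> (0, 1))))"
        if l: "l \<in> Lam U 1" and \<gamma>: "\<gamma> \<in> Opn_lam G U 1 l" for l \<gamma>
      proof -
        obtain g where g: "g \<in> over U (l [0]) (l [1])" "\<gamma> = edge g" using Opn_lam_1_cases[OF \<gamma>] .
        note gD = overD[OF g(1)]
        have "?lv (l [0]) \<in> Lam U 0" "?lv (l [1]) \<in> Lam U 0" using lv Lam_1_in[OF U l] by auto
        moreover have "vertex (rng G g) \<in> Opn_lam G U 0 (?lv (l [0]))"
          "vertex (src G g) \<in> Opn_lam G U 0 (?lv (l [1]))" using olv gD by auto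
        ultimately show ?thesis
          using dif_0[OF U bC l \<gamma>] g(2) gD by (simp add: lp vertex_apply)
      qed
      then show ?thesis
        unfolding b(2) by (simp add: mk_def dif_def fun_eq_iff restrict_def)
    qed
    ultimately show "c \<in> coboundaries 1 G S U" by (auto simp: coboundaries_def)
  }
qed

end


section \<open>The cohomology group of a cover\<close>

abbreviation Z1 :: "('g, 'j) cover_data \<Rightarrow> ('g, 's, 'j) cochain monoid" where
  "Z1 U \<equiv> (CR 1 G S U)\<lparr>carrier := cocycles 1 G S U\<rparr>"

lemma HR_1: "HR 1 G S U = Z1 U Mod coboundaries 1 G S U"
  by (simp add: HR_def)

context
  fixes U :: "('g, 'j) cover_data"
  assumes U: "real_open_cover G U"
begin

lemma cocyclesE:
  assumes "c \<in> cocycles 1 G S U"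
  obtains f where "cocycle_on U f" "c = mk U f"
  using that val_cocycle_on[OF U assms] mk_val[OF U assms] by metis

lemma Z1_mult: "mk U f \<otimes>\<^bsub>Z1 U\<^esub> mk U f' = mk U (\<lambda>i j g. f i j g \<otimes> f' i j g)"
  using mk_mult[OF U] by simp

text \<open>The axioms are verified directly on cocycles: each one is of the form
  \<open>mk U f\<close>, where the product becomes pointwise multiplication in
  \<open>S\<close>.\<close>

lemma Z1_comm_group: "comm_group (Z1 U)"
proof (rule comm_groupI)
  show "x \<otimes>\<^bsub>Z1 U\<^esub> y \<in> carrier (Z1 U)" if "x \<in> carrier (Z1 U)" "y \<in> carrier (Z1 U)" for x y
  proof -
    from that have "x \<in> cocycles 1 G S U" "y \<in> cocycles 1 G S U" by simp_all
    then obtain f f' where f: "cocycle_on U f" "x = mk U f" "cocycle_on U f'" "y = mk U f'"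
      by (elim cocyclesE) blast
    show ?thesis
      unfolding f Z1_mult using mk_cocycle[OF U cocycle_on_mult[OF U f(1,3)]] by simp
  qed
  show "\<one>\<^bsub>Z1 U\<^esub> \<in> carrier (Z1 U)"
    using mk_cocycle[OF U cocycle_on_one[OF U]] mk_one[OF U] by simp
  fix x y z assume "x \<in> carrier (Z1 U)" "y \<in> carrier (Z1 U)"
  then have "x \<in> cocycles 1 G S U" "y \<in> cocycles 1 G S U" by simp_all
  then obtain f f' where f: "cocycle_on U f" "x = mk U f" "cocycle_on U f'" "y = mk U f'"
    by (elim cocyclesE) blast
  show "x \<otimes>\<^bsub>Z1 U\<^esub> y = y \<otimes>\<^bsub>Z1 U\<^esub> x"
    unfolding f Z1_mult using cocycle_on_in[OF f(1)] cocycle_on_in[OF f(3)]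
    by (intro mk_cong[OF U]) (auto simp: m_comm)
  show "\<one>\<^bsub>Z1 U\<^esub> \<otimes>\<^bsub>Z1 U\<^esub> x = x"
    using mk_one[OF U] mk_mult[OF U, of "\<lambda>i j g. \<one>" f] cocycle_on_in[OF f(1)]
    unfolding f by (auto intro!: mk_cong[OF U])
  have "mk U (\<lambda>i j g. inv f i j g) \<otimes>\<^bsub>Z1 U\<^esub> x = \<one>\<^bsub>Z1 U\<^esub>"
    using mk_one[OF U] mk_mult[OF U, of "\<lambda>i j g. inv f i j g" f] cocycle_on_in[OF f(1)]
    unfolding f by (auto intro!: mk_cong[OF U])
  then show "\<exists>y\<in>carrier (Z1 U). y \<otimes>\<^bsub>Z1 U\<^esub> x = \<one>\<^bsub>Z1 U\<^esub>"
    using mk_cocycle[OF U cocycle_on_inv[OF U f(1)]] by auto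
  assume "z \<in> carrier (Z1 U)"
  then have "z \<in> cocycles 1 G S U" by simp
  then obtain f'' where f'': "cocycle_on U f''" "z = mk U f''" by (rule cocyclesE)
  show "x \<otimes>\<^bsub>Z1 U\<^esub> y \<otimes>\<^bsub>Z1 U\<^esub> z = x \<otimes>\<^bsub>Z1 U\<^esub> (y \<otimes>\<^bsub>Z1 U\<^esub> z)"
    unfolding f f'' Z1_mult
    using cocycle_on_in[OF f(1)] cocycle_on_in[OF f(3)] cocycle_on_in[OF f''(1)]
    by (intro mk_cong[OF U]) (auto simp: m_assoc)
qed

abbreviation coboundary :: "('j \<Rightarrow> 'x \<Rightarrow> 's) \<Rightarrow> 'j \<Rightarrow> 'j \<Rightarrow> 'g \<Rightarrow> 's" where
  "coboundary b i j g \<equiv> b j (src G g) \<otimes> inv (b i (rng G g))"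

lemma coboundary_in:
  assumes "cochain0_on U b" "i \<in> Idx U 0" "j \<in> Idx U 0" "g \<in> over U i j"
  shows "b j (src G g) \<in> carrier S" "b i (rng G g) \<in> carrier S"
  using cochain0_on_in[OF U assms(1,3) overD(3)[OF assms(4)]]
    cochain0_on_in[OF U assms(1,2) overD(2)[OF assms(4)]] .

lemma coboundaryI: "cochain0_on U b \<Longrightarrow> mk U (coboundary b) \<in> coboundaries 1 G S U"
  unfolding coboundaries_eq[OF U] by (intro CollectI exI[of _ b] conjI refl)

lemma coboundaryE:
  assumes "x \<in> coboundaries 1 G S U"
  obtains b where "cochain0_on U b" "x = mk U (coboundary b)"
  using assms unfolding coboundaries_eq[OF U] by blast

lemma coboundary_cocycle: "cochain0_on U b \<Longrightarrow> mk U (coboundary b) \<in> carrier (Z1 U)"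
  using mk_cocycle[OF U cocycle_on_coboundary[OF U]] by simp

lemma cochain0_on_mult:
  assumes "cochain0_on U b" "cochain0_on U b'"
  shows "cochain0_on U (\<lambda>i x. b i x \<otimes> b' i x)"
  using assms cochain0_on_in[OF U assms(1)] cochain0_on_in[OF U assms(2)]
  by (auto simp: cochain0_on_def intro!: continuous_map_mult)

lemma cochain0_on_inv:
  assumes "cochain0_on U b" shows "cochain0_on U (\<lambda>i x. inv (b i x))"
  using assms cochain0_on_in[OF U assms(1)]
  by (auto simp: cochain0_on_def intro!: continuous_map_inv)

lemma coboundaries_normal: "coboundaries 1 G S U \<lhd> Z1 U"
proof -
  interpret Z1: comm_group "Z1 U" by (rule Z1_comm_group)
  have "subgroup (coboundaries 1 G S U) (Z1 U)"
  proof (rule Z1.subgroupI)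
    show "coboundaries 1 G S U \<subseteq> carrier (Z1 U)"
      using coboundary_cocycle by (blast elim: coboundaryE)
    have "cochain0_on U (\<lambda>_ _. \<one>)" by (simp add: cochain0_on_def topspace_top_of)
    then show "coboundaries 1 G S U \<noteq> {}" using coboundaryI by blast
    fix x assume "x \<in> coboundaries 1 G S U"
    then obtain b where b: "cochain0_on U b" "x = mk U (coboundary b)" by (rule coboundaryE)
    let ?y = "mk U (coboundary (\<lambda>i x. inv (b i x)))"
    have yc: "?y \<in> coboundaries 1 G S U" using coboundaryI[OF cochain0_on_inv[OF b(1)]] .
    have "inv\<^bsub>Z1 U\<^esub> x = ?y"
    proof (rule Z1.inv_equality)
      show "x \<in> carrier (Z1 U)" "?y \<in> carrier (Z1 U)"
        unfolding b(2) using coboundary_cocycle[OF b(1)] coboundary_cocycle[OF cochain0_on_inv[OF b(1)]] .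
      have "?y \<otimes>\<^bsub>Z1 U\<^esub> x = mk U (\<lambda>i j g. \<one>)"
        unfolding b(2) Z1_mult
      proof (rule mk_cong[OF U])
        fix i j g assume "i \<in> Idx U 0" "j \<in> Idx U 0" "g \<in> over U i j"
        then have [simp]: "b j (src G g) \<in> carrier S" "b i (rng G g) \<in> carrier S"
          using coboundary_in[OF b(1)] by auto
        have "inv (b j (src G g)) \<otimes> inv (inv (b i (rng G g))) \<otimes> (b j (src G g) \<otimes> inv (b i (rng G g)))
          = inv (b j (src G g)) \<otimes> b j (src G g) \<otimes> (b i (rng G g) \<otimes> inv (b i (rng G g)))"
          by (simp only: m_ac inv_inv m_closed inv_closed \<open>b j (src G g) \<in> carrier S\<close> \<open>b i (rng G g) \<in> carrier S\<close>)
        also have "\<dots> = \<one>" by simp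
        finally show "inv (b j (src G g)) \<otimes> inv (inv (b i (rng G g))) \<otimes> (b j (src G g) \<otimes> inv (b i (rng G g))) = \<one>" .
      qed
      then show "?y \<otimes>\<^bsub>Z1 U\<^esub> x = \<one>\<^bsub>Z1 U\<^esub>" using mk_one[OF U] by simp
    qed
    then show "inv\<^bsub>Z1 U\<^esub> x \<in> coboundaries 1 G S U" using yc by simp
    fix x' assume "x' \<in> coboundaries 1 G S U"
    then obtain b' where b': "cochain0_on U b'" "x' = mk U (coboundary b')" by (rule coboundaryE)
    have "x \<otimes>\<^bsub>Z1 U\<^esub> x' = mk U (coboundary (\<lambda>i x. b i x \<otimes> b' i x))"
      unfolding b(2) b'(2) Z1_mult
      by (intro mk_cong[OF U]) (simp add: coboundary_in[OF b(1)] coboundary_in[OF b'(1)] inv_mult m_ac)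
    then show "x \<otimes>\<^bsub>Z1 U\<^esub> x' \<in> coboundaries 1 G S U"
      using coboundaryI[OF cochain0_on_mult[OF b(1) b'(1)]] by simp
  qed
  then show ?thesis by (rule Z1.subgroup_imp_normal)
qed

text \<open>A cohomology class written as the relation c' = (db)c between functions. This is how two
  systems of charts on one space turn out to be related.\<close>

lemma coset_eq:
  assumes c: "c \<in> cocycles 1 G S U"
  shows "coboundaries 1 G S U #>\<^bsub>Z1 U\<^esub> c = {c' \<in> cocycles 1 G S U. \<exists>b. cochain0_on U b \<and>
    (\<forall>i\<in>Idx U 0. \<forall>j\<in>Idx U 0. \<forall>g\<in>over U i j. val U c' i j g = coboundary b i j g \<otimes> val U c i j g)}"
    (is "?L = ?R")
proof (intro subset_antisym subsetI)
  note vc = val_cocycle_on[OF U c]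
  have mkc: "mk U (coboundary b) \<otimes>\<^bsub>Z1 U\<^esub> c = mk U (\<lambda>i j g. coboundary b i j g \<otimes> val U c i j g)" for b
    using Z1_mult[of "coboundary b" "val U c"] mk_val[OF U c] by simp
  { fix c' assume "c' \<in> ?L"
    then obtain b where b: "cochain0_on U b" "c' = mk U (coboundary b) \<otimes>\<^bsub>Z1 U\<^esub> c"
      unfolding r_coset_def by (blast elim: coboundaryE)
    have "cocycle_on U (\<lambda>i j g. coboundary b i j g \<otimes> val U c i j g)"
      by (rule cocycle_on_mult[OF U cocycle_on_coboundary[OF U b(1)] vc])
    then show "c' \<in> ?R" unfolding b(2) mkc using mk_cocycle[OF U] val_mk[OF U] b(1) by blast
  next
    fix c' assume "c' \<in> ?R"
    then obtain b where b: "cochain0_on U b" and c': "c' \<in> cocycles 1 G S U"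
      "\<And>i j g. i\<in>Idx U 0 \<Longrightarrow> j\<in>Idx U 0 \<Longrightarrow> g\<in>over U i j \<Longrightarrow> val U c' i j g = coboundary b i j g \<otimes> val U c i j g"
      by blast
    have "c' = mk U (val U c')" using mk_val[OF U c'(1)] by simp
    also have "\<dots> = mk U (coboundary b) \<otimes>\<^bsub>Z1 U\<^esub> c" unfolding mkc by (rule mk_cong[OF U c'(2)])
    finally show "c' \<in> ?L" using coboundaryI[OF b] unfolding r_coset_def by blast
  }
qed

lemma carrier_HR: "carrier (HR 1 G S U) = {coboundaries 1 G S U #>\<^bsub>Z1 U\<^esub> c | c. c \<in> cocycles 1 G S U}"
  unfolding HR_1 FactGroup_def RCOSETS_def by auto

lemma one_HR: "\<one>\<^bsub>HR 1 G S U\<^esub> = coboundaries 1 G S U #>\<^bsub>Z1 U\<^esub> mk U (\<lambda>i j g. \<one>)"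
proof -
  interpret Z1: comm_group "Z1 U" by (rule Z1_comm_group)
  have "coboundaries 1 G S U \<subseteq> carrier (Z1 U)"
    using subgroup.subset[OF normal_imp_subgroup[OF coboundaries_normal]] .
  from Z1.coset_mult_one[OF this] show ?thesis
    unfolding HR_1 FactGroup_def using mk_one[OF U] by simp
qed

lemma mult_HR:
  assumes "c \<in> cocycles 1 G S U" "d \<in> cocycles 1 G S U"
  shows "(coboundaries 1 G S U #>\<^bsub>Z1 U\<^esub> c) \<otimes>\<^bsub>HR 1 G S U\<^esub> (coboundaries 1 G S U #>\<^bsub>Z1 U\<^esub> d) =
    coboundaries 1 G S U #>\<^bsub>Z1 U\<^esub> mk U (\<lambda>i j g. val U c i j g \<otimes> val U d i j g)"
proof -
  have "c \<otimes>\<^bsub>Z1 U\<^esub> d = mk U (\<lambda>i j g. val U c i j g \<otimes> val U d i j g)"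
    using Z1_mult[of "val U c" "val U d"] mk_val[OF U] assms by simp
  then show ?thesis
    unfolding HR_1 FactGroup_def using normal.rcos_sum[OF coboundaries_normal, of c d] assms by simp
qed

end

text \<open>Since the value of a cocycle is determined by the indices at the two vertices, only the
  degree 0 part of \<theta> remains visible after passing to \<open>val\<close>.\<close>

lemma refine_cochain_1:
  assumes U: "real_open_cover G U" and V: "real_open_cover G V" and \<theta>: "refinement U V \<theta>"
    and c: "c \<in> cocycles 1 G S U"
  shows "refine_cochain 1 G V \<theta> c = mk V (\<lambda>i j. val U c (\<theta> 0 i) (\<theta> 0 j))"
proof -
  have eq: "c (\<lambda>\<phi>\<in>faces 1. \<theta> (dom_ord \<phi>) (l \<phi>)) \<gamma> = val U c (\<theta> 0 (l [0])) (\<theta> 0 (l [1])) (\<gamma> (0, 1))"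
    if l: "l \<in> Lam V 1" and \<gamma>: "\<gamma> \<in> Opn_lam G V 1 l" for l \<gamma>
  proof -
    let ?m = "\<lambda>\<phi>\<in>faces 1. \<theta> (dom_ord \<phi>) (l \<phi>)"
    have lin: "l \<phi> \<in> Idx V (dom_ord \<phi>)" if "\<phi> \<in> faces 1" for \<phi>
      using PiE_mem[OF l[unfolded Lam_def] that] .
    then have m: "?m \<in> Lam U 1" using \<theta> by (auto simp: Lam_def refinement_def)
    have o: "\<gamma> \<in> Opn_lam G U 1 ?m"
      using \<gamma> lin \<theta> unfolding Opn_lam_def refinement_def by fastforce
    obtain g where g: "g \<in> over V (l [0]) (l [1])" "\<gamma> = edge g" using Opn_lam_1_cases[OF V \<gamma>] .
    then show ?thesis
      using cocycle_val[OF U c m, of g] o overD(1)[OF g(1)] by (simp add: dom_ord_def)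
  qed
  show ?thesis unfolding refine_cochain_def mk_def by (intro restrict_ext) (simp add: eq[simplified])
qed

lemma ob_refinement: "refinement U V \<theta> \<Longrightarrow> i \<in> Idx V 0 \<Longrightarrow> ob V i \<subseteq> ob U (\<theta> 0 i)"
  by (auto simp: refinement_def ob_def)

lemma over_refinement:
  "refinement U V \<theta> \<Longrightarrow> i \<in> Idx V 0 \<Longrightarrow> j \<in> Idx V 0 \<Longrightarrow> over V i j \<subseteq> over U (\<theta> 0 i) (\<theta> 0 j)"
  using ob_refinement by (fastforce simp: over_def)

lemma refinementD:
  assumes "refinement U V \<theta>" "i \<in> Idx V k"
  shows "\<theta> k i \<in> Idx U k" "\<theta> k (ibar V k i) = ibar U k (\<theta> k i)" "Opn V k i \<subseteq> Opn U k (\<theta> k i)"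
  using assms by (auto simp: refinement_def)

lemma cocycle_on_refine:
  assumes V: "real_open_cover G V" and \<theta>: "refinement U V \<theta>" and f: "cocycle_on U f"
  shows "cocycle_on V (\<lambda>i j. f (\<theta> 0 i) (\<theta> 0 j))"
  unfolding cocycle_on_def
proof (intro ballI conjI impI)
  note r = refinementD[OF \<theta>] and o = over_refinement[OF \<theta>]
  fix i j assume ij: "i \<in> Idx V 0" "j \<in> Idx V 0"
  show "continuous_map (subtopology (Arr G) (over V i j)) (top_of S) (f (\<theta> 0 i) (\<theta> 0 j))"
    by (rule continuous_map_from_subtopology_mono[OF cocycle_on_continuous[OF f r(1)[OF ij(1)] r(1)[OF ij(2)]] o[OF ij]])
  fix g assume g: "g \<in> over V i j"
  then show "f (\<theta> 0 (ibar V 0 i)) (\<theta> 0 (ibar V 0 j)) (rho G g) = bar S (f (\<theta> 0 i) (\<theta> 0 j) g)"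
    using cocycle_on_rho[OF f r(1)[OF ij(1)] r(1)[OF ij(2)], of g] o[OF ij] r(2) ij by auto
  fix k h assume "k \<in> Idx V 0" "h \<in> over V j k" "src G g = rng G h"
  then show "f (\<theta> 0 i) (\<theta> 0 k) (mul G g h) = f (\<theta> 0 i) (\<theta> 0 j) g \<otimes> f (\<theta> 0 j) (\<theta> 0 k) h"
    using cocycle_on_mul[OF f r(1)[OF ij(1)] r(1)[OF ij(2)], of g "\<theta> 0 k" h] g o ij r(1) by blast
qed


section \<open>Atlases\<close>

definition chart_space :: "('g, 'j) cover_data \<Rightarrow> 'j \<Rightarrow> ('x \<times> 's) topology" where
  "chart_space U i = subtopology (prod_topology (Obj G) (top_of S)) (ob U i \<times> carrier S)"

text \<open>Injectivity is asked within a fibre and extends to the whole chart because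
  \<open>anchor\<close> separates fibres. With continuity and openness it makes each chart a
  homeomorphism onto the part of \<open>Z\<close> over \<open>ob U i\<close>, see
  \<open>atlas_homeomorphic\<close>. That \<open>anchor\<close> takes values in the object space has
  to be stated, as no axioms are assumed of \<open>Z\<close>.\<close>

definition atlas ::
  "('g, 'j) cover_data \<Rightarrow> ('x, 'g, 's, 'z) gen_hom_data \<Rightarrow> ('j \<Rightarrow> 'x \<times> 's \<Rightarrow> 'z) \<Rightarrow> bool" where
  "atlas U Z h \<longleftrightarrow> anchor Z \<in> points Z \<rightarrow> objects G \<and> (\<forall>i\<in>Idx U 0.
     continuous_map (chart_space U i) (Top Z) (h i) \<and> open_map (chart_space U i) (Top Z) (h i) \<and>
     h i ` (ob U i \<times> carrier S) = {z \<in> points Z. anchor Z z \<in> ob U i} \<and>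
     (\<forall>x\<in>ob U i. \<forall>s\<in>carrier S. anchor Z (h i (x, s)) = x \<and>
        tau Z (h i (x, s)) = h (ibar U 0 i) (\<rho> x, bar S s) \<and>
        (\<forall>t\<in>carrier S. ract Z (h i (x, s)) t = h i (x, s \<otimes> t) \<and>
           (h i (x, s) = h i (x, t) \<longrightarrow> s = t))))"

definition transition ::
  "('g, 'j) cover_data \<Rightarrow> ('x, 'g, 's, 'z) gen_hom_data \<Rightarrow> ('j \<Rightarrow> 'x \<times> 's \<Rightarrow> 'z) \<Rightarrow>
   ('j \<Rightarrow> 'j \<Rightarrow> 'g \<Rightarrow> 's) \<Rightarrow> bool" where
  "transition U Z h f \<longleftrightarrow> (\<forall>i\<in>Idx U 0. \<forall>j\<in>Idx U 0. \<forall>g\<in>over U i j. \<forall>t\<in>carrier S.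
     lact Z g (h j (src G g, t)) = h i (rng G g, f i j g \<otimes> t))"

text \<open>
  The axioms of a Real generalized homomorphism are not assumed of \<open>Z\<close>, they follow from the charts
  (see \<open>represents_real_gen_hom\<close>). Sums, which live in another type, can thus be compared with
  their summands through charts alone.
\<close>

definition represents ::
  "('x, 'g, 's, 'z) gen_hom_data \<Rightarrow> ('g, 'j) cover_data \<Rightarrow> ('g, 's, 'j) cochain \<Rightarrow> bool" where
  "represents Z U c \<longleftrightarrow> c \<in> cocycles 1 G S U \<and> (\<exists>h. atlas U Z h \<and> transition U Z h (val U c))"

definition coord :: "('g, 'j) cover_data \<Rightarrow> ('j \<Rightarrow> 'x \<times> 's \<Rightarrow> 'z) \<Rightarrow> 'j \<Rightarrow> 'z \<Rightarrow> 's" where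
  "coord U h i z = snd (inv_into (ob U i \<times> carrier S) (h i) z)"

lemma topspace_chart_space [simp]: "topspace (chart_space U i) = ob U i \<times> carrier S"
  by (auto simp: chart_space_def topspace_top_of obD)

lemma openin_chart_space:
  assumes "real_open_cover G U" "i \<in> Idx U 0"
  shows "openin (chart_space U i) A \<longleftrightarrow> openin (prod_topology (Obj G) (top_of S)) A \<and> A \<subseteq> ob U i \<times> carrier S"
proof -
  have "openin (prod_topology (Obj G) (top_of S)) (ob U i \<times> carrier S)"
    using ob_open[OF assms] openin_topspace[of "top_of S"]
    by (auto simp: openin_prod_Times_iff topspace_top_of)
  then show ?thesis unfolding chart_space_def by (rule openin_open_subtopology)
qed

lemma continuous_map_into_chart_space:
  assumes "continuous_map X (Obj G) f" "continuous_map X (top_of S) g" "\<And>p. p \<in> topspace X \<Longrightarrow> f p \<in> ob U i"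
  shows "continuous_map X (chart_space U i) (\<lambda>p. (f p, g p))"
  using assms continuous_map_funspace[OF assms(2)] topspace_top_of
  unfolding chart_space_def continuous_map_in_subtopology by (auto simp: continuous_map_pairedI)

lemma continuous_map_chart_fst: "continuous_map (chart_space U i) (subtopology (Obj G) (ob U i)) fst"
  unfolding continuous_map_in_subtopology
  by (auto simp: chart_space_def intro!: continuous_map_from_subtopology continuous_map_fst)

lemma continuous_map_chart_snd: "continuous_map (chart_space U i) (top_of S) snd"
  by (auto simp: chart_space_def intro!: continuous_map_from_subtopology continuous_map_snd)

lemma continuous_map_chart_fst': "continuous_map (chart_space U i) (Obj G) fst"
  using continuous_map_chart_fst[of U i] by (simp add: continuous_map_in_subtopology)

lemma continuous_map_chart_base:
  "continuous_map (subtopology (Obj G) (ob U i)) (top_of S) b \<Longrightarrow>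
    continuous_map (chart_space U i) (top_of S) (\<lambda>p. b (fst p))"
  using continuous_map_compose[OF continuous_map_chart_fst] by (fastforce simp: comp_def)

lemma atlasD:
  assumes "atlas U Z h" "i \<in> Idx U 0"
  shows atlas_continuous: "continuous_map (chart_space U i) (Top Z) (h i)"
    and atlas_open: "open_map (chart_space U i) (Top Z) (h i)"
    and atlas_image: "h i ` (ob U i \<times> carrier S) = {z \<in> points Z. anchor Z z \<in> ob U i}"
    and atlas_anchor: "x \<in> ob U i \<Longrightarrow> s \<in> carrier S \<Longrightarrow> anchor Z (h i (x, s)) = x"
    and atlas_tau: "x \<in> ob U i \<Longrightarrow> s \<in> carrier S \<Longrightarrow> tau Z (h i (x, s)) = h (ibar U 0 i) (\<rho> x, bar S s)"
    and atlas_ract: "x \<in> ob U i \<Longrightarrow> s \<in> carrier S \<Longrightarrow> t \<in> carrier S \<Longrightarrow> ract Z (h i (x, s)) t = h i (x, s \<otimes> t)"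
    and atlas_inj: "x \<in> ob U i \<Longrightarrow> s \<in> carrier S \<Longrightarrow> t \<in> carrier S \<Longrightarrow> h i (x, s) = h i (x, t) \<Longrightarrow> s = t"
  using assms unfolding atlas_def by blast+

lemma atlas_in:
  assumes "atlas U Z h" "i \<in> Idx U 0" "x \<in> ob U i" "s \<in> carrier S"
  shows "h i (x, s) \<in> points Z"
  using atlas_image[OF assms(1,2)] assms(3,4) by blast

lemma atlas_anchor_in: "atlas U Z h \<Longrightarrow> z \<in> points Z \<Longrightarrow> anchor Z z \<in> objects G"
  by (auto simp: atlas_def)

lemma atlas_cases:
  assumes "atlas U Z h" "i \<in> Idx U 0" "z \<in> points Z" "anchor Z z \<in> ob U i"
  obtains s where "s \<in> carrier S" "z = h i (anchor Z z, s)"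
proof -
  have "z \<in> h i ` (ob U i \<times> carrier S)" using atlas_image[OF assms(1,2)] assms(3,4) by blast
  then obtain x s where "x \<in> ob U i" "s \<in> carrier S" "z = h i (x, s)" by auto
  then show ?thesis using that atlas_anchor[OF assms(1,2)] by auto
qed

lemma atlas_inj_on:
  assumes "atlas U Z h" "i \<in> Idx U 0"
  shows "inj_on (h i) (ob U i \<times> carrier S)"
proof (rule inj_onI, clarify)
  fix x s y t assume *: "x \<in> ob U i" "s \<in> carrier S" "y \<in> ob U i" "t \<in> carrier S" "h i (x, s) = h i (y, t)"
  then have "x = y" using atlas_anchor[OF assms] by metis
  then show "x = y \<and> s = t" using atlas_inj[OF assms] * by blast
qed

lemma coord_chart [simp]:
  assumes "atlas U Z h" "i \<in> Idx U 0" "x \<in> ob U i" "s \<in> carrier S"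
  shows "coord U h i (h i (x, s)) = s"
  using assms by (simp add: coord_def inv_into_f_f[OF atlas_inj_on])

lemma coord_in:
  assumes "atlas U Z h" "i \<in> Idx U 0" "z \<in> points Z" "anchor Z z \<in> ob U i"
  shows "coord U h i z \<in> carrier S" "h i (anchor Z z, coord U h i z) = z"
  using atlas_cases[OF assms] coord_chart[OF assms(1,2,4)] by metis+

lemma atlas_fibre_open:
  assumes "atlas U Z h" "i \<in> Idx U 0"
  shows "openin (Top Z) {z \<in> points Z. anchor Z z \<in> ob U i}"
  using atlas_open[OF assms] openin_topspace[of "chart_space U i"] atlas_image[OF assms]
  unfolding open_map_def by fastforce

lemma atlas_homeomorphic:
  assumes "atlas U Z h" "i \<in> Idx U 0"
  shows "homeomorphic_map (chart_space U i) (subtopology (Top Z) {z \<in> points Z. anchor Z z \<in> ob U i}) (h i)"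
  using injective_open_imp_embedding_map[OF atlas_continuous[OF assms] atlas_open[OF assms]]
    atlas_inj_on[OF assms] atlas_image[OF assms]
  by (simp add: embedding_map_def)

lemma coord_continuous:
  assumes "atlas U Z h" "i \<in> Idx U 0"
  shows "continuous_map (subtopology (Top Z) {z \<in> points Z. anchor Z z \<in> ob U i}) (chart_space U i)
    (\<lambda>z. (anchor Z z, coord U h i z))"
proof -
  obtain k where k: "homeomorphic_maps (chart_space U i) (subtopology (Top Z) {z \<in> points Z. anchor Z z \<in> ob U i}) (h i) k"
    using atlas_homeomorphic[OF assms] homeomorphic_map_maps by blast
  then have "continuous_map (subtopology (Top Z) {z \<in> points Z. anchor Z z \<in> ob U i}) (chart_space U i) k"
    by (simp add: homeomorphic_maps_def)
  moreover have "k z = (anchor Z z, coord U h i z)" if z: "z \<in> points Z" "anchor Z z \<in> ob U i" for z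
  proof -
    have "\<forall>p\<in>ob U i \<times> carrier S. k (h i p) = p"
      using k by (simp add: homeomorphic_maps_def)
    then have "k (h i (anchor Z z, coord U h i z)) = (anchor Z z, coord U h i z)"
      using coord_in(1)[OF assms z] z by blast
    then show ?thesis using coord_in[OF assms z] by simp
  qed
  ultimately show ?thesis by (rule continuous_map_eq) auto
qed

lemma transitionD:
  "transition U Z h f \<Longrightarrow> i \<in> Idx U 0 \<Longrightarrow> j \<in> Idx U 0 \<Longrightarrow> g \<in> over U i j \<Longrightarrow> t \<in> carrier S \<Longrightarrow>
    lact Z g (h j (src G g, t)) = h i (rng G g, f i j g \<otimes> t)"
  by (simp add: transition_def)

section \<open>Spaces sharing a cocycle, and all the cocycles of one space\<close>

context
  fixes U :: "('g, 'j) cover_data"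
  assumes U: "real_open_cover G U"
begin

lemma atlas_index:
  assumes "atlas U Z h" "z \<in> points Z"
  obtains i where "i \<in> Idx U 0" "anchor Z z \<in> ob U i"
  using ob_cover[OF U atlas_anchor_in[OF assms]] that by blast

text \<open>A change of charts is the action of a unit. That units act as the identity is not yet
  known of \<open>Z\<close>; it is obtained here inside chart i, where \<open>f i i\<close> is
  trivial on units, after the point has been rewritten in that chart.\<close>

lemma transition_point:
  assumes "atlas U Z h" "transition U Z h f" "cocycle_on U f" "i \<in> Idx U 0" "j \<in> Idx U 0"
    "x \<in> ob U i" "x \<in> ob U j" "t \<in> carrier S"
  shows "h j (x, t) = h i (x, f i j (unt G x) \<otimes> t)"
proof -
  have x: "x \<in> objects G" by (rule obD[OF assms(6)])
  have i: "lact Z (unt G x) (h i (x, s)) = h i (x, s)" if "s \<in> carrier S" for s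
  proof -
    show ?thesis
      using transitionD[OF assms(2,4,4) unt_over[OF assms(6,6)] that] x that
        cocycle_on_unt[OF assms(3,4,6)] by simp
  qed
  have a: "anchor Z (h j (x, t)) = x" "h j (x, t) \<in> points Z"
    using atlas_anchor[OF assms(1,5,7,8)] atlas_in[OF assms(1,5,7,8)] by auto
  obtain s where s: "s \<in> carrier S" "h j (x, t) = h i (x, s)"
    using atlas_cases[OF assms(1,4) a(2)] a(1) assms(6) by metis
  show ?thesis
    using transitionD[OF assms(2,4,5) unt_over[OF assms(6,7)] assms(8)] x i[OF s(1)] s(2) by simp
qed

text \<open>Keeps the coordinates and replaces the charts \<open>h\<close> by the charts
  \<open>k\<close>. The index is picked arbitrarily for each point; \<open>chart_map_chart\<close>
  shows that every other admissible index gives the same value.\<close>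

definition chart_map ::
  "('x, 'g, 's, 'v) gen_hom_data \<Rightarrow> ('j \<Rightarrow> 'x \<times> 's \<Rightarrow> 'v) \<Rightarrow> ('j \<Rightarrow> 'x \<times> 's \<Rightarrow> 'u) \<Rightarrow> 'v \<Rightarrow> 'u" where
  "chart_map Z h k z = (let i = SOME i. i \<in> Idx U 0 \<and> anchor Z z \<in> ob U i in
    k i (anchor Z z, coord U h i z))"

text \<open>Passing from the picked index j to i changes coordinates by
  \<open>f j i (unt G x)\<close> in both atlases, since both have the same transition functions; the
  two corrections compensate.\<close>

lemma chart_map_chart:
  assumes h: "atlas U Z h" "transition U Z h f" and k: "atlas U W k" "transition U W k f"
    and f: "cocycle_on U f" and i: "i \<in> Idx U 0" "x \<in> ob U i" "s \<in> carrier S"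
  shows "chart_map Z h k (h i (x, s)) = k i (x, s)"
proof -
  define j where "j = (SOME j. j \<in> Idx U 0 \<and> x \<in> ob U j)"
  have j: "j \<in> Idx U 0" "x \<in> ob U j"
    unfolding j_def using someI_ex[of "\<lambda>j. j \<in> Idx U 0 \<and> x \<in> ob U j"] i by blast+
  have fin: "f j i (unt G x) \<in> carrier S" using cocycle_on_in[OF f j(1) i(1)] i j by simp
  have "chart_map Z h k (h i (x, s)) = k j (x, coord U h j (h i (x, s)))"
    unfolding chart_map_def Let_def by (simp add: atlas_anchor[OF h(1) i] j_def)
  also have "\<dots> = k j (x, f j i (unt G x) \<otimes> s)"
    using transition_point[OF h f j(1) i(1) j(2) i(2,3)] coord_chart[OF h(1) j] fin i(3) by simp
  also have "\<dots> = k i (x, s)"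
    by (rule transition_point[OF k f j(1) i(1) j(2) i(2,3), symmetric])
  finally show ?thesis .
qed

lemma chart_map_continuous:
  assumes h: "atlas U Z h" "transition U Z h f" and k: "atlas U W k" "transition U W k f"
    and f: "cocycle_on U f"
  shows "continuous_map (Top Z) (Top W) (chart_map Z h k)"
proof (rule continuous_map_locallyI)
  fix z assume z: "z \<in> points Z"
  then obtain i where i: "i \<in> Idx U 0" "anchor Z z \<in> ob U i" by (rule atlas_index[OF h(1)])
  let ?V = "{z \<in> points Z. anchor Z z \<in> ob U i}"
  let ?g = "k i \<circ> (\<lambda>z. (anchor Z z, coord U h i z))"
  have "chart_map Z h k y = ?g y" if y: "y \<in> ?V" for y
  proof -
    have y': "y \<in> points Z" "anchor Z y \<in> ob U i" using y by auto
    have "chart_map Z h k (h i (anchor Z y, coord U h i y)) = k i (anchor Z y, coord U h i y)"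
      by (rule chart_map_chart[OF h k f i(1) y'(2) coord_in(1)[OF h(1) i(1) y']])
    then show ?thesis using coord_in(2)[OF h(1) i(1) y'] by simp
  qed
  moreover have "continuous_map (subtopology (Top Z) ?V) (Top W) ?g"
    by (rule continuous_map_compose[OF coord_continuous[OF h(1) i(1)] atlas_continuous[OF k(1) i(1)]])
  ultimately show "\<exists>V g. openin (Top Z) V \<and> z \<in> V \<and> continuous_map (subtopology (Top Z) V) (Top W) g \<and>
      (\<forall>y\<in>V. chart_map Z h k y = g y)"
    using atlas_fibre_open[OF h(1) i(1)] i(2) z by (intro exI[of _ ?V] exI[of _ ?g]) auto
qed

lemma chart_map_inverse:
  assumes h: "atlas U Z h" "transition U Z h f" and k: "atlas U W k" "transition U W k f"
    and f: "cocycle_on U f" and z: "z \<in> points Z"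
  shows "chart_map W k h (chart_map Z h k z) = z"
proof -
  obtain i where i: "i \<in> Idx U 0" "anchor Z z \<in> ob U i" using z by (rule atlas_index[OF h(1)])
  obtain s where s: "s \<in> carrier S" "z = h i (anchor Z z, s)" using atlas_cases[OF h(1) i(1) z i(2)] .
  show ?thesis
    using chart_map_chart[OF h k f i s(1)] chart_map_chart[OF k h f i s(1)] s(2) by simp
qed

text \<open>In charts the map is the identity on coordinates, and both spaces express anchor, Real
  structure and actions by the same formulas in coordinates.\<close>

lemma atlas_iso:
  assumes h: "atlas U Z h" "transition U Z h f" and k: "atlas U W k" "transition U W k f"
    and f: "cocycle_on U f"
  shows "gen_hom_iso G S Z W"
proof -
  let ?F = "chart_map Z h k"
  note FZ = chart_map_chart[OF h k f]
  have "homeomorphic_maps (Top Z) (Top W) ?F (chart_map W k h)"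
    unfolding homeomorphic_maps_def
    using chart_map_continuous[OF h k f] chart_map_continuous[OF k h f]
      chart_map_inverse[OF h k f] chart_map_inverse[OF k h f] by blast
  then have "homeomorphic_map (Top Z) (Top W) ?F" using homeomorphic_maps_map by blast
  moreover have "anchor W (?F z) = anchor Z z \<and> ?F (tau Z z) = tau W (?F z) \<and>
      (\<forall>g \<in> arrows G. src G g = anchor Z z \<longrightarrow> ?F (lact Z g z) = lact W g (?F z)) \<and>
      (\<forall>t \<in> carrier S. ?F (ract Z z t) = ract W (?F z) t)" if z: "z \<in> points Z" for z
  proof -
    obtain i where i0: "i \<in> Idx U 0" "anchor Z z \<in> ob U i" using z by (rule atlas_index[OF h(1)])
    obtain s where "s \<in> carrier S" "z = h i (anchor Z z, s)" using atlas_cases[OF h(1) i0(1) z i0(2)] .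
    note i = i0 this
    define x where "x = anchor Z z"
    have x: "x \<in> ob U i" "z = h i (x, s)" "x \<in> objects G"
      using i obD[OF i(2)] by (auto simp: x_def)
    note i' = i(1) x(1) i(3)
    have 1: "anchor W (?F z) = anchor Z z"
      using atlas_anchor[OF h(1) i'] atlas_anchor[OF k(1) i'] FZ[OF i'] x(2) by simp
    have ib: "ibar U 0 i \<in> Idx U 0" "\<rho> x \<in> ob U (ibar U 0 i)" "bar S s \<in> carrier S"
      using i' x(3) U by (simp_all add: ibar_in[OF U] ob_ibar[OF U])
    have 2: "?F (tau Z z) = tau W (?F z)"
      using atlas_tau[OF h(1) i'] atlas_tau[OF k(1) i'] FZ[OF i'] FZ[OF ib] x(2) by simp
    have 3: "?F (lact Z g z) = lact W g (?F z)" if g: "g \<in> arrows G" "src G g = x" for g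
    proof -
      obtain j where j: "j \<in> Idx U 0" "rng G g \<in> ob U j" using ob_cover[OF U rng_in[OF g(1)]] by blast
      then have o: "g \<in> over U j i" using g x by auto
      have "lact Z g z = h j (rng G g, f j i g \<otimes> s)" "lact W g (k i (x, s)) = k j (rng G g, f j i g \<otimes> s)"
        using transitionD[OF h(2) j(1) i(1) o i(3)] transitionD[OF k(2) j(1) i(1) o i(3)] g x by simp_all
      then show ?thesis
        using FZ[OF i'] FZ[OF j] x(2) cocycle_on_in[OF f j(1) i(1) o] i(3) by simp
    qed
    have 4: "?F (ract Z z t) = ract W (?F z) t" if "t \<in> carrier S" for t
      using atlas_ract[OF h(1) i' that] atlas_ract[OF k(1) i' that] FZ[OF i'] FZ[OF i'(1,2)] x(2) that i(3) by simp
    show ?thesis using 1 2 3 4 x_def by simp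
  qed
  ultimately show ?thesis unfolding gen_hom_iso_def by blast
qed

text \<open>Composing the charts with the isomorphism leaves all coordinates unchanged, and with
  them the cocycle.\<close>

lemma represents_iso:
  assumes "represents Z U c" "gen_hom_iso G S Z W"
  shows "represents W U c"
proof -
  obtain h where c: "c \<in> cocycles 1 G S U" and h: "atlas U Z h" "transition U Z h (val U c)"
    using assms(1) by (auto simp: represents_def)
  obtain F where F: "homeomorphic_map (Top Z) (Top W) F"
    and Fz: "\<And>z. z \<in> points Z \<Longrightarrow> anchor W (F z) = anchor Z z \<and> F (tau Z z) = tau W (F z) \<and>
           (\<forall>g \<in> arrows G. src G g = anchor Z z \<longrightarrow> F (lact Z g z) = lact W g (F z)) \<and>
           (\<forall>t \<in> carrier S. F (ract Z z t) = ract W (F z) t)"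
    using assms(2) unfolding gen_hom_iso_def by blast
  let ?k = "\<lambda>i p. F (h i p)"
  have surj: "F ` points Z = points W" using F homeomorphic_imp_surjective_map by blast
  have inj: "inj_on F (points Z)" using F homeomorphic_imp_injective_map by blast
  have "atlas U W ?k"
    unfolding atlas_def
  proof (intro conjI ballI impI)
    show "anchor W \<in> points W \<rightarrow> objects G"
      using Fz atlas_anchor_in[OF h(1)] surj by (metis (no_types, lifting) Pi_I imageE)
    fix i assume i: "i \<in> Idx U 0"
    show "continuous_map (chart_space U i) (Top W) (?k i)"
      using continuous_map_compose[OF atlas_continuous[OF h(1) i] homeomorphic_imp_continuous_map[OF F]]
      by (simp add: comp_def)
    show "open_map (chart_space U i) (Top W) (?k i)"
      using open_map_compose[OF atlas_open[OF h(1) i] homeomorphic_imp_open_map[OF F]] by (simp add: comp_def)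
    have "?k i ` (ob U i \<times> carrier S) = F ` {z \<in> points Z. anchor Z z \<in> ob U i}"
      unfolding atlas_image[OF h(1) i, symmetric] by (simp add: image_image)
    also have "\<dots> = {w \<in> points W. anchor W w \<in> ob U i}"
    proof (intro subset_antisym subsetI)
      fix w assume "w \<in> F ` {z \<in> points Z. anchor Z z \<in> ob U i}"
      then obtain z where "z \<in> points Z" "anchor Z z \<in> ob U i" "w = F z" by blast
      moreover have "F z \<in> points W" using surj \<open>z \<in> points Z\<close> by blast
      ultimately show "w \<in> {w \<in> points W. anchor W w \<in> ob U i}" using Fz[of z] by simp
    next
      fix w assume w: "w \<in> {w \<in> points W. anchor W w \<in> ob U i}"
      then obtain z where z: "z \<in> points Z" "w = F z" using surj by blast
      then show "w \<in> F ` {z \<in> points Z. anchor Z z \<in> ob U i}" using Fz[OF z(1)] w by auto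
    qed
    finally show "?k i ` (ob U i \<times> carrier S) = {w \<in> points W. anchor W w \<in> ob U i}" .
    fix x s assume x: "x \<in> ob U i" and s: "s \<in> carrier S"
    note z = Fz[OF atlas_in[OF h(1) i x s]]
    show "anchor W (?k i (x, s)) = x" using z atlas_anchor[OF h(1) i x s] by simp
    show "tau W (?k i (x, s)) = ?k (ibar U 0 i) (\<rho> x, bar S s)" using z atlas_tau[OF h(1) i x s] by simp
    fix t assume t: "t \<in> carrier S"
    show "ract W (?k i (x, s)) t = ?k i (x, s \<otimes> t)" using z t atlas_ract[OF h(1) i x s t] by metis
    assume "?k i (x, s) = ?k i (x, t)"
    then have "h i (x, s) = h i (x, t)" using inj atlas_in[OF h(1) i x] s t by (meson inj_onD)
    then show "s = t" by (rule atlas_inj[OF h(1) i x s t])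
  qed
  moreover have "transition U W ?k (val U c)"
    unfolding transition_def
  proof (intro ballI)
    fix i j g t assume *: "i \<in> Idx U 0" "j \<in> Idx U 0" "g \<in> over U i j" "t \<in> carrier S"
    note o = overD[OF *(3)]
    have "lact W g (?k j (src G g, t)) = F (lact Z g (h j (src G g, t)))"
      using Fz[OF atlas_in[OF h(1) *(2) o(3) *(4)]] o(1) atlas_anchor[OF h(1) *(2) o(3) *(4)] by simp
    then show "lact W g (?k j (src G g, t)) = ?k i (rng G g, val U c i j g \<otimes> t)"
      using transitionD[OF h(2) *] by simp
  qed
  ultimately show ?thesis using c unfolding represents_def by blast
qed

lemma represents_same_iso:
  assumes "represents Z U c" "represents W U c" shows "gen_hom_iso G S Z W"
  using assms atlas_iso val_cocycle_on[OF U] unfolding represents_def by metis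

lemma represents_cohomologous:
  assumes Z: "represents Z U c"
  shows "{c'. represents Z U c'} = coboundaries 1 G S U #>\<^bsub>Z1 U\<^esub> c"
proof (intro subset_antisym subsetI)
  obtain h where c: "c \<in> cocycles 1 G S U" and h: "atlas U Z h" "transition U Z h (val U c)"
    using assms(1) by (auto simp: represents_def)
  note f = val_cocycle_on[OF U c]
  { fix c' assume "c' \<in> {c'. represents Z U c'}"
    then obtain h' where c': "c' \<in> cocycles 1 G S U" and h': "atlas U Z h'" "transition U Z h' (val U c')"
      by (auto simp: represents_def)
    note f' = val_cocycle_on[OF U c']
    \<comment> \<open>The coordinate, in the atlas \<open>h\<close>, of the section
      \<open>h' i (x, \<one>)\<close>; equivariance under \<open>S\<close> then determines all of
      \<open>h' i\<close>.\<close>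
    let ?b = "\<lambda>i x. coord U h i (h' i (x, \<one>))"
    have b: "?b i x \<in> carrier S" "h' i (x, \<one>) = h i (x, ?b i x)" if "i \<in> Idx U 0" "x \<in> ob U i" for i x
      using coord_in[OF h(1) that(1) atlas_in[OF h'(1) that one_closed]] atlas_anchor[OF h'(1) that one_closed] that
      by simp_all
    have b': "h' i (x, t) = h i (x, ?b i x \<otimes> t)" if "i \<in> Idx U 0" "x \<in> ob U i" "t \<in> carrier S" for i x t
      using atlas_ract[OF h'(1) that(1,2) one_closed that(3)] atlas_ract[OF h(1) that(1,2) b(1)[OF that(1,2)] that(3)]
        b(2)[OF that(1,2)] l_one[OF that(3)] by metis
    have "cochain0_on U ?b"
      unfolding cochain0_on_def
    proof (intro ballI conjI)
      fix i assume i: "i \<in> Idx U 0"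
      have "continuous_map (subtopology (Obj G) (ob U i)) (chart_space U i) (\<lambda>x. (x, \<one>))"
        by (rule continuous_map_into_chart_space) (auto simp: topspace_top_of continuous_map_from_subtopology)
      from continuous_map_compose[OF this atlas_continuous[OF h'(1) i]]
      have "continuous_map (subtopology (Obj G) (ob U i)) (subtopology (Top Z) {z \<in> points Z. anchor Z z \<in> ob U i})
          (\<lambda>x. h' i (x, \<one>))"
        unfolding continuous_map_in_subtopology
        using atlas_in[OF h'(1) i] atlas_anchor[OF h'(1) i] by (auto simp: comp_def)
      from continuous_map_compose[OF this continuous_map_compose[OF coord_continuous[OF h(1) i] continuous_map_chart_snd]]
      show "continuous_map (subtopology (Obj G) (ob U i)) (top_of S) (?b i)" by (simp add: comp_def)
      fix x assume x: "x \<in> ob U i"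
      have ib: "ibar U 0 i \<in> Idx U 0" "\<rho> x \<in> ob U (ibar U 0 i)"
        using i x obD[OF x] by (simp_all add: ibar_in[OF U] ob_ibar[OF U])
      \<comment> \<open>Both atlases express \<open>tau\<close> by \<rho> and \<open>bar\<close>,
        and \<open>bar\<close> fixes the unit; Reality of \<open>?b\<close> follows by comparing
        coordinates in the conjugate chart.\<close>
      have "h (ibar U 0 i) (\<rho> x, ?b (ibar U 0 i) (\<rho> x)) = h' (ibar U 0 i) (\<rho> x, \<one>)"
        by (rule b(2)[OF ib, symmetric])
      also have "\<dots> = tau Z (h' i (x, \<one>))" using atlas_tau[OF h'(1) i x one_closed] by simp
      also have "\<dots> = h (ibar U 0 i) (\<rho> x, bar S (?b i x))"
        using atlas_tau[OF h(1) i x b(1)[OF i x]] b(2)[OF i x, symmetric] by simp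
      finally show "?b (ibar U 0 i) (\<rho> x) = bar S (?b i x)"
        by (rule atlas_inj[OF h(1) ib b(1)[OF ib] bar_in[OF b(1)[OF i x]]])
    qed
    moreover have "val U c' i j g = coboundary ?b i j g \<otimes> val U c i j g"
      if i: "i \<in> Idx U 0" and j: "j \<in> Idx U 0" and g: "g \<in> over U i j" for i j g
    proof -
      note o = overD[OF g] and fi = cocycle_on_in[OF f i j g] and fi' = cocycle_on_in[OF f' i j g]
      note bi = b(1)[OF i o(2)] and bj = b(1)[OF j o(3)]
      have "h i (rng G g, ?b i (rng G g) \<otimes> val U c' i j g) = h' i (rng G g, val U c' i j g \<otimes> \<one>)"
        using b'[OF i o(2) fi'] fi' by simp
      also have "\<dots> = lact Z g (h' j (src G g, \<one>))"
        by (rule transitionD[OF h'(2) i j g one_closed, symmetric])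
      also have "\<dots> = h i (rng G g, val U c i j g \<otimes> ?b j (src G g))"
        using transitionD[OF h(2) i j g bj] b(2)[OF j o(3), symmetric] by simp
      finally have "?b i (rng G g) \<otimes> val U c' i j g = val U c i j g \<otimes> ?b j (src G g)"
        by (rule atlas_inj[OF h(1) i o(2) m_closed[OF bi fi'] m_closed[OF fi bj]])
      then have "inv ?b i (rng G g) \<otimes> (?b i (rng G g) \<otimes> val U c' i j g) = inv ?b i (rng G g) \<otimes> (val U c i j g \<otimes> ?b j (src G g))"
        by simp
      then have "val U c' i j g = inv ?b i (rng G g) \<otimes> (val U c i j g \<otimes> ?b j (src G g))"
        using bi fi' by simp
      also have "\<dots> = coboundary ?b i j g \<otimes> val U c i j g"
        by (simp only: m_ac m_closed inv_closed bi bj fi)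
      finally show ?thesis .
    qed
    ultimately show "c' \<in> coboundaries 1 G S U #>\<^bsub>Z1 U\<^esub> c"
      unfolding coset_eq[OF U c] using c' by (intro CollectI conjI exI[of _ ?b]) auto
  next
    fix c' assume "c' \<in> coboundaries 1 G S U #>\<^bsub>Z1 U\<^esub> c"
    then obtain b where c': "c' \<in> cocycles 1 G S U" and b: "cochain0_on U b"
      and e: "\<And>i j g. i\<in>Idx U 0 \<Longrightarrow> j\<in>Idx U 0 \<Longrightarrow> g\<in>over U i j \<Longrightarrow> val U c' i j g = coboundary b i j g \<otimes> val U c i j g"
      unfolding coset_eq[OF U c] by blast
    note bin = cochain0_on_in[OF U b]
    \<comment> \<open>Multiplication of the fibre coordinate by b and its inverse, homeomorphisms of
      the chart domain onto itself.\<close>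
    let ?\<phi> = "\<lambda>i p. (fst p, b i (fst p) \<otimes> snd p)" and ?\<psi> = "\<lambda>i p. (fst p, inv (b i (fst p)) \<otimes> snd p)"
    let ?h = "\<lambda>i p. h i (?\<phi> i p)"
    have hom: "homeomorphic_maps (chart_space U i) (chart_space U i) (?\<phi> i) (?\<psi> i)" if i: "i \<in> Idx U 0" for i
    proof -
      have bc: "continuous_map (chart_space U i) (top_of S) (\<lambda>p. b i (fst p))"
        using b i by (intro continuous_map_chart_base) (simp add: cochain0_on_def)
      show ?thesis
        unfolding homeomorphic_maps_def
        using bin[OF i] bc
        by (auto intro!: continuous_map_into_chart_space continuous_map_mult continuous_map_inv
            continuous_map_chart_fst' continuous_map_chart_snd)
    qed
    have "atlas U Z ?h"
      unfolding atlas_def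
    proof (intro conjI ballI impI)
      show "anchor Z \<in> points Z \<rightarrow> objects G" using atlas_anchor_in[OF h(1)] by blast
      fix i assume i: "i \<in> Idx U 0"
      have hm: "homeomorphic_map (chart_space U i) (chart_space U i) (?\<phi> i)"
        using hom[OF i] homeomorphic_maps_map by blast
      show "continuous_map (chart_space U i) (Top Z) (?h i)"
        using continuous_map_compose[OF homeomorphic_imp_continuous_map[OF hm] atlas_continuous[OF h(1) i]]
        by (simp add: comp_def)
      show "open_map (chart_space U i) (Top Z) (?h i)"
        using open_map_compose[OF homeomorphic_imp_open_map[OF hm] atlas_open[OF h(1) i]] by (simp add: comp_def)
      have "?\<phi> i ` (ob U i \<times> carrier S) = ob U i \<times> carrier S"
        using homeomorphic_imp_surjective_map[OF hm] by simp
      then have "?h i ` (ob U i \<times> carrier S) = h i ` (ob U i \<times> carrier S)" by (metis image_image)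
      then show "?h i ` (ob U i \<times> carrier S) = {z \<in> points Z. anchor Z z \<in> ob U i}"
        using atlas_image[OF h(1) i] by simp
      fix x s assume x: "x \<in> ob U i" and s: "s \<in> carrier S"
      note bx = bin[OF i x]
      show "anchor Z (?h i (x, s)) = x" using atlas_anchor[OF h(1) i x] bx s by simp
      show "tau Z (?h i (x, s)) = ?h (ibar U 0 i) (\<rho> x, bar S s)"
        using atlas_tau[OF h(1) i x] bx s b i x by (simp add: cochain0_on_def)
      fix t assume t: "t \<in> carrier S"
      show "ract Z (?h i (x, s)) t = ?h i (x, s \<otimes> t)"
        using atlas_ract[OF h(1) i x _ t] bx s t by (simp add: m_assoc)
      assume "?h i (x, s) = ?h i (x, t)"
      then have "b i x \<otimes> s = b i x \<otimes> t" using atlas_inj[OF h(1) i x] bx s t by simp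
      then show "s = t" using bx s t by simp
    qed
    moreover have "transition U Z ?h (val U c')"
      unfolding transition_def
    proof (intro ballI)
      fix i j g t assume *: "i \<in> Idx U 0" "j \<in> Idx U 0" "g \<in> over U i j" "t \<in> carrier S"
      note o = overD[OF *(3)] and fi = cocycle_on_in[OF f *(1-3)]
      note bi = bin[OF *(1) o(2)] and bj = bin[OF *(2) o(3)]
      have "lact Z g (?h j (src G g, t)) = h i (rng G g, val U c i j g \<otimes> (b j (src G g) \<otimes> t))"
        using transitionD[OF h(2) *(1-3) m_closed[OF bj *(4)]] by simp
      also have "val U c i j g \<otimes> (b j (src G g) \<otimes> t) = b i (rng G g) \<otimes> (inv (b i (rng G g)) \<otimes> (val U c i j g \<otimes> (b j (src G g) \<otimes> t)))"
        using bi bj fi *(4) by simp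
      also have "\<dots> = b i (rng G g) \<otimes> (val U c' i j g \<otimes> t)"
        unfolding e[OF *(1-3)] by (simp only: m_ac m_closed inv_closed bi bj fi *(4))
      finally show "lact Z g (?h j (src G g, t)) = ?h i (rng G g, val U c' i j g \<otimes> t)" by simp
    qed
    ultimately show "c' \<in> {c'. represents Z U c'}" using c' unfolding represents_def by blast
  }
qed

end

text \<open>The charts are those with index \<open>\<theta> 0 i\<close>, restricted to
  \<open>ob V i\<close>. They stay open maps because \<open>ob V i\<close> is itself open.\<close>

lemma represents_refine:
  assumes U: "real_open_cover G U" and V: "real_open_cover G V" and \<theta>: "refinement U V \<theta>"
    and Z: "represents Z U c"
  shows "represents Z V (refine_cochain 1 G V \<theta> c)"
proof -
  obtain h where c: "c \<in> cocycles 1 G S U" and h: "atlas U Z h" "transition U Z h (val U c)"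
    using Z by (auto simp: represents_def)
  note r = refinementD[OF \<theta>] and o = ob_refinement[OF \<theta>]
  let ?f = "\<lambda>i j. val U c (\<theta> 0 i) (\<theta> 0 j)"
  have f: "cocycle_on V ?f" by (rule cocycle_on_refine[OF V \<theta> val_cocycle_on[OF U c]])
  let ?h = "\<lambda>i. h (\<theta> 0 i)"
  have "atlas V Z ?h"
    unfolding atlas_def
  proof (intro conjI ballI impI)
    show "anchor Z \<in> points Z \<rightarrow> objects G" using atlas_anchor_in[OF h(1)] by blast
    fix i assume i: "i \<in> Idx V 0"
    note ri = r(1)[OF i] and oi = o[OF i]
    show "continuous_map (chart_space V i) (Top Z) (?h i)"
      using continuous_map_from_subtopology_mono[of "prod_topology (Obj G) (top_of S)" "ob U (\<theta> 0 i) \<times> carrier S"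
          "Top Z" "?h i" "ob V i \<times> carrier S"] atlas_continuous[OF h(1) ri] oi
      unfolding chart_space_def by blast
    show "open_map (chart_space V i) (Top Z) (?h i)"
      unfolding open_map_def
    proof (intro allI impI)
      fix A assume "openin (chart_space V i) A"
      then have "openin (chart_space U (\<theta> 0 i)) A"
        using oi by (auto simp: openin_chart_space[OF V i] openin_chart_space[OF U ri])
      then show "openin (Top Z) (?h i ` A)" using atlas_open[OF h(1) ri] by (simp add: open_map_def)
    qed
    show "?h i ` (ob V i \<times> carrier S) = {z \<in> points Z. anchor Z z \<in> ob V i}"
    proof (intro subset_antisym subsetI)
      fix z assume "z \<in> ?h i ` (ob V i \<times> carrier S)"
      then obtain x s where "x \<in> ob V i" "s \<in> carrier S" "z = ?h i (x, s)" by auto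
      then show "z \<in> {z \<in> points Z. anchor Z z \<in> ob V i}"
        using atlas_anchor[OF h(1) ri] atlas_in[OF h(1) ri] oi by auto
    next
      fix z assume "z \<in> {z \<in> points Z. anchor Z z \<in> ob V i}"
      then have z: "z \<in> points Z" "anchor Z z \<in> ob V i" "anchor Z z \<in> ob U (\<theta> 0 i)" using oi by auto
      obtain s where "s \<in> carrier S" "z = ?h i (anchor Z z, s)" using atlas_cases[OF h(1) ri z(1,3)] .
      then show "z \<in> ?h i ` (ob V i \<times> carrier S)" using z(2) by blast
    qed
    fix x s assume x: "x \<in> ob V i" and s: "s \<in> carrier S"
    then have x': "x \<in> ob U (\<theta> 0 i)" using oi by blast
    show "anchor Z (?h i (x, s)) = x" by (rule atlas_anchor[OF h(1) ri x' s])
    show "tau Z (?h i (x, s)) = ?h (ibar V 0 i) (\<rho> x, bar S s)"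
      using atlas_tau[OF h(1) ri x' s] r(2)[OF i] by simp
    fix t assume t: "t \<in> carrier S"
    show "ract Z (?h i (x, s)) t = ?h i (x, s \<otimes> t)" by (rule atlas_ract[OF h(1) ri x' s t])
    show "?h i (x, s) = ?h i (x, t) \<Longrightarrow> s = t" by (rule atlas_inj[OF h(1) ri x' s t])
  qed
  moreover have "transition V Z ?h (val V (mk V ?f))"
    unfolding transition_def
  proof (intro ballI)
    fix i j g t assume *: "i \<in> Idx V 0" "j \<in> Idx V 0" "g \<in> over V i j" "t \<in> carrier S"
    then have "g \<in> over U (\<theta> 0 i) (\<theta> 0 j)" using over_refinement[OF \<theta>] by blast
    then show "lact Z g (?h j (src G g, t)) = ?h i (rng G g, val V (mk V ?f) i j g \<otimes> t)"
      using transitionD[OF h(2) r(1)[OF *(1)] r(1)[OF *(2)] _ *(4)] val_mk[OF V f *(1-3)] by simp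
  qed
  ultimately show ?thesis
    unfolding represents_def refine_cochain_1[OF U V \<theta> c] using mk_cocycle[OF V f] by blast
qed


section \<open>Trivial, opposite and summed spaces\<close>

lemma image_mult_carrier: "a \<in> carrier S \<Longrightarrow> (\<lambda>t. a \<otimes> t) ` carrier S = carrier S"
  by (metis (no_types, lifting) bij_betw_def image_cong inj_on_cmult surj_const_mult)

lemma mult_inv_mult:
  assumes "a \<in> carrier S" "t \<in> carrier S"
  shows "a \<otimes> inv (a \<otimes> t) = inv t" "a \<otimes> inv (t \<otimes> a) = inv t"
proof -
  show "a \<otimes> inv (a \<otimes> t) = inv t" using assms by (simp only: inv_mult mult_inv_cancel inv_closed)
  then show "a \<otimes> inv (t \<otimes> a) = inv t" using assms by (simp only: m_comm)
qed

lemma bar_image_carrier: "bar S ` carrier S = carrier S"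
proof
  show "carrier S \<subseteq> bar S ` carrier S"
  proof
    fix t assume "t \<in> carrier S"
    then have "t = bar S (bar S t)" "bar S t \<in> carrier S" by auto
    then show "t \<in> bar S ` carrier S" by (rule image_eqI)
  qed
qed auto

lemma chart_space_eq: "prod_topology (subtopology (Obj G) (ob U i)) (top_of S) = chart_space U i"
  unfolding chart_space_def topspace_top_of[symmetric] by (simp add: prod_topology_subtopology)

context
  fixes U :: "('g, 'j) cover_data"
  assumes U: "real_open_cover G U"
begin

lemma represents_trivial: "represents (gen_hom_trivial G S) U (mk U (\<lambda>i j g. \<one>))"
proof -
  let ?Z = "gen_hom_trivial G S" and ?h = "\<lambda>i::'j. \<lambda>p::'x \<times> 's. p"
  have "atlas U ?Z ?h"
    unfolding atlas_def
  proof (intro conjI ballI impI)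
    show "anchor ?Z \<in> points ?Z \<rightarrow> objects G" by (auto simp: gen_hom_trivial_def)
    fix i assume i: "i \<in> Idx U 0"
    show "continuous_map (chart_space U i) (Top ?Z) (\<lambda>p. p)"
      by (simp add: chart_space_def gen_hom_trivial_def continuous_map_from_subtopology)
    show "open_map (chart_space U i) (Top ?Z) (\<lambda>p. p)"
      by (simp add: open_map_def openin_chart_space[OF U i] gen_hom_trivial_def)
    show "(\<lambda>p. p) ` (ob U i \<times> carrier S) = {z \<in> points ?Z. anchor ?Z z \<in> ob U i}"
      by (auto simp: gen_hom_trivial_def topspace_top_of obD)
  qed (simp_all add: gen_hom_trivial_def)
  moreover have "transition U ?Z ?h (val U (mk U (\<lambda>i j g. \<one>)))"
    unfolding transition_def
    by (intro ballI) (simp add: val_mk[OF U cocycle_on_one[OF U]] gen_hom_trivial_def)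
  ultimately show ?thesis
    unfolding represents_def using mk_cocycle[OF U cocycle_on_one[OF U]] by blast
qed

text \<open>The charts are precomposed with inversion in the fibre, which is a homomorphism because
  \<open>S\<close> is abelian. It turns right multiplication by \<open>inv t\<close> into
  multiplication by \<open>t\<close>, and left multiplication by a cocycle value into that by its
  inverse.\<close>

lemma represents_opposite:
  assumes Z: "represents Z U c"
  shows "represents (gen_hom_opposite S Z) U (mk U (\<lambda>i j g. inv (val U c i j g)))"
proof -
  obtain h where c: "c \<in> cocycles 1 G S U" and h: "atlas U Z h" "transition U Z h (val U c)"
    using Z by (auto simp: represents_def)
  note f = val_cocycle_on[OF U c]
  let ?f = "\<lambda>i j g. inv (val U c i j g)" and ?Y = "gen_hom_opposite S Z"
  let ?\<phi> = "\<lambda>p. (fst p, inv (snd p))"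
  let ?h = "\<lambda>i p. h i (?\<phi> p)"
  have f': "cocycle_on U ?f" by (rule cocycle_on_inv[OF U f])
  have hm: "homeomorphic_map (chart_space U i) (chart_space U i) ?\<phi>" for i :: 'j
  proof -
    have "homeomorphic_maps (chart_space U i) (chart_space U i) ?\<phi> ?\<phi>"
      unfolding homeomorphic_maps_def
      by (auto intro!: continuous_map_into_chart_space continuous_map_inv
          continuous_map_chart_fst' continuous_map_chart_snd)
    then show ?thesis using homeomorphic_maps_map by blast
  qed
  have sel [simp]: "Top ?Y = Top Z" "anchor ?Y = anchor Z" "tau ?Y = tau Z" "lact ?Y = lact Z"
    "ract ?Y z t = ract Z z (inv t)" for z t
    by (simp_all add: gen_hom_opposite_def)
  have "atlas U ?Y ?h"
    unfolding atlas_def sel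
  proof (intro conjI ballI impI)
    show "anchor Z \<in> points Z \<rightarrow> objects G" using atlas_anchor_in[OF h(1)] by blast
    fix i assume i: "i \<in> Idx U 0"
    show "continuous_map (chart_space U i) (Top Z) (?h i)"
      using continuous_map_compose[OF homeomorphic_imp_continuous_map[OF hm] atlas_continuous[OF h(1) i]]
      by (simp add: comp_def)
    show "open_map (chart_space U i) (Top Z) (?h i)"
      using open_map_compose[OF homeomorphic_imp_open_map[OF hm] atlas_open[OF h(1) i]] by (simp add: comp_def)
    have "?\<phi> ` (ob U i \<times> carrier S) = ob U i \<times> carrier S"
      using homeomorphic_imp_surjective_map[OF hm] by simp
    then have "?h i ` (ob U i \<times> carrier S) = h i ` (ob U i \<times> carrier S)" by (metis image_image)
    then show "?h i ` (ob U i \<times> carrier S) = {z \<in> points Z. anchor Z z \<in> ob U i}"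
      using atlas_image[OF h(1) i] by simp
    fix x s assume x: "x \<in> ob U i" and s: "s \<in> carrier S"
    show "anchor Z (?h i (x, s)) = x" using atlas_anchor[OF h(1) i x] s by simp
    show "tau Z (?h i (x, s)) = ?h (ibar U 0 i) (\<rho> x, bar S s)"
      using atlas_tau[OF h(1) i x] s by simp
    fix t assume t: "t \<in> carrier S"
    show "ract Z (?h i (x, s)) (inv t) = ?h i (x, s \<otimes> t)"
      using atlas_ract[OF h(1) i x, of "inv s" "inv t"] s t by (simp add: inv_mult)
    assume "?h i (x, s) = ?h i (x, t)"
    then have "inv s = inv t" using atlas_inj[OF h(1) i x] s t by simp
    then show "s = t" using s t by (metis inv_inv)
  qed
  moreover have "transition U ?Y ?h (val U (mk U ?f))"
    unfolding transition_def
  proof (intro ballI)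
    fix i j g t assume *: "i \<in> Idx U 0" "j \<in> Idx U 0" "g \<in> over U i j" "t \<in> carrier S"
    then show "lact ?Y g (?h j (src G g, t)) = ?h i (rng G g, val U (mk U ?f) i j g \<otimes> t)"
      using transitionD[OF h(2) *(1-3), of "inv t"] val_mk[OF U f' *(1-3)] cocycle_on_in[OF f *(1-3)]
      by (simp add: inv_mult)
  qed
  ultimately show ?thesis unfolding represents_def using mk_cocycle[OF U f'] by blast
qed

text \<open>In a fibre the class of a pair with coordinates a and b is determined by the product ab.
  Taking this product as the coordinate on the sum yields charts, and an arrow that multiplies the
  two coordinates by c and d multiplies their product by cd.\<close>

lemma represents_sum:
  assumes Z: "represents Z U c" and W: "represents W U d"
  shows "represents (gen_hom_sum S Z W) U (mk U (\<lambda>i j g. val U c i j g \<otimes> val U d i j g))"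
proof -
  obtain h where c: "c \<in> cocycles 1 G S U" and h: "atlas U Z h" "transition U Z h (val U c)"
    using Z by (auto simp: represents_def)
  obtain k where d: "d \<in> cocycles 1 G S U" and k: "atlas U W k" "transition U W k (val U d)"
    using W by (auto simp: represents_def)
  note fc = val_cocycle_on[OF U c] and fd = val_cocycle_on[OF U d]
  let ?f = "\<lambda>i j g. val U c i j g \<otimes> val U d i j g" and ?Y = "gen_hom_sum S Z W"
  have f: "cocycle_on U ?f" by (rule cocycle_on_mult[OF U fc fd])
  define FP where "FP = subtopology (prod_topology (Top Z) (Top W)) {(z, w). anchor Z z = anchor W w}"
  let ?q = "sum_class S Z W"
  \<comment> \<open>\<open>H i (x, s)\<close> is the class of the pair \<open>(h i (x, \<one>), k i (x, s))\<close>.\<close>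
  define H where "H i p = (\<lambda>t. (h i (fst p, inv t), k i (fst p, snd p \<otimes> t))) ` carrier S" for i p
  have Top: "Top ?Y = quotient_topology FP ?q" by (simp add: gen_hom_sum_def FP_def)
  have pts: "points ?Y = ?q ` topspace FP" by (simp add: Top topspace_quotient_topology)
  have FP: "topspace FP = {(z, w). z \<in> points Z \<and> w \<in> points W \<and> anchor Z z = anchor W w}"
    by (auto simp: FP_def)
  have q: "?q (h i (x, a), k i (x, b)) = H i (x, a \<otimes> b)"
    if "i \<in> Idx U 0" "x \<in> ob U i" "a \<in> carrier S" "b \<in> carrier S" for i x a b
  proof -
    have "?q (h i (x, a), k i (x, b)) = (\<lambda>t. (ract Z (h i (x, a)) (inv t), ract W (k i (x, b)) t)) ` carrier S"
      by (auto simp: sum_class_def)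
    also have "\<dots> = (\<lambda>t. (h i (x, a \<otimes> inv t), k i (x, b \<otimes> t))) ` carrier S"
      using atlas_ract[OF h(1) that(1,2,3)] atlas_ract[OF k(1) that(1,2,4)] by (intro image_cong) simp_all
    \<comment> \<open>Reindexing the class by t \<mapsto> at moves the factor a from the first
      coordinate to the second.\<close>
    also have "\<dots> = (\<lambda>t. (h i (x, a \<otimes> inv t), k i (x, b \<otimes> t))) ` (\<lambda>t. a \<otimes> t) ` carrier S"
      by (simp only: image_mult_carrier[OF that(3)])
    also have "\<dots> = H i (x, a \<otimes> b)"
      unfolding image_image H_def using that(3,4) by (intro image_cong) (simp_all add: mult_inv_mult m_ac)
    finally show ?thesis .
  qed
  have FPc: "\<exists>s t. s \<in> carrier S \<and> t \<in> carrier S \<and> p = (h i (anchor Z (fst p), s), k i (anchor Z (fst p), t))"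
    if pi: "p \<in> topspace FP" "i \<in> Idx U 0" "anchor Z (fst p) \<in> ob U i" for p i
  proof -
    obtain z w where p: "p = (z, w)" "z \<in> points Z" "w \<in> points W" "anchor Z z = anchor W w"
      using pi(1)[unfolded FP] by auto
    have zi: "anchor Z z \<in> ob U i" "anchor W w \<in> ob U i" using pi(3) p by auto
    obtain s where "s \<in> carrier S" "z = h i (anchor Z z, s)" by (rule atlas_cases[OF h(1) pi(2) p(2) zi(1)])
    moreover obtain t where "t \<in> carrier S" "w = k i (anchor W w, t)"
      by (rule atlas_cases[OF k(1) pi(2) p(3) zi(2)])
    ultimately show ?thesis using p by auto
  qed
  have hkFP: "(h i (x, s), k i (x, t)) \<in> topspace FP"
    if "i \<in> Idx U 0" "x \<in> ob U i" "s \<in> carrier S" "t \<in> carrier S" for i x s t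
    using atlas_in[OF h(1) that(1-3)] atlas_in[OF k(1) that(1,2,4)]
      atlas_anchor[OF h(1) that(1-3)] atlas_anchor[OF k(1) that(1,2,4)] by (simp add: FP)
  have Hin: "H i (x, s) \<in> points ?Y" if "i \<in> Idx U 0" "x \<in> ob U i" "s \<in> carrier S" for i x s
    using q[OF that(1,2) one_closed that(3)] hkFP[OF that(1,2) one_closed that(3)] that(3)
    unfolding pts by (metis image_eqI l_one)
  have anc: "anchor ?Y (H i (x, s)) = x" if "i \<in> Idx U 0" "x \<in> ob U i" "s \<in> carrier S" for i x s
  proof -
    have "(\<lambda>(z, w). anchor Z z) ` H i (x, s) = {x}"
      unfolding H_def image_image
      using atlas_anchor[OF h(1) that(1,2)] one_closed by (auto simp: image_def)
    then show ?thesis by (simp add: gen_hom_sum_def)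
  qed
  have ptsE: "\<exists>i x s. i \<in> Idx U 0 \<and> x \<in> ob U i \<and> s \<in> carrier S \<and> A = H i (x, s)" if A: "A \<in> points ?Y" for A
  proof -
    obtain p where p: "p \<in> topspace FP" "A = ?q p" using A pts by auto
    then have "fst p \<in> points Z" unfolding FP by auto
    then obtain i where i: "i \<in> Idx U 0" "anchor Z (fst p) \<in> ob U i" using atlas_index[OF U h(1)] by metis
    obtain s t where st: "s \<in> carrier S" "t \<in> carrier S" "p = (h i (anchor Z (fst p), s), k i (anchor Z (fst p), t))"
      using FPc[OF p(1) i] by blast
    then have "A = H i (anchor Z (fst p), s \<otimes> t)" using q[OF i st(1,2)] p(2) by metis
    then show ?thesis using i st by blast
  qed
  have "atlas U ?Y H"
    unfolding atlas_def
  proof (intro conjI ballI impI)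
    show "anchor ?Y \<in> points ?Y \<rightarrow> objects G"
    proof
      fix A assume "A \<in> points ?Y"
      then obtain i x s where "i \<in> Idx U 0" "x \<in> ob U i" "s \<in> carrier S" "A = H i (x, s)" using ptsE by blast
      then show "anchor ?Y A \<in> objects G" using anc obD[of x U i] by simp
    qed
    fix i assume i: "i \<in> Idx U 0"
    show "continuous_map (chart_space U i) (Top ?Y) (H i)"
    proof -
      have "continuous_map (chart_space U i) (Top Z) (\<lambda>p. h i (fst p, \<one>))"
        by (rule continuous_map_compose[of "chart_space U i" "chart_space U i" "\<lambda>p. (fst p, \<one>)" "Top Z" "h i", unfolded comp_def])
          (auto intro!: continuous_map_into_chart_space continuous_map_chart_fst' atlas_continuous[OF h(1) i]
            simp: topspace_top_of)
      moreover have "continuous_map (chart_space U i) (Top W) (\<lambda>p. k i (fst p, snd p))"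
        using atlas_continuous[OF k(1) i] by simp
      ultimately have "continuous_map (chart_space U i) FP (\<lambda>p. (h i (fst p, \<one>), k i (fst p, snd p)))"
        unfolding FP_def continuous_map_in_subtopology
        using atlas_anchor[OF h(1) i] atlas_anchor[OF k(1) i] by (auto simp: continuous_map_pairedI)
      from continuous_map_compose[OF this quotient_imp_continuous_map[OF quotient_map_quotient_topology]]
      have "continuous_map (chart_space U i) (Top ?Y) (?q \<circ> (\<lambda>p. (h i (fst p, \<one>), k i (fst p, snd p))))"
        unfolding Top .
      then show ?thesis by (rule continuous_map_eq) (use q[OF i _ one_closed] in auto)
    qed
    show "open_map (chart_space U i) (Top ?Y) (H i)"
      unfolding open_map_def
    proof (intro allI impI)
      fix A assume A: "openin (chart_space U i) A"
      then have As: "A \<subseteq> ob U i \<times> carrier S" using openin_subset by fastforce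
      let ?V = "{z \<in> points Z. anchor Z z \<in> ob U i}" and ?V' = "{w \<in> points W. anchor W w \<in> ob U i}"
      let ?B = "{p \<in> topspace FP. fst p \<in> ?V \<and> snd p \<in> ?V'}"
      \<comment> \<open>The quotient map in coordinates: \<open>?q p = H i (?m p)\<close> for p in
        \<open>?B\<close>. The saturated preimage of the image of A under \<open>H i\<close> is
        therefore the preimage of A under the continuous map \<open>?m\<close>.\<close>
      let ?m = "\<lambda>p. (anchor Z (fst p), coord U h i (fst p) \<otimes> coord U k i (snd p))"
      have pr: "continuous_map FP (Top Z) fst" "continuous_map FP (Top W) snd"
        unfolding FP_def by (auto intro!: continuous_map_from_subtopology continuous_map_fst continuous_map_snd)
      have "openin FP ({p \<in> topspace FP. fst p \<in> ?V} \<inter> {p \<in> topspace FP. snd p \<in> ?V'})"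
        by (intro openin_Int openin_continuous_map_preimage[OF pr(1)] openin_continuous_map_preimage[OF pr(2)]
            atlas_fibre_open[OF h(1) i] atlas_fibre_open[OF k(1) i])
      then have B: "openin FP ?B" by (rule back_subst[of "openin FP"]) auto
      have prV: "continuous_map (subtopology FP ?B) (subtopology (Top Z) ?V) fst"
        "continuous_map (subtopology FP ?B) (subtopology (Top W) ?V') snd"
        unfolding continuous_map_in_subtopology by (auto intro!: continuous_map_from_subtopology pr)
      note ch = continuous_map_compose[OF prV(1) coord_continuous[OF h(1) i], unfolded comp_def]
      note ck = continuous_map_compose[OF prV(2) coord_continuous[OF k(1) i], unfolded comp_def]
      have m: "continuous_map (subtopology FP ?B) (chart_space U i) ?m"
      proof (rule continuous_map_into_chart_space)
        show "continuous_map (subtopology FP ?B) (Obj G) (\<lambda>p. anchor Z (fst p))"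
          using continuous_map_compose[OF ch continuous_map_chart_fst'] by (simp add: comp_def)
        show "continuous_map (subtopology FP ?B) (top_of S) (\<lambda>p. coord U h i (fst p) \<otimes> coord U k i (snd p))"
          using continuous_map_compose[OF ch continuous_map_chart_snd] continuous_map_compose[OF ck continuous_map_chart_snd]
          by (intro continuous_map_mult) (simp_all add: comp_def)
      qed auto
      have "openin FP {p \<in> topspace (subtopology FP ?B). ?m p \<in> A}"
        using openin_continuous_map_preimage[OF m A] B openin_open_subtopology by blast
      moreover have "{p \<in> topspace (subtopology FP ?B). ?m p \<in> A} = {p \<in> topspace FP. ?q p \<in> H i ` A}"
      proof (intro subset_antisym subsetI)
        fix p assume p: "p \<in> {p \<in> topspace (subtopology FP ?B). ?m p \<in> A}"
        then have p': "p \<in> topspace FP" "anchor Z (fst p) \<in> ob U i" by auto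
        obtain s t where st: "s \<in> carrier S" "t \<in> carrier S" "p = (h i (anchor Z (fst p), s), k i (anchor Z (fst p), t))"
          using FPc[OF p'(1) i p'(2)] by blast
        have "coord U h i (fst p) = s" "coord U k i (snd p) = t"
          using coord_chart[OF h(1) i p'(2) st(1)] coord_chart[OF k(1) i p'(2) st(2)] st(3)
          by (metis fst_conv, metis snd_conv)
        then have "?q p = H i (?m p)" using q[OF i p'(2) st(1,2)] st(3) by metis
        then show "p \<in> {p \<in> topspace FP. ?q p \<in> H i ` A}" using p p' by auto
      next
        fix p assume p: "p \<in> {p \<in> topspace FP. ?q p \<in> H i ` A}"
        then obtain x a where a: "(x, a) \<in> A" "?q p = H i (x, a)" by auto
        then have xa: "x \<in> ob U i" "a \<in> carrier S" using As by auto
        have pF: "p \<in> topspace FP" using p by simp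
        \<comment> \<open>Every pair lies in its own class. As this class is also
          \<open>H i (x, a)\<close>, the coordinates of p in chart i can be read off from an element
          of that set.\<close>
        have "p \<in> ?q p"
        proof -
          obtain z w where zw: "p = (z, w)" "z \<in> points Z" "w \<in> points W" using pF[unfolded FP] by auto
          then obtain j where j: "j \<in> Idx U 0" "anchor Z (fst p) \<in> ob U j" using atlas_index[OF U h(1) zw(2)] by auto
          obtain s t where st: "s \<in> carrier S" "t \<in> carrier S" "p = (h j (anchor Z (fst p), s), k j (anchor Z (fst p), t))"
            using FPc[OF pF j] by blast
          have "(h j (anchor Z (fst p), inv (inv s)), k j (anchor Z (fst p), s \<otimes> t \<otimes> inv s)) \<in> H j (anchor Z (fst p), s \<otimes> t)"
            unfolding H_def using st(1) by (intro image_eqI[of _ _ "inv s"]) auto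
          moreover have "s \<otimes> t \<otimes> inv s = t" using st(1,2) by (metis m_comm m_closed inv_closed mult_inv_cancel(2))
          ultimately show ?thesis using q[OF j st(1,2)] st by (metis inv_inv)
        qed
        then obtain t where t: "t \<in> carrier S" "p = (h i (x, inv t), k i (x, a \<otimes> t))"
          using a(2) by (auto simp: H_def)
        have "anchor Z (fst p) = x" "coord U h i (fst p) = inv t" "coord U k i (snd p) = a \<otimes> t"
          unfolding t(2) using atlas_anchor[OF h(1) i xa(1)] coord_chart[OF h(1) i xa(1)] coord_chart[OF k(1) i xa(1)] t(1) xa(2)
          by simp_all
        moreover have "inv t \<otimes> (a \<otimes> t) = a" using t(1) xa(2) by (metis m_comm m_closed mult_inv_cancel(2))
        moreover have "fst p \<in> ?V" "snd p \<in> ?V'"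
          unfolding t(2) using atlas_anchor[OF h(1) i xa(1)] atlas_anchor[OF k(1) i xa(1)] t(1) xa
            atlas_in[OF h(1) i xa(1)] atlas_in[OF k(1) i xa(1)] by simp_all
        ultimately show "p \<in> {p \<in> topspace (subtopology FP ?B). ?m p \<in> A}" using a(1) pF by simp
      qed
      moreover have "H i ` A \<subseteq> ?q ` topspace FP"
        using As Hin[OF i] unfolding pts by blast
      ultimately show "openin (Top ?Y) (H i ` A)" by (simp add: Top openin_quotient_topology)
    qed
    show "H i ` (ob U i \<times> carrier S) = {z \<in> points ?Y. anchor ?Y z \<in> ob U i}"
    proof (intro subset_antisym subsetI)
      fix A assume "A \<in> H i ` (ob U i \<times> carrier S)"
      then show "A \<in> {z \<in> points ?Y. anchor ?Y z \<in> ob U i}" using Hin[OF i] anc[OF i] by auto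
    next
      fix A assume A: "A \<in> {z \<in> points ?Y. anchor ?Y z \<in> ob U i}"
      then obtain p where p: "p \<in> topspace FP" "A = ?q p" using pts by auto
      obtain j x s where j: "j \<in> Idx U 0" "x \<in> ob U j" "s \<in> carrier S" "A = H j (x, s)" using A ptsE by blast
      have x: "x \<in> ob U i" using anc[OF j(1-3)] A j(4) by simp
      \<comment> \<open>A representative of the class found in chart j, to be rewritten in chart i,
        where \<open>q\<close> applies again.\<close>
      have "A = ?q (h j (x, \<one>), k j (x, s))" using q[OF j(1,2) one_closed j(3)] j by simp
      moreover obtain s' t' where "s' \<in> carrier S" "t' \<in> carrier S"
        "(h j (x, \<one>), k j (x, s)) = (h i (x, s'), k i (x, t'))"
        using FPc[OF hkFP[OF j(1,2) one_closed j(3)] i] atlas_anchor[OF h(1) j(1,2) one_closed] x by auto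
      ultimately have "A = H i (x, s' \<otimes> t')" "s' \<otimes> t' \<in> carrier S" using q[OF i x] by auto
      then show "A \<in> H i ` (ob U i \<times> carrier S)" using x by blast
    qed
    fix x s assume x: "x \<in> ob U i" and s: "s \<in> carrier S"
    show "anchor ?Y (H i (x, s)) = x" by (rule anc[OF i x s])
    have "map_prod (tau Z) (tau W) ` H i (x, s) =
        (\<lambda>t. (h (ibar U 0 i) (\<rho> x, inv t), k (ibar U 0 i) (\<rho> x, bar S s \<otimes> t))) ` bar S ` carrier S"
      unfolding H_def image_image
      using atlas_tau[OF h(1) i x] atlas_tau[OF k(1) i x] s by (intro image_cong) simp_all
    then show "tau ?Y (H i (x, s)) = H (ibar U 0 i) (\<rho> x, bar S s)"
      unfolding bar_image_carrier by (simp add: gen_hom_sum_def H_def)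
    fix t assume t: "t \<in> carrier S"
    have "(\<lambda>(z, w). (z, ract W w t)) ` H i (x, s) = H i (x, s \<otimes> t)"
      unfolding H_def image_image
      using atlas_ract[OF k(1) i x] s t by (intro image_cong) (simp_all add: m_ac)
    then show "ract ?Y (H i (x, s)) t = H i (x, s \<otimes> t)" by (simp add: gen_hom_sum_def)
    assume e: "H i (x, s) = H i (x, t)"
    have "(h i (x, inv \<one>), k i (x, s \<otimes> \<one>)) \<in> H i (x, s)" unfolding H_def using one_closed by force
    then have "(h i (x, \<one>), k i (x, s)) \<in> H i (x, t)" using e s by simp
    then obtain u where u: "u \<in> carrier S" "h i (x, \<one>) = h i (x, inv u)" "k i (x, s) = k i (x, t \<otimes> u)"
      by (auto simp: H_def)
    then have "\<one> = inv u" "s = t \<otimes> u"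
      using atlas_inj[OF h(1) i x one_closed inv_closed[OF u(1)]] atlas_inj[OF k(1) i x s m_closed[OF t u(1)]] by auto
    then show "s = t" using u(1) t by (metis inv_inv inv_one r_one)
  qed
  moreover have "transition U ?Y H (val U (mk U ?f))"
    unfolding transition_def
  proof (intro ballI)
    fix i j g s assume *: "i \<in> Idx U 0" "j \<in> Idx U 0" "g \<in> over U i j" "s \<in> carrier S"
    note fin = cocycle_on_in[OF fc *(1-3)] cocycle_on_in[OF fd *(1-3)]
    have "(\<lambda>(z, w). (lact Z g z, lact W g w)) ` H j (src G g, s) =
       (\<lambda>t. (h i (rng G g, val U c i j g \<otimes> inv t), k i (rng G g, val U d i j g \<otimes> (s \<otimes> t)))) ` carrier S"
      unfolding H_def image_image
      using transitionD[OF h(2) *(1-3)] transitionD[OF k(2) *(1-3)] *(4) by (intro image_cong) simp_all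
    \<comment> \<open>Reindexing by the value of c cancels that value in the first coordinate and
      multiplies it into the second.\<close>
    also have "\<dots> = (\<lambda>t. (h i (rng G g, val U c i j g \<otimes> inv t), k i (rng G g, val U d i j g \<otimes> (s \<otimes> t))))
        ` (\<lambda>t. val U c i j g \<otimes> t) ` carrier S"
      by (simp only: image_mult_carrier[OF fin(1)])
    also have "\<dots> = H i (rng G g, ?f i j g \<otimes> s)"
      unfolding image_image H_def using fin *(4) by (intro image_cong) (simp_all add: mult_inv_mult m_ac)
    finally show "lact ?Y g (H j (src G g, s)) = H i (rng G g, val U (mk U ?f) i j g \<otimes> s)"
      by (simp add: gen_hom_sum_def val_mk[OF U f *(1-3)])
  qed
  ultimately show ?thesis unfolding represents_def using mk_cocycle[OF U f] by blast
qed

end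


section \<open>The axioms of a generalized homomorphism derived from charts\<close>

lemma coord_continuous':
  assumes "atlas U Z h" "i \<in> Idx U 0"
  shows "continuous_map (subtopology (Top Z) {z \<in> points Z. anchor Z z \<in> ob U i}) (top_of S) (coord U h i)"
    and "continuous_map (subtopology (Top Z) {z \<in> points Z. anchor Z z \<in> ob U i}) (Obj G) (anchor Z)"
  using continuous_map_compose[OF coord_continuous[OF assms] continuous_map_chart_snd]
    continuous_map_compose[OF coord_continuous[OF assms] continuous_map_chart_fst']
  by (simp_all add: comp_def)

context
  fixes U :: "('g, 'j) cover_data"
  assumes U: "real_open_cover G U"
begin

lemma atlas_point:
  assumes "atlas U Z h" "z \<in> points Z"
  obtains i x s where "i \<in> Idx U 0" "x \<in> ob U i" "s \<in> carrier S" "z = h i (x, s)" "anchor Z z = x"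
proof -
  obtain i where i: "i \<in> Idx U 0" "anchor Z z \<in> ob U i" using assms(2) by (rule atlas_index[OF U assms(1)])
  obtain s where "s \<in> carrier S" "z = h i (anchor Z z, s)" using atlas_cases[OF assms(1) i(1) assms(2) i(2)] .
  then show ?thesis using that i by blast
qed

lemma atlas_anchor_continuous:
  assumes h: "atlas U Z h" shows "continuous_map (Top Z) (Obj G) (anchor Z)"
proof (rule continuous_map_locallyI)
  fix z assume z: "z \<in> points Z"
  then obtain i where i: "i \<in> Idx U 0" "anchor Z z \<in> ob U i" by (rule atlas_index[OF U h])
  let ?V = "{z \<in> points Z. anchor Z z \<in> ob U i}"
  show "\<exists>W g. openin (Top Z) W \<and> z \<in> W \<and> continuous_map (subtopology (Top Z) W) (Obj G) g \<and>
      (\<forall>y\<in>W. anchor Z y = g y)"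
    using atlas_fibre_open[OF h i(1)] coord_continuous'(2)[OF h i(1)] i z
    by (intro exI[of _ ?V] exI[of _ "anchor Z"]) simp
qed

lemma Hausdorff_chart_space: "Hausdorff_space (chart_space U i)"
  unfolding chart_space_def
  by (intro Hausdorff_space_subtopology) (simp add: Hausdorff_space_prod_topology obj_Hausdorff Hausdorff_top_of)

lemma locally_compact_chart_space: "i \<in> Idx U 0 \<Longrightarrow> locally_compact_space (chart_space U i)"
proof -
  assume i: "i \<in> Idx U 0"
  have "openin (prod_topology (Obj G) (top_of S)) (ob U i \<times> carrier S)"
    using openin_topspace[of "chart_space U i"] by (simp add: openin_chart_space[OF U i])
  moreover have "Hausdorff_space (prod_topology (Obj G) (top_of S))"
    by (simp add: Hausdorff_space_prod_topology obj_Hausdorff Hausdorff_top_of)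
  moreover have "locally_compact_space (prod_topology (Obj G) (top_of S))"
    by (simp add: locally_compact_space_prod_topology obj_locally_compact locally_compact_top_of)
  ultimately show ?thesis unfolding chart_space_def using locally_compact_space_open_subset by blast
qed

lemma atlas_homeomorphic_space:
  assumes "atlas U Z h" "i \<in> Idx U 0"
  shows "chart_space U i homeomorphic_space subtopology (Top Z) {z \<in> points Z. anchor Z z \<in> ob U i}"
  using atlas_homeomorphic[OF assms] homeomorphic_space by blast

text \<open>Points over different objects are separated by the continuous map \<open>anchor\<close>
  into a Hausdorff space; points over the same object lie in one chart, whose image is open and
  Hausdorff.\<close>

lemma atlas_Hausdorff:
  assumes h: "atlas U Z h" shows "Hausdorff_space (Top Z)"
  unfolding Hausdorff_space_def
proof (intro allI impI, elim conjE)
  fix z w assume z: "z \<in> points Z" and w: "w \<in> points Z" and ne: "z \<noteq> w"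
  show "\<exists>A B. openin (Top Z) A \<and> openin (Top Z) B \<and> z \<in> A \<and> w \<in> B \<and> disjnt A B"
  proof (cases "anchor Z z = anchor Z w")
    case False
    then obtain A B where AB: "openin (Obj G) A" "openin (Obj G) B" "anchor Z z \<in> A" "anchor Z w \<in> B" "disjnt A B"
      using obj_Hausdorff atlas_anchor_in[OF h z] atlas_anchor_in[OF h w] unfolding Hausdorff_space_def by blast
    note p = openin_continuous_map_preimage[OF atlas_anchor_continuous[OF h]]
    show ?thesis
      using p[OF AB(1)] p[OF AB(2)] AB(3-5) z w
      by (intro exI[of _ "{z \<in> points Z. anchor Z z \<in> A}"] exI[of _ "{z \<in> points Z. anchor Z z \<in> B}"])
        (auto simp: disjnt_iff)
  next
    case True
    obtain i where i: "i \<in> Idx U 0" "anchor Z z \<in> ob U i" using z by (rule atlas_index[OF U h])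
    let ?V = "{z \<in> points Z. anchor Z z \<in> ob U i}"
    have "Hausdorff_space (subtopology (Top Z) ?V)"
      using homeomorphic_Hausdorff_space[OF atlas_homeomorphic_space[OF h i(1)]] Hausdorff_chart_space by simp
    moreover have "z \<in> topspace (subtopology (Top Z) ?V)" "w \<in> topspace (subtopology (Top Z) ?V)"
      using z w i(2) True by auto
    ultimately obtain A B where AB: "openin (subtopology (Top Z) ?V) A" "openin (subtopology (Top Z) ?V) B"
        "z \<in> A" "w \<in> B" "disjnt A B"
      using ne unfolding Hausdorff_space_def by blast
    moreover have "openin (Top Z) A" "openin (Top Z) B"
      using openin_trans_full[OF AB(1)] openin_trans_full[OF AB(2)] atlas_fibre_open[OF h i(1)] by blast+
    ultimately show ?thesis by blast
  qed
qed

text \<open>A compact neighbourhood inside the open image of a chart is still one in the whole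
  space.\<close>

lemma atlas_locally_compact:
  assumes h: "atlas U Z h" shows "locally_compact_space (Top Z)"
  unfolding locally_compact_space_def
proof
  fix z assume z: "z \<in> points Z"
  then obtain i where i: "i \<in> Idx U 0" "anchor Z z \<in> ob U i" by (rule atlas_index[OF U h])
  let ?V = "{z \<in> points Z. anchor Z z \<in> ob U i}"
  have "locally_compact_space (subtopology (Top Z) ?V)"
    using homeomorphic_locally_compact_space[OF atlas_homeomorphic_space[OF h i(1)]]
      locally_compact_chart_space[OF i(1)] by simp
  moreover have "z \<in> topspace (subtopology (Top Z) ?V)" using z i(2) by auto
  ultimately obtain A K where "openin (subtopology (Top Z) ?V) A" "compactin (subtopology (Top Z) ?V) K" "z \<in> A" "A \<subseteq> K"
    unfolding locally_compact_space_def by blast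
  then show "\<exists>A K. openin (Top Z) A \<and> compactin (Top Z) K \<and> z \<in> A \<and> A \<subseteq> K"
    using atlas_fibre_open[OF h i(1)] by (meson compactin_subtopology openin_trans_full)
qed

text \<open>Each axiom becomes an identity between coordinates. Associativity of the left action is
  the cocycle identity, the action of units is \<open>cocycle_on_unt\<close>, compatibility with
  \<open>tau\<close> is Reality of the cocycle, and commutation of the two actions is associativity
  in \<open>S\<close>. Continuity is checked on the open pieces where fixed charts apply.\<close>

lemma represents_real_gen_hom:
  assumes Z: "represents Z U c"
  shows "real_gen_hom G S Z"
proof -
  obtain h where c: "c \<in> cocycles 1 G S U" and h: "atlas U Z h" and tr: "transition U Z h (val U c)"
    using Z by (auto simp: represents_def)
  define f where "f = val U c"
  note T = transitionD[OF tr[folded f_def]]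
  have f: "cocycle_on U f" using val_cocycle_on[OF U c] by (simp add: f_def)
  note fin = cocycle_on_in[OF f]
  note pt = atlas_point[OF h]
  have ib: "ibar U 0 i \<in> Idx U 0" "\<rho> x \<in> ob U (ibar U 0 i)" if "i \<in> Idx U 0" "x \<in> ob U i" for i x
    using that obD[OF that(2)] by (simp_all add: ibar_in[OF U] ob_ibar[OF U])
  have anch: "continuous_map (Top Z) (Obj G) (anchor Z)" by (rule atlas_anchor_continuous[OF h])
  have ob_ex: "\<exists>i\<in>Idx U 0. x \<in> ob U i" if "x \<in> objects G" for x using ob_cover[OF U that] .
  have tt: "tau Z (tau Z z) = z" "tau Z z \<in> points Z" "anchor Z (tau Z z) = \<rho> (anchor Z z)"
    if zz: "z \<in> points Z" for z
  proof -
    obtain i x s where i: "i \<in> Idx U 0" "x \<in> ob U i" "s \<in> carrier S" "z = h i (x, s)" "anchor Z z = x"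
      using zz by (rule pt)
    have x: "x \<in> objects G" by (rule obD[OF i(2)])
    note j = ib[OF i(1,2)] bar_in[OF i(3)]
    show "tau Z (tau Z z) = z"
      using atlas_tau[OF h i(1-3)] atlas_tau[OF h j] i x ibar_ibar[OF U i(1)] by simp
    show "tau Z z \<in> points Z" "anchor Z (tau Z z) = \<rho> (anchor Z z)"
      using atlas_tau[OF h i(1-3)] atlas_in[OF h j] atlas_anchor[OF h j] i by simp_all
  qed
  have tc: "continuous_map (Top Z) (Top Z) (tau Z)"
  proof (rule continuous_map_locallyI)
    fix z assume z: "z \<in> points Z"
    then obtain i where i: "i \<in> Idx U 0" "anchor Z z \<in> ob U i" by (rule atlas_index[OF U h])
    let ?V = "{z \<in> points Z. anchor Z z \<in> ob U i}"
    let ?m = "\<lambda>y. (\<rho> (anchor Z y), bar S (coord U h i y))"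
    have "continuous_map (subtopology (Top Z) ?V) (chart_space U (ibar U 0 i)) ?m"
    proof (rule continuous_map_into_chart_space)
      show "continuous_map (subtopology (Top Z) ?V) (Obj G) (\<lambda>y. \<rho> (anchor Z y))"
        using continuous_map_compose[OF coord_continuous'(2)[OF h i(1)] rho_obj_continuous] by (simp add: comp_def)
    qed (use ib[OF i(1)] continuous_map_bar[OF coord_continuous'(1)[OF h i(1)]] in auto)
    from continuous_map_compose[OF this atlas_continuous[OF h ibar_in[OF U i(1)]]]
    have "continuous_map (subtopology (Top Z) ?V) (Top Z) (h (ibar U 0 i) \<circ> ?m)" .
    moreover have "tau Z y = (h (ibar U 0 i) \<circ> ?m) y" if "y \<in> ?V" for y
    proof -
      have y: "y \<in> points Z" "anchor Z y \<in> ob U i" using that by auto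
      show ?thesis using atlas_tau[OF h i(1) y(2) coord_in(1)[OF h i(1) y]] coord_in(2)[OF h i(1) y] by simp
    qed
    ultimately show "\<exists>W g. openin (Top Z) W \<and> z \<in> W \<and> continuous_map (subtopology (Top Z) W) (Top Z) g \<and>
        (\<forall>y\<in>W. tau Z y = g y)"
      using atlas_fibre_open[OF h i(1)] i(2) z by (intro exI[of _ ?V] exI[of _ "h (ibar U 0 i) \<circ> ?m"]) auto
  qed
  show ?thesis
  proof
    show "real_space (Top Z) (tau Z)"
      unfolding real_space_def homeomorphic_maps_def
      using atlas_locally_compact[OF h] atlas_Hausdorff[OF h] tc tt(1) by blast
    show "continuous_map (Top Z) (Obj G) (anchor Z)" by (rule anch)
    show "anchor Z (tau Z z) = \<rho> (anchor Z z)" if "z \<in> points Z" for z by (rule tt(3)[OF that])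
    have L: "\<exists>i\<in>Idx U 0. rng G g \<in> ob U i \<and> g \<in> over U i j \<and> f i j g \<in> carrier S \<and>
        (\<forall>s\<in>carrier S. lact Z g (h j (src G g, s)) = h i (rng G g, f i j g \<otimes> s))"
      if g: "g \<in> arrows G" "src G g \<in> ob U j" and j: "j \<in> Idx U 0" for g j
    proof -
      obtain i where i: "i \<in> Idx U 0" "rng G g \<in> ob U i" using ob_ex[OF rng_in[OF g(1)]] by blast
      then have o: "g \<in> over U i j" using g by auto
      show ?thesis using T[OF i(1) j o] fin[OF i(1) j o] i o by blast
    qed
    show "continuous_map (subtopology (prod_topology (Arr G) (Top Z)) {(g, z). src G g = anchor Z z})
         (Top Z) (\<lambda>(g, z). lact Z g z)" (is "continuous_map ?X _ _")
    proof (rule continuous_map_locallyI)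
      fix p assume "p \<in> topspace ?X"
      then obtain g z where p: "p = (g, z)" and g: "g \<in> arrows G" and z: "z \<in> points Z" and gz: "src G g = anchor Z z"
        by auto
      obtain j where j: "j \<in> Idx U 0" "anchor Z z \<in> ob U j" using z by (rule atlas_index[OF U h])
      obtain i where i: "i \<in> Idx U 0" "rng G g \<in> ob U i" using ob_ex[OF rng_in[OF g]] by blast
      \<comment> \<open>Near (g, z) one chart around the range of g and one around the anchor of z
        are kept fixed. There the result of the action has base point r(g) and coordinate
        \<open>f i j g\<close> times the coordinate of z.\<close>
      let ?A = "{g \<in> arrows G. rng G g \<in> ob U i}" and ?B = "{z \<in> points Z. anchor Z z \<in> ob U j}"
      let ?W = "(?A \<times> ?B) \<inter> {(g, z). src G g = anchor Z z}"
      have "openin (prod_topology (Arr G) (Top Z)) (?A \<times> ?B)"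
        using openin_continuous_map_preimage[OF rng_continuous ob_open[OF U i(1)]] atlas_fibre_open[OF h j(1)]
        by (simp add: openin_prod_Times_iff)
      then have W: "openin ?X ?W" unfolding openin_subtopology by blast
      have Wsub: "subtopology ?X ?W = subtopology (prod_topology (Arr G) (Top Z)) ?W"
        by (simp add: subtopology_subtopology Int_absorb1)
      have Wp: "fst q \<in> over U i j" "snd q \<in> ?B" "src G (fst q) = anchor Z (snd q)" if "q \<in> ?W" for q
        using that by auto
      have 1: "continuous_map (subtopology ?X ?W) (subtopology (Arr G) (over U i j)) fst"
        unfolding Wsub continuous_map_in_subtopology using Wp(1)
        by (auto simp: continuous_map_subtopology_fst)
      have 2: "continuous_map (subtopology ?X ?W) (subtopology (Top Z) ?B) snd"
        unfolding Wsub continuous_map_in_subtopology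
        by (auto simp: continuous_map_subtopology_snd)
      let ?m = "\<lambda>q. (rng G (fst q), f i j (fst q) \<otimes> coord U h j (snd q))"
      have "continuous_map (subtopology ?X ?W) (chart_space U i) ?m"
      proof (rule continuous_map_into_chart_space)
        show "continuous_map (subtopology ?X ?W) (Obj G) (\<lambda>q. rng G (fst q))"
          using continuous_map_compose[OF 1 continuous_map_from_subtopology[OF rng_continuous]] by (simp add: comp_def)
        show "continuous_map (subtopology ?X ?W) (top_of S) (\<lambda>q. f i j (fst q) \<otimes> coord U h j (snd q))"
          using continuous_map_compose[OF 1 cocycle_on_continuous[OF f i(1) j(1)]]
            continuous_map_compose[OF 2 coord_continuous'(1)[OF h j(1)]]
          by (intro continuous_map_mult) (simp_all add: comp_def)
      qed auto
      from continuous_map_compose[OF this atlas_continuous[OF h i(1)]]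
      have "continuous_map (subtopology ?X ?W) (Top Z) (h i \<circ> ?m)" .
      moreover have "(case q of (g, z) \<Rightarrow> lact Z g z) = (h i \<circ> ?m) q" if q: "q \<in> ?W" for q
      proof -
        obtain g' z' where q': "q = (g', z')" by fastforce
        have z': "z' \<in> points Z" "anchor Z z' \<in> ob U j" "src G g' = anchor Z z'" "g' \<in> over U i j"
          using Wp[OF q] q' by auto
        show ?thesis
          using T[OF i(1) j(1) z'(4) coord_in(1)[OF h j(1) z'(1,2)]] coord_in(2)[OF h j(1) z'(1,2)] z'(3) q' by simp
      qed
      ultimately show "\<exists>W m. openin ?X W \<and> p \<in> W \<and> continuous_map (subtopology ?X W) (Top Z) m \<and>
          (\<forall>q\<in>W. (case q of (g, z) \<Rightarrow> lact Z g z) = m q)"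
        using W p g z gz i j by (intro exI[of _ ?W] exI[of _ "h i \<circ> ?m"]) auto
    qed
    show "continuous_map (prod_topology (Top Z) (top_of S)) (Top Z) (\<lambda>(z, t). ract Z z t)" (is "continuous_map ?X _ _")
    proof (rule continuous_map_locallyI)
      fix p assume "p \<in> topspace ?X"
      then obtain z t where p: "p = (z, t)" and z: "z \<in> points Z" and t: "t \<in> carrier S"
        by (auto simp: topspace_top_of)
      obtain i where i: "i \<in> Idx U 0" "anchor Z z \<in> ob U i" using z by (rule atlas_index[OF U h])
      let ?V = "{z \<in> points Z. anchor Z z \<in> ob U i}"
      let ?W = "?V \<times> carrier S"
      have W: "openin ?X ?W"
        using atlas_fibre_open[OF h i(1)] openin_topspace[of "top_of S"]
        by (simp add: openin_prod_Times_iff topspace_top_of)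
      have 1: "continuous_map (subtopology ?X ?W) (subtopology (Top Z) ?V) fst"
        unfolding continuous_map_in_subtopology by (auto simp: continuous_map_subtopology_fst)
      let ?m = "\<lambda>q. (anchor Z (fst q), coord U h i (fst q) \<otimes> snd q)"
      have "continuous_map (subtopology ?X ?W) (chart_space U i) ?m"
      proof (rule continuous_map_into_chart_space)
        show "continuous_map (subtopology ?X ?W) (Obj G) (\<lambda>q. anchor Z (fst q))"
          using continuous_map_compose[OF 1 coord_continuous'(2)[OF h i(1)]] by (simp add: comp_def)
        show "continuous_map (subtopology ?X ?W) (top_of S) (\<lambda>q. coord U h i (fst q) \<otimes> snd q)"
          using continuous_map_compose[OF 1 coord_continuous'(1)[OF h i(1)]]
          by (intro continuous_map_mult) (simp_all add: comp_def continuous_map_subtopology_snd)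
      qed auto
      from continuous_map_compose[OF this atlas_continuous[OF h i(1)]]
      have "continuous_map (subtopology ?X ?W) (Top Z) (h i \<circ> ?m)" .
      moreover have "(case q of (z, t) \<Rightarrow> ract Z z t) = (h i \<circ> ?m) q" if q: "q \<in> ?W" for q
      proof -
        obtain z' t' where q': "q = (z', t')" "z' \<in> points Z" "anchor Z z' \<in> ob U i" "t' \<in> carrier S" using q by auto
        show ?thesis
          using atlas_ract[OF h i(1) q'(3) coord_in(1)[OF h i(1) q'(2,3)] q'(4)] coord_in(2)[OF h i(1) q'(2,3)] q'(1)
          by simp
      qed
      ultimately show "\<exists>W m. openin ?X W \<and> p \<in> W \<and> continuous_map (subtopology ?X W) (Top Z) m \<and>
          (\<forall>q\<in>W. (case q of (z, t) \<Rightarrow> ract Z z t) = m q)"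
        using W p z t i by (intro exI[of _ ?W] exI[of _ "h i \<circ> ?m"]) auto
    qed
    show "locally_trivial_principal_bundle (Obj G) S (Top Z) (anchor Z) (ract Z)"
      unfolding locally_trivial_principal_bundle_def
    proof
      fix x assume "x \<in> objects G"
      then obtain i where i: "i \<in> Idx U 0" "x \<in> ob U i" using ob_ex by blast
      show "\<exists>V k. openin (Obj G) V \<and> x \<in> V \<and>
        homeomorphic_map (prod_topology (subtopology (Obj G) V) (top_of S))
          (subtopology (Top Z) {z \<in> points Z. anchor Z z \<in> V}) k \<and>
        (\<forall>y \<in> V. \<forall>s \<in> carrier S. anchor Z (k (y, s)) = y \<and>
           (\<forall>t \<in> carrier S. k (y, s \<otimes> t) = ract Z (k (y, s)) t))"
        using ob_open[OF U i(1)] i(2) atlas_homeomorphic[OF h i(1)] atlas_anchor[OF h i(1)] atlas_ract[OF h i(1)]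
        by (intro exI[of _ "ob U i"] exI[of _ "h i"]) (simp add: chart_space_eq)
    qed
    fix z assume z: "z \<in> points Z"
    then obtain j x s where j: "j \<in> Idx U 0" "x \<in> ob U j" "s \<in> carrier S" and zj: "z = h j (x, s)" and x: "anchor Z z = x"
      by (rule pt)
    show "lact Z (unt G (anchor Z z)) z = z"
      using T[OF j(1,1) unt_over[OF j(2,2)] j(3)] cocycle_on_unt[OF f j(1,2)] j zj x obD[OF j(2)] by simp
    show "ract Z z \<one> = z" using atlas_ract[OF h j one_closed] zj j by simp
    show "ract Z z (a \<otimes> b) = ract Z (ract Z z a) b" if "a \<in> carrier S" "b \<in> carrier S" for a b
      using atlas_ract[OF h j, of "a \<otimes> b"] atlas_ract[OF h j that(1)] atlas_ract[OF h j(1,2) m_closed[OF j(3) that(1)] that(2)]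
        zj j that by (simp add: m_assoc)
    show "anchor Z (ract Z z t) = anchor Z z" if "t \<in> carrier S" for t
      using atlas_ract[OF h j that] atlas_anchor[OF h j(1,2) m_closed[OF j(3) that]] zj x by simp
    show "tau Z (ract Z z t) = ract Z (tau Z z) (bar S t)" if "t \<in> carrier S" for t
      using atlas_ract[OF h j that] atlas_tau[OF h j(1,2) m_closed[OF j(3) that]] atlas_tau[OF h j]
        atlas_ract[OF h ib[OF j(1,2)] bar_in[OF j(3)] bar_in[OF that]] zj j that by simp
    fix g assume g: "g \<in> arrows G"
    { assume sg: "src G g = anchor Z z"
      then obtain i where i: "i \<in> Idx U 0" "rng G g \<in> ob U i" "g \<in> over U i j" "f i j g \<in> carrier S"
        and l: "\<And>s. s \<in> carrier S \<Longrightarrow> lact Z g (h j (x, s)) = h i (rng G g, f i j g \<otimes> s)"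
        using L[OF g _ j(1)] j(2) x by metis
      show "anchor Z (lact Z g z) = rng G g"
        using l[OF j(3)] atlas_anchor[OF h i(1,2)] i(4) j(3) zj by simp
      show "lact Z g (ract Z z t) = ract Z (lact Z g z) t" if "t \<in> carrier S" for t
        using atlas_ract[OF h j that] l[OF j(3)] l[OF m_closed[OF j(3) that]]
          atlas_ract[OF h i(1,2) m_closed[OF i(4) j(3)] that] zj i(4) j(3) that by (simp add: m_assoc)
      show "tau Z (lact Z g z) = lact Z (rho G g) (tau Z z)"
      proof -
        have o: "rho G g \<in> over U (ibar U 0 i) (ibar U 0 j)" by (rule over_ibar[OF U i(1) j(1) i(3)])
        show ?thesis
          using l[OF j(3)] atlas_tau[OF h i(1,2) m_closed[OF i(4) j(3)]] atlas_tau[OF h j]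
            T[OF ib(1)[OF i(1,2)] ib(1)[OF j(1,2)] o bar_in[OF j(3)]] cocycle_on_rho[OF f i(1) j(1) i(3)]
            zj g sg x i(4) j(3) by simp
      qed
    }
    fix k assume k: "k \<in> arrows G" and gk: "src G g = rng G k" and kz: "src G k = anchor Z z"
    obtain i where i: "i \<in> Idx U 0" "rng G k \<in> ob U i" "k \<in> over U i j" "f i j k \<in> carrier S"
      and li: "\<And>s. s \<in> carrier S \<Longrightarrow> lact Z k (h j (x, s)) = h i (rng G k, f i j k \<otimes> s)"
      using L[OF k _ j(1)] j(2) x kz by metis
    obtain m where m: "m \<in> Idx U 0" "rng G g \<in> ob U m" "g \<in> over U m i" "f m i g \<in> carrier S"
      and lm: "\<And>s. s \<in> carrier S \<Longrightarrow> lact Z g (h i (rng G k, s)) = h m (rng G g, f m i g \<otimes> s)"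
      using L[OF g _ i(1)] i(2) gk by metis
    have "lact Z (mul G g k) (h j (src G (mul G g k), s)) = h m (rng G (mul G g k), f m j (mul G g k) \<otimes> s)"
      by (rule T[OF m(1) j(1) mul_over[OF m(3) i(3) gk] j(3)])
    then show "lact Z (mul G g k) z = lact Z g (lact Z k z)"
      using cocycle_on_mul[OF f m(1) i(1) m(3) j(1) i(3) gk] li[OF j(3)] lm[OF m_closed[OF i(4) j(3)]]
        zj x kz g k gk m(4) i(4) j(3) by (simp add: m_assoc)
  qed
qed

end


section \<open>Gluing a bundle from a cocycle\<close>

lemma cocycle_on_mul_unt:
  assumes "cocycle_on U f" "i \<in> Idx U 0" "j \<in> Idx U 0" "k \<in> Idx U 0" "x \<in> ob U i" "x \<in> ob U j" "x \<in> ob U k"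
  shows "f i k (unt G x) = f i j (unt G x) \<otimes> f j k (unt G x)"
  using cocycle_on_mul[OF assms(1-3) unt_over[OF assms(5,6)] assms(4) unt_over[OF assms(6,7)]]
    obD[OF assms(5)] mul_unt[of "unt G x"] by simp

text \<open>
  The fibre over \<open>x\<close> is identified with \<open>S\<close> by one chosen chart \<open>ix x\<close>, so that the total space is
  the image of the set of all \<open>(x, s)\<close> under \<open>\<kappa>\<close>; only its topology is glued from the charts.
\<close>

lemma exists_represents:
  fixes \<kappa> :: "'x \<times> 's \<Rightarrow> 'z"
  assumes U: "real_open_cover G U" and c: "c \<in> cocycles 1 G S U"
    and \<kappa>: "inj_on \<kappa> (objects G \<times> carrier S)"
  shows "\<exists>Z :: ('x, 'g, 's, 'z) gen_hom_data. represents Z U c"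
proof -
  define f where "f = val U c"
  have f: "cocycle_on U f" using val_cocycle_on[OF U c] by (simp add: f_def)
  note fin = cocycle_on_in[OF f]
  define ix where "ix x = (SOME i. i \<in> Idx U 0 \<and> x \<in> ob U i)" for x
  have ix: "ix x \<in> Idx U 0" "x \<in> ob U (ix x)" if "x \<in> objects G" for x
    using someI_ex[of "\<lambda>i. i \<in> Idx U 0 \<and> x \<in> ob U i"] ob_cover[OF U that] unfolding ix_def by blast+
  \<comment> \<open>\<open>X\<close> and \<open>Y\<close> recover the object and the coordinate in
    the chosen chart from a coded point.\<close>
  define X where "X z = fst (inv_into (objects G \<times> carrier S) \<kappa> z)" for z
  define Y where "Y z = snd (inv_into (objects G \<times> carrier S) \<kappa> z)" for z
  have XY [simp]: "X (\<kappa> (x, s)) = x" "Y (\<kappa> (x, s)) = s" if "x \<in> objects G" "s \<in> carrier S" for x s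
    using inv_into_f_f[OF \<kappa>, of "(x, s)"] that by (simp_all add: X_def Y_def)
  \<comment> \<open>Chart i seen from the chosen chart \<open>ix x\<close>: the factor is the one by
    which \<open>transition_point\<close> passes from i to \<open>ix x\<close>.\<close>
  define h where "h i p = \<kappa> (fst p, f (ix (fst p)) i (unt G (fst p)) \<otimes> snd p)" for i p
  have fx: "f i j (unt G x) \<in> carrier S" if "i \<in> Idx U 0" "j \<in> Idx U 0" "x \<in> ob U i" "x \<in> ob U j" for i j x
    using fin[OF that(1,2) unt_over[OF that(3,4)]] .
  have fix1: "f (ix x) i (unt G x) \<in> carrier S" if "i \<in> Idx U 0" "x \<in> ob U i" for i x
    using fx[OF ix(1) that(1) ix(2) that(2)] obD[OF that(2)] by blast
  have h_trans: "h j (x, t) = h i (x, f i j (unt G x) \<otimes> t)"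
    if "i \<in> Idx U 0" "j \<in> Idx U 0" "x \<in> ob U i" "x \<in> ob U j" "t \<in> carrier S" for i j x t
  proof -
    have x: "x \<in> objects G" by (rule obD[OF that(3)])
    have "f (ix x) j (unt G x) \<otimes> t = f (ix x) i (unt G x) \<otimes> (f i j (unt G x) \<otimes> t)"
      unfolding cocycle_on_mul_unt[OF f ix(1)[OF x] that(1,2) ix(2)[OF x] that(3,4)]
      by (rule m_assoc[OF fix1[OF that(1,3)] fx[OF that(1-4)] that(5)])
    then show ?thesis by (simp only: h_def fst_conv snd_conv)
  qed
  have hX: "X (h i (x, s)) = x" "Y (h i (x, s)) = f (ix x) i (unt G x) \<otimes> s"
    if "i \<in> Idx U 0" "x \<in> ob U i" "s \<in> carrier S" for i x s
    using XY[OF obD[OF that(2)] m_closed[OF fix1[OF that(1,2)] that(3)]] unfolding h_def fst_conv snd_conv .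
  have h_inj: "s = t" if "i \<in> Idx U 0" "x \<in> ob U i" "s \<in> carrier S" "t \<in> carrier S" "h i (x, s) = h i (x, t)"
    for i x s t
  proof -
    have "f (ix x) i (unt G x) \<otimes> s = f (ix x) i (unt G x) \<otimes> t"
      using hX(2)[OF that(1,2,3)] hX(2)[OF that(1,2,4)] unfolding that(5) by (rule trans[OF sym])
    then show ?thesis using fix1[OF that(1,2)] that(3,4) by simp
  qed
  define q where "q = (\<lambda>(i, p). h i p)"
  \<comment> \<open>The choice \<open>ix\<close> varies without any continuity, so the topology is
    taken as a quotient of the disjoint union of all charts. The operations are written in the
    chosen coordinates; that they have the expected form in every chart is proved below.\<close>
  define Z where "Z = \<lparr>Top = quotient_topology (sum_topology (chart_space U) (Idx U 0)) q,
     tau = \<lambda>z. h (ibar U 0 (ix (X z))) (\<rho> (X z), bar S (Y z)),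
     anchor = X,
     lact = \<lambda>g z. h (ix (rng G g)) (rng G g, f (ix (rng G g)) (ix (X z)) g \<otimes> Y z),
     ract = \<lambda>z t. \<kappa> (X z, Y z \<otimes> t)\<rparr>"
  have Zs [simp]: "anchor Z = X" by (simp add: Z_def)
  have pts: "points Z = (\<Union>i\<in>Idx U 0. h i ` (ob U i \<times> carrier S))"
    by (force simp: Z_def topspace_quotient_topology q_def)
  have opn: "openin (Top Z) V \<longleftrightarrow> V \<subseteq> points Z \<and>
      (\<forall>i\<in>Idx U 0. openin (chart_space U i) {p \<in> ob U i \<times> carrier S. h i p \<in> V})" for V
  proof -
    have "openin (Top Z) V \<longleftrightarrow> V \<subseteq> points Z \<and> openin (sum_topology (chart_space U) (Idx U 0))
        {p \<in> topspace (sum_topology (chart_space U) (Idx U 0)). q p \<in> V}"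
      by (simp add: Z_def openin_quotient_topology topspace_quotient_topology)
    also have "openin (sum_topology (chart_space U) (Idx U 0))
        {p \<in> topspace (sum_topology (chart_space U) (Idx U 0)). q p \<in> V} \<longleftrightarrow>
        (\<forall>i\<in>Idx U 0. openin (chart_space U i) {p \<in> ob U i \<times> carrier S. h i p \<in> V})"
      unfolding openin_sum_topology by (auto simp: q_def cong: conj_cong intro!: arg_cong[where f = "openin _"])
    finally show ?thesis .
  qed
  have at: "atlas U Z h"
    unfolding atlas_def
  proof (intro conjI ballI impI)
    show "anchor Z \<in> points Z \<rightarrow> objects G"
    proof
      fix z assume "z \<in> points Z"
      then obtain i x s where "i \<in> Idx U 0" "x \<in> ob U i" "s \<in> carrier S" "z = h i (x, s)" unfolding pts by blast
      then show "anchor Z z \<in> objects G" using hX(1)[of i x s] obD[of x U i] by simp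
    qed
    fix i assume i: "i \<in> Idx U 0"
    show "continuous_map (chart_space U i) (Top Z) (h i)"
      unfolding continuous_map_def using i opn by (auto simp: pts)
    show "open_map (chart_space U i) (Top Z) (h i)"
      unfolding open_map_def
    proof (intro allI impI)
      fix A assume A: "openin (chart_space U i) A"
      have As: "A \<subseteq> ob U i \<times> carrier S" using openin_subset[OF A] by simp
      have "openin (chart_space U j) {p \<in> ob U j \<times> carrier S. h j p \<in> h i ` A}" if j: "j \<in> Idx U 0" for j
      proof -
        \<comment> \<open>The change of coordinates from chart j to chart i over the overlap. Its
          continuity is what makes the images of charts open in the quotient.\<close>
        let ?m = "\<lambda>p. (fst p, f i j (unt G (fst p)) \<otimes> snd p)"
        let ?B = "{p \<in> topspace (chart_space U j). fst p \<in> ob U i}"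
        have B: "openin (chart_space U j) ?B"
          by (rule openin_continuous_map_preimage[OF continuous_map_chart_fst' ob_open[OF U i]])
        have "continuous_map (subtopology (chart_space U j) ?B) (subtopology (Arr G) (over U i j)) (\<lambda>p. unt G (fst p))"
          unfolding continuous_map_in_subtopology
          using continuous_map_compose[OF continuous_map_from_subtopology[OF continuous_map_chart_fst'] unt_continuous]
          by (auto simp: comp_def)
        from continuous_map_compose[OF this cocycle_on_continuous[OF f i j]]
        have "continuous_map (subtopology (chart_space U j) ?B) (chart_space U i) ?m"
          by (intro continuous_map_into_chart_space continuous_map_mult
              continuous_map_from_subtopology[OF continuous_map_chart_fst']
              continuous_map_from_subtopology[OF continuous_map_chart_snd]) (simp_all add: comp_def)
        from openin_continuous_map_preimage[OF this A]
        have "openin (chart_space U j) {p \<in> topspace (subtopology (chart_space U j) ?B). ?m p \<in> A}"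
          using B openin_open_subtopology by blast
        moreover have "{p \<in> topspace (subtopology (chart_space U j) ?B). ?m p \<in> A} =
            {p \<in> ob U j \<times> carrier S. h j p \<in> h i ` A}"
        proof (intro subset_antisym subsetI)
          fix p assume p: "p \<in> {p \<in> topspace (subtopology (chart_space U j) ?B). ?m p \<in> A}"
          then obtain x t where x: "p = (x, t)" "x \<in> ob U j" "x \<in> ob U i" "t \<in> carrier S" by auto
          then have "h j p = h i (?m p)" using h_trans[OF i j x(3,2,4)] by simp
          then show "p \<in> {p \<in> ob U j \<times> carrier S. h j p \<in> h i ` A}" using p x by auto
        next
          fix p assume "p \<in> {p \<in> ob U j \<times> carrier S. h j p \<in> h i ` A}"
          then obtain x t y a where x: "p = (x, t)" "x \<in> ob U j" "t \<in> carrier S" and a: "(y, a) \<in> A" "h j (x, t) = h i (y, a)"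
            by auto
          have y: "y \<in> ob U i" "a \<in> carrier S" using a(1) As by auto
          have "x = y" using hX(1)[OF j x(2,3)] hX(1)[OF i y] a(2) by simp
          then have xi: "x \<in> ob U i" using y by simp
          have "f i j (unt G x) \<otimes> t = a"
            using h_inj[OF i xi m_closed[OF fx[OF i j xi x(2)] x(3)] y(2)] h_trans[OF i j xi x(2,3)] a(2) \<open>x = y\<close> by simp
          then show "p \<in> {p \<in> topspace (subtopology (chart_space U j) ?B). ?m p \<in> A}"
            using x xi a(1) \<open>x = y\<close> by simp
        qed
        ultimately show ?thesis by simp
      qed
      then show "openin (Top Z) (h i ` A)" unfolding opn using As i pts by auto
    qed
    show "h i ` (ob U i \<times> carrier S) = {z \<in> points Z. anchor Z z \<in> ob U i}"
    proof (intro subset_antisym subsetI)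
      fix z assume "z \<in> h i ` (ob U i \<times> carrier S)"
      then show "z \<in> {z \<in> points Z. anchor Z z \<in> ob U i}" using hX(1)[OF i] i pts by auto
    next
      fix z assume z: "z \<in> {z \<in> points Z. anchor Z z \<in> ob U i}"
      then obtain j x s where j: "j \<in> Idx U 0" "x \<in> ob U j" "s \<in> carrier S" "z = h j (x, s)" unfolding pts by blast
      then have x: "x \<in> ob U i" using z hX(1)[OF j(1-3)] by simp
      then show "z \<in> h i ` (ob U i \<times> carrier S)"
        using h_trans[OF i j(1) x j(2,3)] j(4) m_closed[OF fx[OF i j(1) x j(2)] j(3)] by blast
    qed
    fix x s assume x: "x \<in> ob U i" and s: "s \<in> carrier S"
    have xo: "x \<in> objects G" by (rule obD[OF x])
    note hx = hX[OF i x s] and fi = fix1[OF i x]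
    show "anchor Z (h i (x, s)) = x" using hx by simp
    have ib: "ibar U 0 i \<in> Idx U 0" "\<rho> x \<in> ob U (ibar U 0 i)"
      "ibar U 0 (ix x) \<in> Idx U 0" "\<rho> x \<in> ob U (ibar U 0 (ix x))"
      using i x xo ix[OF xo] by (simp_all add: ibar_in[OF U] ob_ibar[OF U])
    have "tau Z (h i (x, s)) = h (ibar U 0 (ix x)) (\<rho> x, bar S (f (ix x) i (unt G x)) \<otimes> bar S s)"
      using hx fi s by (simp add: Z_def)
    \<comment> \<open>Reality of the cocycle at a unit. The conjugate of the index chosen for x need
      not be the index chosen for \<rho> x, so the result is brought to the chart
      \<open>ibar U 0 i\<close> by \<open>h_trans\<close>.\<close>
    also have "bar S (f (ix x) i (unt G x)) = f (ibar U 0 (ix x)) (ibar U 0 i) (unt G (\<rho> x))"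
      using cocycle_on_rho[OF f ix(1)[OF xo] i unt_over[OF ix(2)[OF xo] x]] xo by simp
    also have "h (ibar U 0 (ix x)) (\<rho> x, f (ibar U 0 (ix x)) (ibar U 0 i) (unt G (\<rho> x)) \<otimes> bar S s) =
        h (ibar U 0 i) (\<rho> x, bar S s)"
      by (rule h_trans[OF ib(3,1,4,2) bar_in[OF s], symmetric])
    finally show "tau Z (h i (x, s)) = h (ibar U 0 i) (\<rho> x, bar S s)" .
    fix t assume t: "t \<in> carrier S"
    show "ract Z (h i (x, s)) t = h i (x, s \<otimes> t)"
      using hx fi s t by (simp add: Z_def h_def m_assoc)
    show "h i (x, s) = h i (x, t) \<Longrightarrow> s = t" by (rule h_inj[OF i x s t])
  qed
  moreover have "transition U Z h f"
    unfolding transition_def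
  proof (intro ballI)
    fix i j g t assume *: "i \<in> Idx U 0" "j \<in> Idx U 0" "g \<in> over U i j" "t \<in> carrier S"
    note o = overD[OF *(3)]
    let ?a = "ix (rng G g)" and ?b = "ix (src G g)"
    have a: "?a \<in> Idx U 0" "rng G g \<in> ob U ?a" "?b \<in> Idx U 0" "src G g \<in> ob U ?b" using ix o(1) by auto
    have ov: "g \<in> over U ?a ?b" "g \<in> over U ?a j" using a o by auto
    \<comment> \<open>Writing g as a product with the unit at its source, and then with the unit at
      its range, exchanges the chosen indices \<open>?b\<close> and \<open>?a\<close> for j and
      i.\<close>
    have "lact Z g (h j (src G g, t)) = h ?a (rng G g, f ?a ?b g \<otimes> (f ?b j (unt G (src G g)) \<otimes> t))"
      using hX[OF *(2) o(3) *(4)] by (simp add: Z_def)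
    also have "f ?a ?b g \<otimes> (f ?b j (unt G (src G g)) \<otimes> t) = f ?a j g \<otimes> t"
      using cocycle_on_mul[OF f a(1,3) ov(1) *(2) unt_over[OF a(4) o(3)]] o(1) *(4)
        fin[OF a(1,3) ov(1)] fx[OF a(3) *(2) a(4) o(3)] by (simp add: m_assoc)
    also have "f ?a j g = f ?a i (unt G (rng G g)) \<otimes> f i j g"
      using cocycle_on_mul[OF f a(1) *(1) unt_over[OF a(2) o(2)] *(2,3)] o(1) by simp
    also have "h ?a (rng G g, f ?a i (unt G (rng G g)) \<otimes> f i j g \<otimes> t) = h i (rng G g, f i j g \<otimes> t)"
      using h_trans[OF a(1) *(1) a(2) o(2) m_closed[OF fin[OF *(1-3)] *(4)]]
        fx[OF a(1) *(1) a(2) o(2)] fin[OF *(1-3)] *(4) by (simp add: m_assoc)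
    finally show "lact Z g (h j (src G g, t)) = h i (rng G g, f i j g \<otimes> t)" .
  qed
  ultimately show ?thesis using c unfolding represents_def f_def by blast
qed

section \<open>The cocycle of an atlas\<close>

text \<open>The arrow g carries the point \<open>h j (src G g, \<one>)\<close> to a point over its
  range, and f_ij(g) is the coordinate of that point in chart i. Commutation of the two actions
  extends the formula to all t; injectivity of the charts turns associativity of the action into the
  cocycle identity and compatibility with \<open>tau\<close> into Reality.\<close>

lemma atlas_represents:
  assumes U: "real_open_cover G U" and Z: "real_gen_hom G S Z" and h: "atlas U Z h"
  shows "\<exists>c. represents Z U c"
proof -
  interpret Z: real_gen_hom G S Z by (rule Z)
  define f where "f i j g = coord U h i (lact Z g (h j (src G g, \<one>)))" for i j g
  have lin: "lact Z g z \<in> points Z" if "g \<in> arrows G" "z \<in> points Z" "src G g = anchor Z z" for g z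
  proof -
    have "(\<lambda>(g, z). lact Z g z) (g, z) \<in> points Z"
      by (rule funcset_mem[OF continuous_map_funspace[OF Z.lact_continuous]]) (use that in simp)
    then show ?thesis by simp
  qed
  have z: "h j (src G g, t) \<in> points Z" "anchor Z (h j (src G g, t)) = src G g"
    if "j \<in> Idx U 0" "g \<in> over U i j" "t \<in> carrier S" for i j g t
    using atlas_in[OF h that(1) overD(3)[OF that(2)] that(3)] atlas_anchor[OF h that(1) overD(3)[OF that(2)] that(3)] .
  have f: "f i j g \<in> carrier S" "h i (rng G g, f i j g) = lact Z g (h j (src G g, \<one>))"
    if "i \<in> Idx U 0" "j \<in> Idx U 0" "g \<in> over U i j" for i j g
  proof -
    note o = overD[OF that(3)] and zz = z[OF that(2,3) one_closed]
    have "lact Z g (h j (src G g, \<one>)) \<in> points Z" "anchor Z (lact Z g (h j (src G g, \<one>))) = rng G g"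
      using lin[OF o(1) zz(1)] Z.anchor_lact[OF o(1) zz(1)] zz(2) by simp_all
    then show "f i j g \<in> carrier S" "h i (rng G g, f i j g) = lact Z g (h j (src G g, \<one>))"
      using coord_in[OF h that(1)] o(2) unfolding f_def by metis+
  qed
  have T: "lact Z g (h j (src G g, t)) = h i (rng G g, f i j g \<otimes> t)"
    if "i \<in> Idx U 0" "j \<in> Idx U 0" "g \<in> over U i j" "t \<in> carrier S" for i j g t
  proof -
    note o = overD[OF that(3)] and zz = z[OF that(2,3) one_closed]
    have "lact Z g (h j (src G g, t)) = lact Z g (ract Z (h j (src G g, \<one>)) t)"
      using atlas_ract[OF h that(2) o(3) one_closed that(4)] that(4) by simp
    also have "\<dots> = ract Z (lact Z g (h j (src G g, \<one>))) t"
      by (rule Z.lact_ract[OF o(1) zz(1) that(4)]) (simp add: zz(2))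
    also have "\<dots> = h i (rng G g, f i j g \<otimes> t)"
      using atlas_ract[OF h that(1) o(2) f(1)[OF that(1-3)] that(4)] f(2)[OF that(1-3)] by simp
    finally show ?thesis .
  qed
  have fc: "cocycle_on U f"
    unfolding cocycle_on_def
  proof (intro ballI conjI impI)
    fix i j assume ij: "i \<in> Idx U 0" "j \<in> Idx U 0"
    let ?O = "subtopology (Arr G) (over U i j)" and ?V = "{z \<in> points Z. anchor Z z \<in> ob U i}"
    let ?X = "subtopology (prod_topology (Arr G) (Top Z)) {(g, z). src G g = anchor Z z}"
    have id: "continuous_map ?O (Arr G) (\<lambda>g. g)" by (simp add: continuous_map_from_subtopology)
    have "continuous_map ?O (chart_space U j) (\<lambda>g. (src G g, \<one>))"
      by (intro continuous_map_into_chart_space continuous_map_from_subtopology[OF src_continuous])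
        (auto simp: topspace_top_of over_def)
    from continuous_map_compose[OF this atlas_continuous[OF h ij(2)]]
    have "continuous_map ?O ?X (\<lambda>g. (g, h j (src G g, \<one>)))"
      unfolding continuous_map_in_subtopology using id z[OF ij(2) _ one_closed]
      by (auto simp: comp_def intro!: continuous_map_pairedI)
    from continuous_map_compose[OF this Z.lact_continuous]
    have "continuous_map ?O (Top Z) (\<lambda>g. lact Z g (h j (src G g, \<one>)))" by (simp add: comp_def)
    moreover have "lact Z g (h j (src G g, \<one>)) \<in> ?V" if "g \<in> over U i j" for g
      using f(2)[OF ij that, symmetric] atlas_in[OF h ij(1) overD(2)[OF that] f(1)[OF ij that]]
        atlas_anchor[OF h ij(1) overD(2)[OF that] f(1)[OF ij that]] overD(2)[OF that] by simp
    ultimately have "continuous_map ?O (subtopology (Top Z) ?V) (\<lambda>g. lact Z g (h j (src G g, \<one>)))"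
      unfolding continuous_map_in_subtopology by auto
    from continuous_map_compose[OF this coord_continuous'(1)[OF h ij(1)]]
    show "continuous_map ?O (top_of S) (f i j)" by (simp add: f_def[abs_def] comp_def)
    fix g assume g: "g \<in> over U i j"
    note o = overD[OF g] and zz = z[OF ij(2) g one_closed]
    note ib = ibar_in[OF U ij(1)] ibar_in[OF U ij(2)] over_ibar[OF U ij g]
    have rx: "rng G (rho G g) \<in> ob U (ibar U 0 i)" by (rule overD(2)[OF ib(3)])
    have "h (ibar U 0 i) (rng G (rho G g), f (ibar U 0 i) (ibar U 0 j) (rho G g)) =
        lact Z (rho G g) (h (ibar U 0 j) (src G (rho G g), \<one>))"
      by (rule f(2)[OF ib])
    also have "h (ibar U 0 j) (src G (rho G g), \<one>) = tau Z (h j (src G g, \<one>))"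
      using atlas_tau[OF h ij(2) o(3) one_closed] o(1) by simp
    also have "lact Z (rho G g) (tau Z (h j (src G g, \<one>))) = tau Z (lact Z g (h j (src G g, \<one>)))"
      by (rule Z.tau_lact[OF o(1) zz(1), symmetric]) (simp add: zz(2))
    also have "\<dots> = h (ibar U 0 i) (rng G (rho G g), bar S (f i j g))"
      using atlas_tau[OF h ij(1) o(2) f(1)[OF ij g]] f(2)[OF ij g] o(1) by simp
    finally show "f (ibar U 0 i) (ibar U 0 j) (rho G g) = bar S (f i j g)"
      by (rule atlas_inj[OF h ib(1) rx f(1)[OF ib] bar_in[OF f(1)[OF ij g]]])
    fix k g' assume k: "k \<in> Idx U 0" and g': "g' \<in> over U j k" "src G g = rng G g'"
    note o' = overD[OF g'(1)] and zk = z[OF k g'(1) one_closed]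
    have m: "mul G g g' \<in> over U i k" by (rule mul_over[OF g g'(1,2)])
    have "h i (rng G g, f i k (mul G g g')) = lact Z (mul G g g') (h k (src G g', \<one>))"
      using f(2)[OF ij(1) k m] o(1) o'(1) g'(2) by simp
    also have "\<dots> = lact Z g (lact Z g' (h k (src G g', \<one>)))"
      by (rule Z.lact_mul[OF o(1) o'(1) zk(1) g'(2)]) (simp add: zk(2))
    also have "\<dots> = lact Z g (h j (src G g, f j k g'))"
      using f(2)[OF ij(2) k g'(1)] g'(2) by simp
    also have "\<dots> = h i (rng G g, f i j g \<otimes> f j k g')"
      by (rule T[OF ij g f(1)[OF ij(2) k g'(1)]])
    finally show "f i k (mul G g g') = f i j g \<otimes> f j k g'"
      by (rule atlas_inj[OF h ij(1) o(2) f(1)[OF ij(1) k m] m_closed[OF f(1)[OF ij g] f(1)[OF ij(2) k g'(1)]]])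
  qed
  moreover have "transition U Z h (val U (mk U f))"
    unfolding transition_def using T val_mk[OF U fc] by simp
  ultimately show ?thesis unfolding represents_def using mk_cocycle[OF U fc] h by blast
qed

end

section \<open>Covers\<close>

text \<open>An infinite set is equipotent to its square. The pairing encodes tuples, pairs and
  labelled objects as single indices of type \<open>'j\<close>.\<close>

lemma exists_pairing:
  assumes "infinite (UNIV :: 'j set)"
  obtains pr :: "'j \<times> 'j \<Rightarrow> 'j" where "inj pr"
proof -
  have "\<exists>f. bij_betw f ((UNIV :: 'j set) \<times> (UNIV :: 'j set)) (UNIV :: 'j set)"
    by (rule iffD2[OF card_of_ordIso card_of_Times_same_infinite[OF assms]])
  then show ?thesis using that by (auto simp: bij_betw_def)
qed

text \<open>
  Indices in degree \<open>n\<close> are tuples of \<open>n + 1\<close> indices in degree \<open>0\<close>. Their encoding is injective only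
  on tuples of equal length, which suffices because the index sets of different degrees are unrelated.
\<close>

fun enc :: "('j \<times> 'j \<Rightarrow> 'j) \<Rightarrow> 'j list \<Rightarrow> 'j" where
  "enc pr [] = undefined"
| "enc pr [x] = x"
| "enc pr (x # y # ys) = pr (x, enc pr (y # ys))"

lemma enc_inj:
  assumes "inj pr" "length xs = length ys" "enc pr xs = enc pr ys"
  shows "xs = ys"
  using assms(2,3)
proof (induction xs ys rule: list_induct2)
  case (Cons x xs y ys)
  note IH = Cons.IH
  show ?case
  proof (cases xs)
    case Nil
    then show ?thesis using Cons by simp
  next
    case (Cons a as)
    then obtain c cs where c: "ys = c # cs" using \<open>length xs = length ys\<close> by (cases ys) auto
    have "pr (x, enc pr xs) = pr (y, enc pr ys)"
      using \<open>enc pr (x # xs) = enc pr (y # ys)\<close> Cons c by simp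
    then have "x = y" "enc pr xs = enc pr ys" using injD[OF assms(1)] by auto
    then show ?thesis using IH by simp
  qed
qed simp

context real_groupoid_with_coefficients
begin

text \<open>A tuple w of n + 1 indices receives the simplices whose k-th vertex lies in
  \<open>A (w ! k)\<close>. Tuples carry simplicial operations by reindexing, the involution acts
  entrywise, and in degree 0 the given cover is recovered.\<close>

lemma exists_cover:
  fixes J :: "'j set"
  assumes inf: "infinite (UNIV :: 'j set)"
    and A: "\<And>i. i \<in> J \<Longrightarrow> openin (Obj G) (A i)" "objects G = (\<Union>i\<in>J. A i)"
    and b: "\<And>i. i \<in> J \<Longrightarrow> b i \<in> J \<and> b (b i) = i"
    and Ob: "\<And>i x. i \<in> J \<Longrightarrow> x \<in> A i \<Longrightarrow> \<rho> x \<in> A (b i)"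
  shows "\<exists>U :: ('g, 'j) cover_data. U \<in> admissible_covers n G \<and> Idx U 0 = J \<and>
    (\<forall>i\<in>J. ibar U 0 i = b i \<and> ob U i = A i)"
proof -
  obtain pr :: "'j \<times> 'j \<Rightarrow> 'j" where pr: "inj pr" using exists_pairing[OF inf] by blast
  define W where "W n = {w. length w = Suc n \<and> set w \<subseteq> J}" for n
  define dec where "dec n = inv_into (W n) (enc pr)" for n
  have dec [simp]: "dec n (enc pr w) = w" if "w \<in> W n" for n w
  proof -
    have "inj_on (enc pr) (W n)" using enc_inj[OF pr] by (auto simp: inj_on_def W_def)
    then show ?thesis unfolding dec_def by (rule inv_into_f_f[OF _ that])
  qed
  have Wnth: "w ! k \<in> J" if "w \<in> W n" "k \<le> n" for w n k
    using that nth_mem[of k w] by (auto simp: W_def)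
  have Wmap: "map b w \<in> W n" if "w \<in> W n" for w n using that b by (auto simp: W_def)
  have Wpull: "map (\<lambda>i. w ! i) f \<in> W m" if "w \<in> W p" "f \<in> Hom_Delta m p" for w f m p
    using that Wnth[OF that(1)] by (auto simp: W_def Hom_Delta_def)
  have bb: "map b (map b w) = w" if "w \<in> W n" for w n
    using that b by (auto simp: W_def intro!: map_idI)
  define K where "K n w = {\<gamma> \<in> topspace (nerve G n). \<forall>k\<le>n. rng G (\<gamma> (k, k)) \<in> A (w ! k)}" for n w
  define U where "U = \<lparr>Idx = \<lambda>n. enc pr ` W n, ibar = \<lambda>n j. enc pr (map b (dec n j)),
    Opn = \<lambda>n j. K n (dec n j)\<rparr>"
  have Us: "Idx U n = enc pr ` W n" "ibar U n j = enc pr (map b (dec n j))" "Opn U n j = K n (dec n j)" for n j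
    by (simp_all add: U_def)
  have Oin: "x \<in> objects G" if "i \<in> J" "x \<in> A i" for i x using A that by blast
  have Kopen: "openin (nerve G n) (K n w)" if w: "w \<in> W n" for n w
  proof -
    have "openin (nerve G n) {\<gamma> \<in> topspace (nerve G n). rng G (\<gamma> (k, k)) \<in> A (w ! k)}" if "k \<le> n" for k
    proof -
      have "continuous_map (nerve G n) (Obj G) (\<lambda>\<gamma>. rng G (\<gamma> (k, k)))"
        using continuous_map_compose[OF nerve_apply_continuous[OF that that] rng_continuous] by (simp add: comp_def)
      then show ?thesis using A(1)[OF Wnth[OF w that]] by (rule openin_continuous_map_preimage)
    qed
    then have "openin (nerve G n) (\<Inter>k\<in>{..n}. {\<gamma> \<in> topspace (nerve G n). rng G (\<gamma> (k, k)) \<in> A (w ! k)})"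
      by (intro openin_INT2) auto
    then show ?thesis by (rule back_subst[of "openin (nerve G n)"]) (auto simp: K_def)
  qed
  have Kcover: "\<exists>w\<in>W n. \<gamma> \<in> K n w" if \<gamma>: "\<gamma> \<in> topspace (nerve G n)" for n \<gamma>
  proof -
    have "\<exists>i\<in>J. rng G (\<gamma> (k, k)) \<in> A i" if "k \<le> n" for k
      using rng_in[OF nerve_in[OF \<gamma> that that]] A(2) by blast
    then obtain i where i: "\<And>k. k \<le> n \<Longrightarrow> i k \<in> J \<and> rng G (\<gamma> (k, k)) \<in> A (i k)" by metis
    show ?thesis
    proof (rule bexI)
      show "map i [0..<Suc n] \<in> W n" using i by (auto simp: W_def)
      show "\<gamma> \<in> K n (map i [0..<Suc n])" using i \<gamma> by (auto simp: K_def simp del: upt_Suc)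
    qed
  qed
  have Krho: "nerve_rho G n \<gamma> \<in> K n (map b w)" if "w \<in> W n" "\<gamma> \<in> K n w" for n w \<gamma>
  proof -
    have "\<gamma> \<in> topspace (nerve G n)" using that by (simp add: K_def)
    moreover have "rng G (nerve_rho G n \<gamma> (k, k)) \<in> A (map b w ! k)" if "k \<le> n" for k
      using Ob[OF Wnth[OF \<open>w \<in> W n\<close> that]] \<open>\<gamma> \<in> K n w\<close> \<open>w \<in> W n\<close> that nerve_in[of \<gamma> n k k]
      by (auto simp: K_def nerve_rho_def W_def)
    ultimately show ?thesis using nerve_rho_in by (simp add: K_def)
  qed
  have Krho_eq: "K n (map b w) = nerve_rho G n ` K n w" if w: "w \<in> W n" for n w
  proof (intro subset_antisym subsetI)
    fix \<gamma> assume \<gamma>: "\<gamma> \<in> K n (map b w)"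
    then have 1: "nerve_rho G n \<gamma> \<in> K n w" using Krho[OF Wmap[OF w] \<gamma>] bb[OF w] by simp
    have "nerve_rho G n (nerve_rho G n \<gamma>) \<in> nerve_rho G n ` K n w" using 1 by (rule imageI)
    moreover have "nerve_rho G n (nerve_rho G n \<gamma>) = \<gamma>" using nerve_rho_nerve_rho \<gamma> by (simp add: K_def)
    ultimately show "\<gamma> \<in> nerve_rho G n ` K n w" by simp
  qed (use Krho[OF w] in auto)
  have "real_open_cover G U"
    unfolding real_open_cover_def
  proof (intro allI conjI ballI)
    fix n
    show "topspace (nerve G n) = (\<Union>j\<in>Idx U n. Opn U n j)"
      using Kcover openin_subset[OF Kopen] by (fastforce simp: Us)
    fix j assume "j \<in> Idx U n"
    then obtain w where w: "w \<in> W n" "j = enc pr w" by (auto simp: Us)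
    show "openin (nerve G n) (Opn U n j)" using Kopen w by (simp add: Us)
    show "ibar U n j \<in> Idx U n" using Wmap[OF w(1)] by (simp add: Us w)
    show "ibar U n (ibar U n j) = j" using w Wmap[OF w(1)] bb[OF w(1)] by (simp add: Us del: map_map)
    show "Opn U n (ibar U n j) = nerve_rho G n ` Opn U n j"
      using Krho_eq[OF w(1)] Wmap[OF w(1)] w by (simp add: Us)
  qed
  \<comment> \<open>A map f from [m] to [p] acts on a tuple, viewed as a function on [p], by
    composition with f.\<close>
  moreover define \<sigma> where "\<sigma> p f j = enc pr (map (\<lambda>i. dec p j ! i) f)" for p f j
  have "truncated_simplicial (n + 1) U \<sigma>"
    unfolding truncated_simplicial_def
  proof (intro conjI allI impI ballI)
    fix p j assume "j \<in> Idx U p"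
    then obtain w where w: "w \<in> W p" "j = enc pr w" by (auto simp: Us)
    have "map (\<lambda>i. w ! i) (id_map p) = w"
      using w(1) map_nth[of w] by (simp add: W_def id_map_def del: upt_Suc)
    then show "\<sigma> p (id_map p) j = j" using w by (simp add: \<sigma>_def)
  next
    fix m p f j assume f: "f \<in> Hom_Delta m p" and "j \<in> Idx U p"
    then obtain w where w: "w \<in> W p" "j = enc pr w" by (auto simp: Us)
    have fl: "length f = Suc m" "set f \<subseteq> {..p}" using f by (auto simp: Hom_Delta_def)
    have fn: "f ! k \<le> p" if "k \<le> m" for k
    proof -
      have "f ! k \<in> set f" using fl(1) that by (intro nth_mem) simp
      then show ?thesis using fl(2) by auto
    qed
    have \<sigma>j: "\<sigma> p f j = enc pr (map (\<lambda>i. w ! i) f)" using w by (simp add: \<sigma>_def)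
    have wf: "map (\<lambda>i. w ! i) f \<in> W m" using Wpull[OF w(1) f] .
    show "\<sigma> p f j \<in> Idx U m" unfolding \<sigma>j Us using wf by blast
    have "map (\<lambda>i. map b w ! i) f = map b (map (\<lambda>i. w ! i) f)"
      using w(1) fl by (auto simp: W_def)
    then show "\<sigma> p f (ibar U p j) = ibar U m (\<sigma> p f j)"
      using w Wmap[OF w(1)] wf by (simp add: \<sigma>_def Us del: map_map)
    show "pull f ` Opn U p j \<subseteq> Opn U m (\<sigma> p f j)"
    proof (rule image_subsetI)
      fix \<gamma> assume "\<gamma> \<in> Opn U p j"
      then have \<gamma>: "\<gamma> \<in> topspace (nerve G p)" "\<And>k. k \<le> p \<Longrightarrow> rng G (\<gamma> (k, k)) \<in> A (w ! k)"
        using w by (auto simp: Us K_def)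
      have "pull f \<gamma> \<in> topspace (nerve G m)" using pull_in[OF \<gamma>(1) fl(2)] fl(1) by (fastforce simp: dom_ord_def)
      then have "pull f \<gamma> \<in> K m (map (\<lambda>i. w ! i) f)"
        using \<gamma>(2)[OF fn] fl(1) by (auto simp: K_def pull_def dom_ord_def)
      then show "pull f \<gamma> \<in> Opn U m (\<sigma> p f j)" unfolding \<sigma>j Us using wf by simp
    qed
    fix l h assume h: "h \<in> Hom_Delta l m"
    have "map (\<lambda>i. w ! i) (after f h) = map (\<lambda>i. map (\<lambda>i. w ! i) f ! i) h"
      using h fl by (auto simp: after_def Hom_Delta_def less_Suc_eq_le subset_iff)
    then show "\<sigma> p (after f h) j = \<sigma> m h (\<sigma> p f j)"
      unfolding \<sigma>j using w wf by (simp add: \<sigma>_def del: map_map)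
  qed
  ultimately have adm: "U \<in> admissible_covers n G" unfolding admissible_covers_def by blast
  \<comment> \<open>A tuple of length one is encoded by its entry, so the indices in degree 0 are
    the elements of \<open>J\<close> themselves.\<close>
  have W0: "W 0 = (\<lambda>i. [i]) ` J" by (auto simp: W_def length_Suc_conv)
  have "Idx U 0 = J" by (simp add: Us W0 image_image)
  moreover have "ibar U 0 i = b i \<and> ob U i = A i" if i: "i \<in> J" for i
  proof -
    have "dec 0 i = [i]" using dec[of "[i]" 0] i W0 by simp
    then show ?thesis using Oin[OF i] by (auto simp: Us ob_def K_def vertex_apply)
  qed
  ultimately show ?thesis using adm by blast
qed

lemma nerve_rho_inj: "inj_on (nerve_rho G n) (topspace (nerve G n))"
  using nerve_rho_nerve_rho by (metis inj_onI)

text \<open>Directedness of the system of covers: members are intersected, indices are encoded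
  pairs, and the simplicial structures combine componentwise up to the smaller of the two truncation
  levels.\<close>

lemma common_refinement:
  fixes U V :: "('g, 'j) cover_data"
  assumes inf: "infinite (UNIV :: 'j set)" and U: "U \<in> admissible_covers n G" and V: "V \<in> admissible_covers n G"
  shows "\<exists>K\<in>admissible_covers n G. finer U K \<and> finer V K"
proof -
  obtain pr :: "'j \<times> 'j \<Rightarrow> 'j" where pr: "inj pr" using exists_pairing[OF inf] by blast
  define u where "u j = fst (inv_into UNIV pr j)" for j
  define v where "v j = snd (inv_into UNIV pr j)" for j
  have uv [simp]: "u (pr (i, j)) = i" "v (pr (i, j)) = j" for i j using pr by (simp_all add: u_def v_def)
  obtain N \<sigma> where Uc: "real_open_cover G U" and N: "N \<ge> n + 1" "truncated_simplicial N U \<sigma>"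
    using U by (auto simp: admissible_covers_def)
  obtain M \<tau> where Vc: "real_open_cover G V" and M: "M \<ge> n + 1" "truncated_simplicial M V \<tau>"
    using V by (auto simp: admissible_covers_def)
  define K where "K = \<lparr>Idx = \<lambda>n. pr ` (Idx U n \<times> Idx V n),
    ibar = \<lambda>n j. pr (ibar U n (u j), ibar V n (v j)), Opn = \<lambda>n j. Opn U n (u j) \<inter> Opn V n (v j)\<rparr>"
  have Ks: "Idx K n = pr ` (Idx U n \<times> Idx V n)" "ibar K n j = pr (ibar U n (u j), ibar V n (v j))"
    "Opn K n j = Opn U n (u j) \<inter> Opn V n (v j)" for n j
    by (simp_all add: K_def)
  have "real_open_cover G K"
    unfolding real_open_cover_def
  proof (intro allI conjI ballI)
    fix n
    show "topspace (nerve G n) = (\<Union>j\<in>Idx K n. Opn K n j)"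
    proof (intro subset_antisym subsetI)
      fix \<gamma> assume "\<gamma> \<in> topspace (nerve G n)"
      then obtain i j where "i \<in> Idx U n" "\<gamma> \<in> Opn U n i" "j \<in> Idx V n" "\<gamma> \<in> Opn V n j"
        using cover_exists[OF Uc] cover_exists[OF Vc] by metis
      then show "\<gamma> \<in> (\<Union>j\<in>Idx K n. Opn K n j)" by (auto simp: Ks intro!: bexI[of _ "(i, j)"])
    next
      fix \<gamma> assume "\<gamma> \<in> (\<Union>j\<in>Idx K n. Opn K n j)"
      then show "\<gamma> \<in> topspace (nerve G n)" using Opn_subset[OF Uc] by (auto simp: Ks)
    qed
    fix k assume "k \<in> Idx K n"
    then obtain i j where ij: "i \<in> Idx U n" "j \<in> Idx V n" "k = pr (i, j)" by (auto simp: Ks)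
    show "openin (nerve G n) (Opn K n k)" using Opn_open[OF Uc ij(1)] Opn_open[OF Vc ij(2)] ij(3) by (auto simp: Ks)
    show "ibar K n k \<in> Idx K n" using ibar_in[OF Uc ij(1)] ibar_in[OF Vc ij(2)] ij(3) by (auto simp: Ks)
    show "ibar K n (ibar K n k) = k" using ibar_ibar[OF Uc ij(1)] ibar_ibar[OF Vc ij(2)] ij(3) by (simp add: Ks)
    have "nerve_rho G n ` (Opn U n i \<inter> Opn V n j) = nerve_rho G n ` Opn U n i \<inter> nerve_rho G n ` Opn V n j"
      by (rule inj_on_image_Int[OF nerve_rho_inj]) (use Opn_subset[OF Uc ij(1)] Opn_subset[OF Vc ij(2)] in auto)
    then show "Opn K n (ibar K n k) = nerve_rho G n ` Opn K n k"
      using Opn_ibar[OF Uc ij(1)] Opn_ibar[OF Vc ij(2)] ij(3) by (simp add: Ks)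
  qed
  moreover have "truncated_simplicial (min N M) K (\<lambda>p f j. pr (\<sigma> p f (u j), \<tau> p f (v j)))"
    using N(2) M(2) unfolding truncated_simplicial_def Ks
    by (intro conjI allI impI ballI) (auto simp: subset_iff)
  moreover have "min N M \<ge> n + 1" using N(1) M(1) by simp
  ultimately have "K \<in> admissible_covers n G" unfolding admissible_covers_def by blast
  moreover have "refinement U K (\<lambda>_. u)" "refinement V K (\<lambda>_. v)"
    by (auto simp: refinement_def Ks)
  ultimately show ?thesis unfolding finer_def by blast
qed

text \<open>
  Each local trivialization is used together with its conjugate under \<open>\<tau>\<close>, under an index of its own.
  Swapping the two indices makes the cover Real, also around fixed points of \<open>\<rho>\<close>, where there may
  be no trivialization invariant under \<open>\<tau>\<close>.
\<close>

lemma bundle_atlas: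
  fixes \<iota> :: "'g \<Rightarrow> 'j"
  assumes Z: "real_gen_hom G S Z"
    and \<iota>: "inj_on \<iota> (arrows G)" and inf: "infinite (UNIV :: 'j set)"
  obtains U :: "('g, 'j) cover_data" and h where "U \<in> admissible_covers n G" "atlas U Z h"
proof -
  interpret Z: real_gen_hom G S Z by (rule Z)
  obtain pr :: "'j \<times> 'j \<Rightarrow> 'j" where pr: "inj pr" using exists_pairing[OF inf] by blast
  \<comment> \<open>Two labels, one for a trivialization and one for its conjugate.\<close>
  have "\<exists>a0 a1 :: 'j. a0 \<noteq> a1"
  proof (rule ccontr)
    assume "\<nexists>a0 a1 :: 'j. a0 \<noteq> a1"
    then have "(UNIV :: 'j set) \<subseteq> {undefined}" by blast
    then show False using inf finite_subset by blast
  qed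
  then obtain a0 a1 :: 'j where a: "a0 \<noteq> a1" by blast
  \<comment> \<open>The index of the trivialization around an object (\<open>True\<close>) or of its
    conjugate (\<open>False\<close>). As \<open>\<iota>\<close> encodes arrows, the object enters
    through its unit.\<close>
  define e where "e p = pr (\<iota> (unt G (fst p)), if snd p then a0 else a1)" for p :: "'x \<times> bool"
  have e: "inj_on e (objects G \<times> UNIV)"
  proof (rule inj_onI, clarify)
    fix x y :: 'x and p q :: bool assume x: "x \<in> objects G" "y \<in> objects G" and eq: "e (x, p) = e (y, q)"
    from injD[OF pr eq[unfolded e_def fst_conv snd_conv]]
    have 1: "\<iota> (unt G x) = \<iota> (unt G y)" and "(if p then a0 else a1) = (if q then a0 else a1)"
      by simp_all
    then have "p = q" using a by (simp split: if_splits)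
    moreover have "unt G x = unt G y" by (rule inj_onD[OF \<iota> 1 unt_in[OF x(1)] unt_in[OF x(2)]])
    ultimately show "x = y \<and> p = q" using x by (metis rng_unt)
  qed
  define dx where "dx j = fst (inv_into (objects G \<times> UNIV) e j)" for j
  define db where "db j = snd (inv_into (objects G \<times> UNIV) e j)" for j
  have d [simp]: "dx (e (x, p)) = x" "db (e (x, p)) = p" if "x \<in> objects G" for x p
    using inv_into_f_f[OF e, of "(x, p)"] that by (simp_all add: dx_def db_def)
  have "\<forall>x\<in>objects G. \<exists>V k. openin (Obj G) V \<and> x \<in> V \<and>
        homeomorphic_map (prod_topology (subtopology (Obj G) V) (top_of S))
          (subtopology (Top Z) {z \<in> points Z. anchor Z z \<in> V}) k \<and>
        (\<forall>y \<in> V. \<forall>s \<in> carrier S. anchor Z (k (y, s)) = y \<and>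
           (\<forall>t \<in> carrier S. k (y, s \<otimes> t) = ract Z (k (y, s)) t))"
    using Z.principal unfolding locally_trivial_principal_bundle_def .
  then obtain V where "\<forall>x\<in>objects G. \<exists>k. openin (Obj G) (V x) \<and> x \<in> V x \<and>
        homeomorphic_map (prod_topology (subtopology (Obj G) (V x)) (top_of S))
          (subtopology (Top Z) {z \<in> points Z. anchor Z z \<in> V x}) k \<and>
        (\<forall>y \<in> V x. \<forall>s \<in> carrier S. anchor Z (k (y, s)) = y \<and>
           (\<forall>t \<in> carrier S. k (y, s \<otimes> t) = ract Z (k (y, s)) t))"
    by (rule bchoice[THEN exE])
  then obtain k where "\<forall>x\<in>objects G. openin (Obj G) (V x) \<and> x \<in> V x \<and>
        homeomorphic_map (prod_topology (subtopology (Obj G) (V x)) (top_of S))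
          (subtopology (Top Z) {z \<in> points Z. anchor Z z \<in> V x}) (k x) \<and>
        (\<forall>y \<in> V x. \<forall>s \<in> carrier S. anchor Z (k x (y, s)) = y \<and>
           (\<forall>t \<in> carrier S. k x (y, s \<otimes> t) = ract Z (k x (y, s)) t))"
    by (rule bchoice[THEN exE])
  note Vk = bspec[OF this]
  have V: "openin (Obj G) (V x) \<and> x \<in> V x" if "x \<in> objects G" for x
    using Vk[OF that] by blast
  have k: "homeomorphic_map (prod_topology (subtopology (Obj G) (V x)) (top_of S))
      (subtopology (Top Z) {z \<in> points Z. anchor Z z \<in> V x}) (k x)" if "x \<in> objects G" for x
    using Vk[OF that] by blast
  have kx: "anchor Z (k x (y, s)) = y" if "x \<in> objects G" "y \<in> V x" "s \<in> carrier S" for x y s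
    using Vk[OF that(1)] that(2,3) by blast
  have kt: "k x (y, s \<otimes> t) = ract Z (k x (y, s)) t"
    if "x \<in> objects G" "y \<in> V x" "s \<in> carrier S" "t \<in> carrier S" for x y s t
    using Vk[OF that(1)] that(2-4) by blast
  have Vo: "y \<in> objects G" if "x \<in> objects G" "y \<in> V x" for x y
    using V[OF that(1)] that(2) openin_subset by blast
  let ?J = "e ` (objects G \<times> UNIV)"
  define B where "B j = (if db j then V (dx j) else {y \<in> objects G. \<rho> y \<in> V (dx j)})" for j
  define b where "b j = e (dx j, \<not> db j)" for j
  have Be: "B (e (x, True)) = V x" "B (e (x, False)) = {y \<in> objects G. \<rho> y \<in> V x}" if "x \<in> objects G" for x
    using that by (simp_all add: B_def)
  have be: "b (e (x, p)) = e (x, \<not> p)" if "x \<in> objects G" for x p using that by (simp add: b_def)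
  have "\<exists>U :: ('g, 'j) cover_data. U \<in> admissible_covers n G \<and> Idx U 0 = ?J \<and>
    (\<forall>i\<in>?J. ibar U 0 i = b i \<and> ob U i = B i)"
  proof (rule exists_cover[OF inf])
    fix i assume "i \<in> ?J"
    then obtain x p where x: "x \<in> objects G" "i = e (x, p)" by auto
    show "openin (Obj G) (B i)"
      using V[OF x(1)] openin_continuous_map_preimage[OF rho_obj_continuous, of "V x"] x
      by (cases p) (simp_all add: Be)
    show "b i \<in> ?J \<and> b (b i) = i" using x by (auto simp: be)
    show "\<rho> y \<in> B (b i)" if "y \<in> B i" for y
      using that x Vo[OF x(1)] by (cases p) (auto simp: Be be)
  next
    have "B (e (x, p)) \<subseteq> objects G" if "x \<in> objects G" for x p
      using Vo[OF that] that by (cases p) (auto simp: Be)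
    moreover have "x \<in> B (e (x, True))" if "x \<in> objects G" for x using V that by (simp add: Be)
    ultimately show "objects G = (\<Union>i\<in>?J. B i)" by blast
  qed
  then obtain U :: "('g, 'j) cover_data" where U: "U \<in> admissible_covers n G" and J: "Idx U 0 = ?J"
    and Ue: "\<And>i. i \<in> ?J \<Longrightarrow> ibar U 0 i = b i \<and> ob U i = B i" by blast
  have Uc: "real_open_cover G U" using U by (simp add: admissible_covers_def)
  let ?fl = "\<lambda>p. (\<rho> (fst p), bar S (snd p))"
  \<comment> \<open>The conjugate of the trivialization \<open>k x\<close> is obtained by applying
    \<rho> and \<open>bar\<close> to the coordinates, then \<open>k x\<close>, then
    \<open>tau\<close>; it lives over the preimage of \<open>V x\<close> under \<rho>.\<close>
  define h where "h j p = (if db j then k (dx j) p else tau Z (k (dx j) (?fl p)))" for j p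
  have tau_hom: "homeomorphic_map (Top Z) (Top Z) (tau Z)"
    using Z.real_space_Top homeomorphic_maps_map unfolding real_space_def by blast
  have tau_tau: "tau Z (tau Z z) = z" if "z \<in> points Z" for z
    using Z.real_space_Top that by (simp add: real_space_def homeomorphic_maps_def)
  have anchor_in: "anchor Z z \<in> objects G" if "z \<in> points Z" for z
    using Z.anchor_continuous that by (auto simp: continuous_map_def)
  have tau_in: "tau Z z \<in> points Z" if "z \<in> points Z" for z
    using homeomorphic_imp_surjective_map[OF tau_hom] that by blast
  have obT: "ob U (e (x, True)) = V x" and obF: "ob U (e (x, False)) = {y \<in> objects G. \<rho> y \<in> V x}"
    if "x \<in> objects G" for x using Ue that Be by auto
  have kh: "homeomorphic_map (chart_space U (e (x, True))) (subtopology (Top Z) {z \<in> points Z. anchor Z z \<in> V x}) (k x)"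
    if x: "x \<in> objects G" for x
    using k[OF x] unfolding obT[OF x, symmetric] chart_space_eq .
  have kim: "k x ` (V x \<times> carrier S) = {z \<in> points Z. anchor Z z \<in> V x}" if x: "x \<in> objects G" for x
    using homeomorphic_imp_surjective_map[OF kh[OF x]] obT[OF x] by auto
  have kin: "k x (y, s) \<in> points Z" if "x \<in> objects G" "y \<in> V x" "s \<in> carrier S" for x y s
    using kim[OF that(1)] that(2,3) by blast
  have kinj: "s = t" if "x \<in> objects G" "y \<in> V x" "s \<in> carrier S" "t \<in> carrier S" "k x (y, s) = k x (y, t)" for x y s t
    using inj_onD[OF homeomorphic_imp_injective_map[OF kh[OF that(1)]] that(5)] that obT[OF that(1)] by simp
  have kc: "continuous_map (chart_space U (e (x, True))) (Top Z) (k x)" if x: "x \<in> objects G" for x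
    using homeomorphic_imp_continuous_map[OF kh[OF x]] by (simp add: continuous_map_in_subtopology)
  have ko: "open_map (chart_space U (e (x, True))) (Top Z) (k x)" if x: "x \<in> objects G" for x
  proof -
    have "openin (Top Z) {z \<in> points Z. anchor Z z \<in> V x}"
      using openin_continuous_map_preimage[OF Z.anchor_continuous] V[OF x] by blast
    then show ?thesis
      using homeomorphic_imp_open_map[OF kh[OF x]] by (auto simp: open_map_def openin_open_subtopology)
  qed
  have fl: "homeomorphic_map (chart_space U (e (x, False))) (chart_space U (e (x, True))) ?fl" if x: "x \<in> objects G" for x
  proof -
    have c: "continuous_map (chart_space U i) (chart_space U j) ?fl" if "\<And>y. y \<in> ob U i \<Longrightarrow> \<rho> y \<in> ob U j" for i j
      using continuous_map_compose[OF continuous_map_chart_fst' rho_obj_continuous] that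
      by (intro continuous_map_into_chart_space continuous_map_bar continuous_map_chart_snd) (auto simp: comp_def)
    have "homeomorphic_maps (chart_space U (e (x, False))) (chart_space U (e (x, True))) ?fl ?fl"
      unfolding homeomorphic_maps_def using Vo[OF x]
      by (auto intro!: c simp: obT[OF x] obF[OF x])
    then show ?thesis using homeomorphic_maps_map by blast
  qed
  have hT: "h (e (x, True)) = k x" and hF: "h (e (x, False)) = tau Z \<circ> (k x \<circ> ?fl)" if "x \<in> objects G" for x
    using that by (auto simp: h_def fun_eq_iff)
  have "atlas U Z h"
    unfolding atlas_def
  proof (intro conjI ballI impI)
    show "anchor Z \<in> points Z \<rightarrow> objects G" using anchor_in by blast
    fix i assume "i \<in> Idx U 0"
    then obtain x p where x: "x \<in> objects G" "i = e (x, p)" using J by auto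
    have ib: "ibar U 0 i = e (x, \<not> p)" using Ue[of i] x be by auto
    show "continuous_map (chart_space U i) (Top Z) (h i)"
    proof (cases p)
      case False
      then show ?thesis
        using x continuous_map_compose[OF continuous_map_compose[OF homeomorphic_imp_continuous_map[OF fl[OF x(1)]] kc[OF x(1)]]
            homeomorphic_imp_continuous_map[OF tau_hom]] hF[OF x(1)] by simp
    qed (use x kc hT in simp)
    show "open_map (chart_space U i) (Top Z) (h i)"
    proof (cases p)
      case False
      then show ?thesis
        using x open_map_compose[OF open_map_compose[OF homeomorphic_imp_open_map[OF fl[OF x(1)]] ko[OF x(1)]]
            homeomorphic_imp_open_map[OF tau_hom]] hF[OF x(1)] by simp
    qed (use x ko hT in simp)
    show "h i ` (ob U i \<times> carrier S) = {z \<in> points Z. anchor Z z \<in> ob U i}"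
    proof (cases p)
      case True
      then show ?thesis using kim[OF x(1)] x by (simp add: hT obT)
    next
      case False
      have im: "?fl ` (ob U i \<times> carrier S) = V x \<times> carrier S"
        using homeomorphic_imp_surjective_map[OF fl[OF x(1)]] x False obT[OF x(1)] by simp
      have "h i ` (ob U i \<times> carrier S) = tau Z ` k x ` ?fl ` (ob U i \<times> carrier S)"
        using x False hF[OF x(1)] by (simp add: image_image)
      also have "\<dots> = tau Z ` {z \<in> points Z. anchor Z z \<in> V x}" unfolding im kim[OF x(1)] ..
      also have "\<dots> = {z \<in> points Z. anchor Z z \<in> ob U i}"
      proof (intro subset_antisym subsetI)
        fix z assume "z \<in> tau Z ` {z \<in> points Z. anchor Z z \<in> V x}"
        then show "z \<in> {z \<in> points Z. anchor Z z \<in> ob U i}"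
          using tau_in Z.anchor_tau anchor_in x False obF[OF x(1)] by auto
      next
        fix z assume z: "z \<in> {z \<in> points Z. anchor Z z \<in> ob U i}"
        then have "z \<in> points Z" "\<rho> (anchor Z z) \<in> V x" using x False obF[OF x(1)] by auto
        then show "z \<in> tau Z ` {z \<in> points Z. anchor Z z \<in> V x}"
          using tau_tau[of z] tau_in[of z] Z.anchor_tau[of z] by (intro image_eqI[of _ _ "tau Z z"]) auto
      qed
      finally show ?thesis .
    qed
    fix y s assume y: "y \<in> ob U i" and s: "s \<in> carrier S"
    have yo: "y \<in> objects G" using obD[OF y] .
    note bs = bar_in[OF s]
    have yV: "p \<Longrightarrow> y \<in> V x" "\<not> p \<Longrightarrow> \<rho> y \<in> V x" using y x obT[OF x(1)] obF[OF x(1)] by auto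
    show "anchor Z (h i (y, s)) = y"
      using x(2) yV kx[OF x(1)] kin[OF x(1)] s bs Z.anchor_tau hT[OF x(1)] hF[OF x(1)] yo by (cases p) simp_all
    show "tau Z (h i (y, s)) = h (ibar U 0 i) (\<rho> y, bar S s)"
      using x(2) yV kin[OF x(1)] s bs yo hT[OF x(1)] hF[OF x(1)] tau_tau unfolding ib by (cases p) simp_all
    fix t assume t: "t \<in> carrier S"
    note bt = bar_in[OF t]
    show "ract Z (h i (y, s)) t = h i (y, s \<otimes> t)"
    proof (cases p)
      case False
      have "ract Z (tau Z (k x (\<rho> y, bar S s))) (bar S (bar S t)) = tau Z (ract Z (k x (\<rho> y, bar S s)) (bar S t))"
        by (rule Z.tau_ract[OF kin[OF x(1) yV(2)[OF False] bs] bt, symmetric])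
      also have "\<dots> = tau Z (k x (\<rho> y, bar S s \<otimes> bar S t))" by (simp only: kt[OF x(1) yV(2)[OF False] bs bt])
      finally show ?thesis using x False hF[OF x(1)] s t by simp
    qed (use kt[OF x(1) yV(1) s t] x hT[OF x(1)] in simp)
    assume eq: "h i (y, s) = h i (y, t)"
    show "s = t"
    proof (cases p)
      case False
      then have "tau Z (k x (\<rho> y, bar S s)) = tau Z (k x (\<rho> y, bar S t))" using eq x hF[OF x(1)] by simp
      then have "k x (\<rho> y, bar S s) = k x (\<rho> y, bar S t)"
        using tau_tau kin[OF x(1) yV(2)[OF False]] bs bt by metis
      then have "bar S s = bar S t" using kinj[OF x(1) yV(2)[OF False] bs bt] by blast
      then show ?thesis using s t by (metis bar_bar)
    qed (use kinj[OF x(1) yV(1) s t] eq x hT[OF x(1)] in simp)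
  qed
  then show ?thesis using that U by blast
qed

lemma exists_cocycle:
  fixes \<iota> :: "'g \<Rightarrow> 'j"
  assumes "real_gen_hom G S Z" "inj_on \<iota> (arrows G)" "infinite (UNIV :: 'j set)"
  obtains U :: "('g, 'j) cover_data" and c where "U \<in> admissible_covers n G" "represents Z U c"
proof -
  obtain U :: "('g, 'j) cover_data" and h where U: "U \<in> admissible_covers n G" "atlas U Z h"
    using bundle_atlas[OF assms] by blast
  then have "real_open_cover G U" by (simp add: admissible_covers_def)
  then show ?thesis using that atlas_represents[OF _ assms(1) U(2)] U(1) by blast
qed

end

section \<open>Comparison of the two groups\<close>

context real_groupoid_with_coefficients
begin

text \<open>By \<open>represents_cohomologous\<close> this set is empty or a whole coset of the
  coboundaries, in which case it is itself the element of \<open>HR 1 G S U\<close> attached to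
  \<open>Z\<close>.\<close>

definition cocycles_of :: "('x, 'g, 's, 'w) gen_hom_data \<Rightarrow> ('g, 'j) cover_data \<Rightarrow> ('g, 's, 'j) cochain set" where
  "cocycles_of Z U = {c. represents Z U c}"

context
  fixes \<iota> :: "'g \<Rightarrow> 'j" and \<kappa> :: "'x \<times> 's \<Rightarrow> 'z"
  assumes inf: "infinite (UNIV :: 'j set)" and \<iota>: "inj_on \<iota> (arrows G)"
    and \<kappa>: "inj_on \<kappa> (objects G \<times> carrier S)"
begin

abbreviation adm :: "('g, 'j) cover_data set" where
  "adm \<equiv> admissible_covers 1 G"

lemma adm_cover: "U \<in> adm \<Longrightarrow> real_open_cover G U"
  by (simp add: admissible_covers_def)

lemma cocycles_of_coset:
  assumes "U \<in> adm" "c \<in> cocycles_of Z U"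
  shows "coboundaries 1 G S U #>\<^bsub>Z1 U\<^esub> c = cocycles_of Z U" "c \<in> cocycles 1 G S U"
  using represents_cohomologous[OF adm_cover[OF assms(1)], of Z c] assms(2)
  by (simp_all add: cocycles_of_def represents_def)

lemma cocycles_of_in_HR: "U \<in> adm \<Longrightarrow> cocycles_of Z U \<noteq> {} \<Longrightarrow> cocycles_of Z U \<in> carrier (HR 1 G S U)"
  using cocycles_of_coset[of U _ Z] carrier_HR[OF adm_cover, of U] by blast

text \<open>Any cocycle in the class can be glued to a space with points in \<open>'z\<close>, and
  the class is then that of this space. Elements of cohomology are replaced by spaces from here
  on.\<close>

lemma HR_cocycles_of:
  assumes "U \<in> adm" "a \<in> carrier (HR 1 G S U)"
  shows "\<exists>Z :: ('x, 'g, 's, 'z) gen_hom_data. a = cocycles_of Z U \<and> cocycles_of Z U \<noteq> {}"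
proof -
  obtain c where c: "c \<in> cocycles 1 G S U" "a = coboundaries 1 G S U #>\<^bsub>Z1 U\<^esub> c"
    using assms(2) carrier_HR[OF adm_cover[OF assms(1)]] by blast
  then obtain Z :: "('x, 'g, 's, 'z) gen_hom_data" where "c \<in> cocycles_of Z U"
    using exists_represents[OF adm_cover[OF assms(1)] c(1) \<kappa>] by (auto simp: cocycles_of_def)
  then show ?thesis using cocycles_of_coset(1)[OF assms(1)] c(2) by blast
qed

lemma cocycles_of_refine:
  assumes "U \<in> adm" "V \<in> adm" "refinement U V \<theta>" "c \<in> cocycles_of Z U"
  shows "refine_cochain 1 G V \<theta> c \<in> cocycles_of Z V"
  using represents_refine[OF adm_cover[OF assms(1)] adm_cover[OF assms(2)] assms(3)] assms(4)
  by (simp add: cocycles_of_def)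

text \<open>A refined cocycle of \<open>Z\<close> is again a cocycle of \<open>Z\<close>, so every
  coset in the product of sets formed by \<open>HR_restriction\<close> is the class of
  \<open>Z\<close> on the finer cover. The result visibly does not depend on the refinement map
  picked by \<open>SOME\<close>.\<close>

lemma HR_restriction_cocycles_of:
  assumes U: "U \<in> adm" and V: "V \<in> adm" and "finer U V" and ne: "cocycles_of Z U \<noteq> {}"
  shows "HR_restriction 1 G S U V (cocycles_of Z U) = cocycles_of Z V" "cocycles_of Z V \<noteq> {}"
proof -
  define \<theta> where "\<theta> = (SOME \<theta>. refinement U V \<theta>)"
  have \<theta>: "refinement U V \<theta>" using someI_ex[of "refinement U V"] assms(3) by (simp add: finer_def \<theta>_def)
  note r = cocycles_of_refine[OF U V \<theta>]
  show "cocycles_of Z V \<noteq> {}" using r ne by blast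
  have "HR_restriction 1 G S U V (cocycles_of Z U) =
      (\<Union>c\<in>cocycles_of Z U. coboundaries 1 G S V #>\<^bsub>Z1 V\<^esub> refine_cochain 1 G V \<theta> c)"
    unfolding HR_restriction_def \<theta>_def[symmetric] set_mult_def r_coset_def by auto
  also have "\<dots> = (\<Union>c\<in>cocycles_of Z U. cocycles_of Z V)"
    by (rule SUP_cong[OF refl]) (rule cocycles_of_coset(1)[OF V r])
  also have "\<dots> = cocycles_of Z V" using ne by blast
  finally show "HR_restriction 1 G S U V (cocycles_of Z U) = cocycles_of Z V" .
qed

text \<open>One common cocycle makes the two spaces isomorphic, and isomorphic spaces represent the
  same cocycles on every cover.\<close>

lemma cocycles_of_eqI:
  assumes U: "U \<in> adm" and c: "c \<in> cocycles_of Z U" "c \<in> cocycles_of W U" and V: "V \<in> adm"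
  shows "cocycles_of Z V = cocycles_of W V"
proof -
  note s = represents_same_iso[OF adm_cover[OF U]] and i = represents_iso[OF adm_cover[OF V]]
  have "gen_hom_iso G S Z W" "gen_hom_iso G S W Z" using s[of Z c W] s[of W c Z] c by (simp_all add: cocycles_of_def)
  then show ?thesis using i[of Z _ W] i[of W _ Z] by (auto simp: cocycles_of_def)
qed

text \<open>The element of the direct limit attached to \<open>Z\<close>, written without reference
  to a particular cover; \<open>germ_cocycles_of\<close> identifies it with the germ of each of its
  members. Its type does not involve the type of points of \<open>Z\<close>.\<close>

definition germs :: "('x, 'g, 's, 'w) gen_hom_data \<Rightarrow> (('g, 'j) cover_data \<times> ('g, 's, 'j) cochain set) set" where
  "germs Z = {(V, cocycles_of Z V) | V. V \<in> adm \<and> cocycles_of Z V \<noteq> {}}"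

lemma germsI: "V \<in> adm \<Longrightarrow> c \<in> cocycles_of Z V \<Longrightarrow> (V, cocycles_of Z V) \<in> germs Z"
  by (auto simp: germs_def)

lemma germsE:
  assumes "germs Z \<noteq> {}"
  obtains V c where "V \<in> adm" "c \<in> cocycles_of Z V"
  using assms by (auto simp: germs_def)

lemma germs_eqI:
  assumes "U \<in> adm" "c \<in> cocycles_of Z U" "c \<in> cocycles_of W U" shows "germs Z = germs W"
  unfolding germs_def using cocycles_of_eqI[OF assms] by auto

text \<open>\<open>germs Z\<close> contains actual cocycles, and a cocycle shared on a single cover
  already determines the space up to isomorphism. Non-emptiness excludes the case where there is no
  cocycle to share.\<close>

lemma germs_iso:
  assumes "germs Z \<noteq> {}"
  shows "gen_hom_iso G S Z W \<longleftrightarrow> germs W = germs Z"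
proof
  obtain U c where U: "U \<in> adm" "c \<in> cocycles_of Z U" using assms by (rule germsE)
  { assume "gen_hom_iso G S Z W"
    then have "c \<in> cocycles_of W U" using represents_iso[OF adm_cover[OF U(1)]] U(2) by (simp add: cocycles_of_def)
    from germs_eqI[OF U this] show "germs W = germs Z" ..
  next
    assume "germs W = germs Z"
    then have "(U, cocycles_of Z U) \<in> germs W" using germsI[OF U] by simp
    then have "c \<in> cocycles_of W U" using U(2) by (auto simp: germs_def)
    then show "gen_hom_iso G S Z W"
      using represents_same_iso[OF adm_cover[OF U(1)]] U(2) by (simp add: cocycles_of_def)
  }
qed

text \<open>A class on V equivalent to that of \<open>Z\<close> is the class of some W, and equality
  after restriction to a cover K gives Z and W a common cocycle on K; they then have the same class
  on V. Conversely, the classes of \<open>Z\<close> on two covers have equal restrictions to a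
  common refinement.\<close>

lemma germ_cocycles_of:
  assumes U: "U \<in> adm" and ne: "cocycles_of Z U \<noteq> {}"
  shows "germ adm finer (HR 1 G S) (HR_restriction 1 G S) U (cocycles_of Z U) = germs Z"
proof (intro subset_antisym subsetI)
  fix p assume "p \<in> germ adm finer (HR 1 G S) (HR_restriction 1 G S) U (cocycles_of Z U)"
  then obtain V a K where p: "p = (V, a)" "V \<in> adm" "a \<in> carrier (HR 1 G S V)" "K \<in> adm" "finer U K" "finer V K"
      "HR_restriction 1 G S U K (cocycles_of Z U) = HR_restriction 1 G S V K a"
    unfolding germ_def by blast
  obtain W :: "('x, 'g, 's, 'z) gen_hom_data" where W: "a = cocycles_of W V" "cocycles_of W V \<noteq> {}"
    using HR_cocycles_of[OF p(2,3)] by blast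
  have "cocycles_of Z K = cocycles_of W K" "cocycles_of Z K \<noteq> {}"
    using p(7) HR_restriction_cocycles_of[OF U p(4,5) ne] HR_restriction_cocycles_of[OF p(2,4,6) W(2)] W(1) by simp_all
  then have "cocycles_of Z V = cocycles_of W V" using cocycles_of_eqI[OF p(4) _ _ p(2)] by blast
  then show "p \<in> germs Z" using p W by (auto simp: germs_def)
next
  fix p assume "p \<in> germs Z"
  then obtain V where V: "p = (V, cocycles_of Z V)" "V \<in> adm" "cocycles_of Z V \<noteq> {}" by (auto simp: germs_def)
  obtain K where K: "K \<in> adm" "finer U K" "finer V K" using common_refinement[OF inf U V(2)] by blast
  then show "p \<in> germ adm finer (HR 1 G S) (HR_restriction 1 G S) U (cocycles_of Z U)"
    using HR_restriction_cocycles_of(1)[OF U K(1,2) ne] HR_restriction_cocycles_of(1)[OF V(2) K(1,3) V(3)]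
      V cocycles_of_in_HR[OF V(2,3)] by (auto simp: germ_def)
qed

section \<open>Products of germs and the group laws\<close>

lemma common_cover:
  assumes "germs Z \<noteq> {}" "germs W \<noteq> {}"
  obtains U c d where "U \<in> adm" "c \<in> cocycles_of Z U" "d \<in> cocycles_of W U"
proof -
  obtain U c where U: "U \<in> adm" "c \<in> cocycles_of Z U" using assms(1) by (rule germsE)
  obtain V d where V: "V \<in> adm" "d \<in> cocycles_of W V" using assms(2) by (rule germsE)
  obtain K where K: "K \<in> adm" "finer U K" "finer V K" using common_refinement[OF inf U(1) V(1)] by blast
  then obtain \<theta> \<theta>' where "refinement U K \<theta>" "refinement V K \<theta>'" by (auto simp: finer_def)
  then show ?thesis
    using that[OF K(1)] cocycles_of_refine[OF U(1) K(1) _ U(2)] cocycles_of_refine[OF V(1) K(1) _ V(2)] by blast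
qed

lemma common_cover3:
  assumes "germs Z \<noteq> {}" "germs W \<noteq> {}" "germs Y \<noteq> {}"
  obtains U c d e where "U \<in> adm" "c \<in> cocycles_of Z U" "d \<in> cocycles_of W U" "e \<in> cocycles_of Y U"
proof -
  obtain U c d where U: "U \<in> adm" "c \<in> cocycles_of Z U" "d \<in> cocycles_of W U" using common_cover[OF assms(1,2)] .
  obtain V e where V: "V \<in> adm" "e \<in> cocycles_of Y V" using assms(3) by (rule germsE)
  obtain K where K: "K \<in> adm" "finer U K" "finer V K" using common_refinement[OF inf U(1) V(1)] by blast
  then obtain \<theta> \<theta>' where "refinement U K \<theta>" "refinement V K \<theta>'" by (auto simp: finer_def)
  then show ?thesis
    using that[OF K(1)] cocycles_of_refine[OF U(1) K(1) _ U(2)] cocycles_of_refine[OF U(1) K(1) _ U(3)]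
      cocycles_of_refine[OF V(1) K(1) _ V(2)] by blast
qed

lemma cocycles_of_cocycle:
  assumes "U \<in> adm" "c \<in> cocycles_of Z U"
  shows "cocycle_on U (val U c)" "mk U (val U c) = c"
    "i \<in> Idx U 0 \<Longrightarrow> j \<in> Idx U 0 \<Longrightarrow> g \<in> over U i j \<Longrightarrow> val U c i j g \<in> carrier S"
  using val_cocycle_on[OF adm_cover[OF assms(1)] cocycles_of_coset(2)[OF assms]]
    mk_val[OF adm_cover[OF assms(1)] cocycles_of_coset(2)[OF assms]] cocycle_on_in by auto

lemma cocycles_of_sum:
  assumes U: "U \<in> adm" and "mk U f \<in> cocycles_of Z U" "mk U f' \<in> cocycles_of W U" "cocycle_on U f" "cocycle_on U f'"
  shows "mk U (\<lambda>i j g. f i j g \<otimes> f' i j g) \<in> cocycles_of (gen_hom_sum S Z W) U"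
proof -
  have "mk U (\<lambda>i j g. val U (mk U f) i j g \<otimes> val U (mk U f') i j g) = mk U (\<lambda>i j g. f i j g \<otimes> f' i j g)"
    using val_mk[OF adm_cover[OF U]] assms(4,5) by (intro mk_cong[OF adm_cover[OF U]]) simp
  then show ?thesis
    using represents_sum[OF adm_cover[OF U]] assms(2,3) by (fastforce simp: cocycles_of_def)
qed

lemma germs_sum_ne:
  assumes "germs Z \<noteq> {}" "germs W \<noteq> {}" shows "germs (gen_hom_sum S Z W) \<noteq> {}"
proof -
  obtain U c d where U: "U \<in> adm" "c \<in> cocycles_of Z U" "d \<in> cocycles_of W U" using common_cover[OF assms] .
  note c = cocycles_of_cocycle[OF U(1,2)] and d = cocycles_of_cocycle[OF U(1,3)]
  show ?thesis
    using germsI[OF U(1) cocycles_of_sum[OF U(1) _ _ c(1) d(1), of Z W]] U c(2) d(2) by auto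
qed

lemma HR_mult_cocycles_of:
  assumes U: "U \<in> adm" and "cocycles_of Z U \<noteq> {}" "cocycles_of W U \<noteq> {}"
  shows "cocycles_of Z U \<otimes>\<^bsub>HR 1 G S U\<^esub> cocycles_of W U = cocycles_of (gen_hom_sum S Z W) U"
    "cocycles_of (gen_hom_sum S Z W) U \<noteq> {}"
proof -
  obtain c d where c: "c \<in> cocycles_of Z U" and d: "d \<in> cocycles_of W U" using assms(2,3) by blast
  let ?e = "mk U (\<lambda>i j g. val U c i j g \<otimes> val U d i j g)"
  note c' = cocycles_of_cocycle[OF U c] and d' = cocycles_of_cocycle[OF U d]
  have e: "?e \<in> cocycles_of (gen_hom_sum S Z W) U"
    using cocycles_of_sum[OF U _ _ c'(1) d'(1), of Z W] c d c'(2) d'(2) by simp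
  show "cocycles_of (gen_hom_sum S Z W) U \<noteq> {}" using e by blast
  show "cocycles_of Z U \<otimes>\<^bsub>HR 1 G S U\<^esub> cocycles_of W U = cocycles_of (gen_hom_sum S Z W) U"
    using mult_HR[OF adm_cover[OF U] cocycles_of_coset(2)[OF U c] cocycles_of_coset(2)[OF U d]]
    unfolding cocycles_of_coset(1)[OF U c] cocycles_of_coset(1)[OF U d] cocycles_of_coset(1)[OF U e] .
qed

abbreviation Cech :: "(('g, 'j) cover_data \<times> ('g, 's, 'j) cochain set) set monoid" where
  "Cech \<equiv> Cech_HR TYPE('j) 1 G S"

text \<open>The product in the direct limit is a union over all covers on which both spaces have a
  class. Each such cover contributes the same set, that of the sum, and at least one exists by
  common refinement.\<close>

lemma mult_Cech:
  assumes "germs Z \<noteq> {}" "germs W \<noteq> {}"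
  shows "germs Z \<otimes>\<^bsub>Cech\<^esub> germs W = germs (gen_hom_sum S Z W)"
proof -
  have "{germ adm finer (HR 1 G S) (HR_restriction 1 G S) i (a \<otimes>\<^bsub>HR 1 G S i\<^esub> b) | i a b.
      (i, a) \<in> germs Z \<and> (i, b) \<in> germs W} = {germs (gen_hom_sum S Z W)}"
  proof (intro subset_antisym subsetI)
    fix x assume "x \<in> {germ adm finer (HR 1 G S) (HR_restriction 1 G S) i (a \<otimes>\<^bsub>HR 1 G S i\<^esub> b) | i a b.
      (i, a) \<in> germs Z \<and> (i, b) \<in> germs W}"
    then obtain i where i: "i \<in> adm" "cocycles_of Z i \<noteq> {}" "cocycles_of W i \<noteq> {}"
      "x = germ adm finer (HR 1 G S) (HR_restriction 1 G S) i (cocycles_of Z i \<otimes>\<^bsub>HR 1 G S i\<^esub> cocycles_of W i)"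
      by (auto simp: germs_def)
    then show "x \<in> {germs (gen_hom_sum S Z W)}"
      using HR_mult_cocycles_of(1)[OF i(1-3)] germ_cocycles_of[OF i(1) HR_mult_cocycles_of(2)[OF i(1-3)]]
      by simp
  next
    fix x assume x: "x \<in> {germs (gen_hom_sum S Z W)}"
    obtain U c d where U: "U \<in> adm" "c \<in> cocycles_of Z U" "d \<in> cocycles_of W U" using common_cover[OF assms] .
    then have ne: "cocycles_of Z U \<noteq> {}" "cocycles_of W U \<noteq> {}" by auto
    have "x = germ adm finer (HR 1 G S) (HR_restriction 1 G S) U (cocycles_of Z U \<otimes>\<^bsub>HR 1 G S U\<^esub> cocycles_of W U)"
      using x HR_mult_cocycles_of(1)[OF U(1) ne] germ_cocycles_of[OF U(1) HR_mult_cocycles_of(2)[OF U(1) ne]]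
      by simp
    then show "x \<in> {germ adm finer (HR 1 G S) (HR_restriction 1 G S) i (a \<otimes>\<^bsub>HR 1 G S i\<^esub> b) | i a b.
      (i, a) \<in> germs Z \<and> (i, b) \<in> germs W}"
      using germsI[OF U(1,2)] germsI[OF U(1,3)] by blast
  qed
  then show ?thesis by (simp add: Cech_HR_def direct_limit_def)
qed

lemma real_gen_hom_germs:
  assumes "real_gen_hom G S Z" shows "germs Z \<noteq> {}"
proof -
  obtain U :: "('g, 'j) cover_data" and c where U: "U \<in> adm" "represents Z U c"
    by (rule exists_cocycle[OF assms \<iota> inf])
  have "c \<in> cocycles_of Z U" using U(2) by (simp add: cocycles_of_def)
  from germsI[OF U(1) this] show ?thesis by blast
qed

lemma germs_real_gen_hom:
  assumes "germs X \<noteq> {}"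
  obtains Z :: "('x, 'g, 's, 'z) gen_hom_data" where "real_gen_hom G S Z" "germs Z = germs X"
proof -
  obtain U c where U: "U \<in> adm" "c \<in> cocycles_of X U" using assms by (rule germsE)
  obtain Z :: "('x, 'g, 's, 'z) gen_hom_data" where Z: "represents Z U c"
    using exists_represents[OF adm_cover[OF U(1)] cocycles_of_coset(2)[OF U] \<kappa>] by blast
  then show ?thesis
    using that[of Z] represents_real_gen_hom[OF adm_cover[OF U(1)] Z] germs_eqI[OF U(1), of c Z X] U(2)
    by (simp add: cocycles_of_def)
qed

lemma carrier_Cech: "carrier Cech = {germs Z | Z :: ('x, 'g, 's, 'z) gen_hom_data. real_gen_hom G S Z}"
proof (intro subset_antisym subsetI)
  fix x assume "x \<in> carrier Cech"
  then obtain i a where i: "i \<in> adm" "a \<in> carrier (HR 1 G S i)"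
    "x = germ adm finer (HR 1 G S) (HR_restriction 1 G S) i a"
    by (auto simp: Cech_HR_def direct_limit_def)
  then obtain Z :: "('x, 'g, 's, 'z) gen_hom_data" where Z: "a = cocycles_of Z i" "cocycles_of Z i \<noteq> {}"
    using HR_cocycles_of by blast
  have x: "x = germs Z" unfolding i(3) Z(1) by (rule germ_cocycles_of[OF i(1) Z(2)])
  have "germs Z \<noteq> {}" using Z(2) i(1) by (auto simp: germs_def)
  then obtain W :: "('x, 'g, 's, 'z) gen_hom_data" where "real_gen_hom G S W" "germs W = germs Z"
    by (rule germs_real_gen_hom)
  then show "x \<in> {germs Z | Z :: ('x, 'g, 's, 'z) gen_hom_data. real_gen_hom G S Z}"
    unfolding x by (intro CollectI exI[of _ W]) simp
next
  fix x assume "x \<in> {germs Z | Z :: ('x, 'g, 's, 'z) gen_hom_data. real_gen_hom G S Z}"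
  then obtain Z :: "('x, 'g, 's, 'z) gen_hom_data" where Z: "x = germs Z" "real_gen_hom G S Z" by blast
  obtain U c where U: "U \<in> adm" "c \<in> cocycles_of Z U" using real_gen_hom_germs[OF Z(2)] by (rule germsE)
  then have ne: "cocycles_of Z U \<noteq> {}" by blast
  then show "x \<in> carrier Cech"
    using cocycles_of_in_HR[OF U(1) ne] germ_cocycles_of[OF U(1) ne] Z(1) U(1)
    by (auto simp: Cech_HR_def direct_limit_def)
qed

lemma trivial_class: "U \<in> adm \<Longrightarrow> mk U (\<lambda>i j g. \<one>) \<in> cocycles_of (gen_hom_trivial G S) U"
  using represents_trivial[OF adm_cover] by (simp add: cocycles_of_def)

text \<open>The degree 0 cover consisting of the whole object space, repeated for every element of
  \<open>'j\<close>, with the identity as involution on indices.\<close>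

lemma adm_nonempty: "adm \<noteq> {}"
proof -
  have "\<exists>U :: ('g, 'j) cover_data. U \<in> adm \<and> Idx U 0 = UNIV \<and>
      (\<forall>i\<in>UNIV. ibar U 0 i = i \<and> ob U i = objects G)"
    by (rule exists_cover[OF inf, where b = "\<lambda>i. i" and A = "\<lambda>_. objects G"]) auto
  then show ?thesis by blast
qed

lemma germs_trivial_ne: "germs (gen_hom_trivial G S) \<noteq> {}"
  using adm_nonempty trivial_class germsI by blast

lemma one_Cech: "\<one>\<^bsub>Cech\<^esub> = germs (gen_hom_trivial G S)"
proof -
  have "germ adm finer (HR 1 G S) (HR_restriction 1 G S) i \<one>\<^bsub>HR 1 G S i\<^esub> = germs (gen_hom_trivial G S)"
    if i: "i \<in> adm" for i
  proof -
    have "\<one>\<^bsub>HR 1 G S i\<^esub> = cocycles_of (gen_hom_trivial G S) i"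
      unfolding one_HR[OF adm_cover[OF i]] by (rule cocycles_of_coset(1)[OF i trivial_class[OF i]])
    then show ?thesis using germ_cocycles_of[OF i] trivial_class[OF i] by fastforce
  qed
  then have "{germ adm finer (HR 1 G S) (HR_restriction 1 G S) i \<one>\<^bsub>HR 1 G S i\<^esub> | i. i \<in> adm} =
      {germs (gen_hom_trivial G S)}"
    using adm_nonempty by blast
  then show ?thesis by (simp add: Cech_HR_def direct_limit_def)
qed

lemma germs_sum_cong:
  assumes "germs Z \<noteq> {}" "germs W \<noteq> {}" "germs Z = germs Z'" "germs W = germs W'"
  shows "germs (gen_hom_sum S Z W) = germs (gen_hom_sum S Z' W')"
  using mult_Cech[of Z W] mult_Cech[of Z' W'] assms by simp

text \<open>The two sums have points in different types, but their germs have the same type.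
  Commutativity of \<open>S\<close> shows that both represent one cocycle, which is enough by
  \<open>germs_eqI\<close>; the other group laws are proved in the same way.\<close>

lemma germs_sum_commute:
  assumes "germs Z \<noteq> {}" "germs W \<noteq> {}"
  shows "germs (gen_hom_sum S Z W) = germs (gen_hom_sum S W Z)"
proof -
  obtain U c d where U: "U \<in> adm" "c \<in> cocycles_of Z U" "d \<in> cocycles_of W U" using common_cover[OF assms] .
  note c = cocycles_of_cocycle[OF U(1,2)] and d = cocycles_of_cocycle[OF U(1,3)]
  have "mk U (\<lambda>i j g. val U c i j g \<otimes> val U d i j g) = mk U (\<lambda>i j g. val U d i j g \<otimes> val U c i j g)"
    using c(3) d(3) by (intro mk_cong[OF adm_cover[OF U(1)]]) (simp add: m_comm)
  then show ?thesis
    using cocycles_of_sum[OF U(1) _ _ c(1) d(1), of Z W] cocycles_of_sum[OF U(1) _ _ d(1) c(1), of W Z] c(2) d(2) U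
    by (intro germs_eqI[OF U(1)]) simp_all
qed

lemma germs_sum_assoc:
  assumes "germs Z \<noteq> {}" "germs W \<noteq> {}" "germs Y \<noteq> {}"
  shows "germs (gen_hom_sum S (gen_hom_sum S Z W) Y) = germs (gen_hom_sum S Z (gen_hom_sum S W Y))"
proof -
  obtain U c d e where U: "U \<in> adm" "c \<in> cocycles_of Z U" "d \<in> cocycles_of W U" "e \<in> cocycles_of Y U"
    using common_cover3[OF assms] .
  note c = cocycles_of_cocycle[OF U(1,2)] and d = cocycles_of_cocycle[OF U(1,3)] and e = cocycles_of_cocycle[OF U(1,4)]
  note m = cocycle_on_mult[OF adm_cover[OF U(1)]]
  have cd: "mk U (\<lambda>i j g. val U c i j g \<otimes> val U d i j g) \<in> cocycles_of (gen_hom_sum S Z W) U"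
    using cocycles_of_sum[OF U(1) _ _ c(1) d(1), of Z W] c(2) d(2) U by simp
  have de: "mk U (\<lambda>i j g. val U d i j g \<otimes> val U e i j g) \<in> cocycles_of (gen_hom_sum S W Y) U"
    using cocycles_of_sum[OF U(1) _ _ d(1) e(1), of W Y] d(2) e(2) U by simp
  have "mk U (\<lambda>i j g. val U c i j g \<otimes> val U d i j g \<otimes> val U e i j g) =
      mk U (\<lambda>i j g. val U c i j g \<otimes> (val U d i j g \<otimes> val U e i j g))"
    using c(3) d(3) e(3) by (intro mk_cong[OF adm_cover[OF U(1)]]) (simp add: m_assoc)
  then show ?thesis
    using cocycles_of_sum[OF U(1) cd _ m[OF c(1) d(1)] e(1), of Y] cocycles_of_sum[OF U(1) _ de c(1) m[OF d(1) e(1)], of Z]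
      c(2) e(2) U by (intro germs_eqI[OF U(1)]) simp_all
qed

lemma germs_sum_trivial:
  assumes "germs Z \<noteq> {}" shows "germs (gen_hom_sum S (gen_hom_trivial G S) Z) = germs Z"
proof -
  obtain U c where U: "U \<in> adm" "c \<in> cocycles_of Z U" using assms by (rule germsE)
  note c = cocycles_of_cocycle[OF U]
  have "mk U (\<lambda>i j g. \<one> \<otimes> val U c i j g) = mk U (val U c)"
    using c(3) by (intro mk_cong[OF adm_cover[OF U(1)]]) simp
  then have "c \<in> cocycles_of (gen_hom_sum S (gen_hom_trivial G S) Z) U"
    using cocycles_of_sum[OF U(1) trivial_class[OF U(1)] _ cocycle_on_one[OF adm_cover[OF U(1)]] c(1), of Z] c(2) U(2) by simp
  then show ?thesis using germs_eqI[OF U(1)] U(2) by blast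
qed

lemma opposite_class:
  assumes U: "U \<in> adm" and c: "c \<in> cocycles_of Z U"
  shows "mk U (\<lambda>i j g. inv (val U c i j g)) \<in> cocycles_of (gen_hom_opposite S Z) U"
  using represents_opposite[OF adm_cover[OF U]] c by (simp add: cocycles_of_def)

lemma germs_opposite:
  assumes "germs Z \<noteq> {}"
  shows "germs (gen_hom_opposite S Z) \<noteq> {}"
    "germs (gen_hom_sum S (gen_hom_opposite S Z) Z) = germs (gen_hom_trivial G S)"
proof -
  obtain U c where U: "U \<in> adm" "c \<in> cocycles_of Z U" using assms by (rule germsE)
  note c = cocycles_of_cocycle[OF U]
  show "germs (gen_hom_opposite S Z) \<noteq> {}" using germsI[OF U(1) opposite_class[OF U]] by blast
  have "mk U (\<lambda>i j g. inv (val U c i j g) \<otimes> val U c i j g) = mk U (\<lambda>i j g. \<one>)"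
    using c(3) by (intro mk_cong[OF adm_cover[OF U(1)]]) simp
  then have "mk U (\<lambda>i j g. \<one>) \<in> cocycles_of (gen_hom_sum S (gen_hom_opposite S Z) Z) U"
    using cocycles_of_sum[OF U(1) opposite_class[OF U] _ cocycle_on_inv[OF adm_cover[OF U(1)] c(1)] c(1), of Z] c(2) U(2)
    by simp
  then show "germs (gen_hom_sum S (gen_hom_opposite S Z) Z) = germs (gen_hom_trivial G S)"
    using germs_eqI[OF U(1)] trivial_class[OF U(1)] by blast
qed

section \<open>The group of isomorphism classes\<close>

abbreviation Hom :: "('x, 'g, 's, 'z) gen_hom_data set monoid" where
  "Hom \<equiv> Hom_RG TYPE('z) G S"

abbreviation cls :: "('x, 'g, 's, 'w) gen_hom_data \<Rightarrow> ('x, 'g, 's, 'z) gen_hom_data set" where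
  "cls X \<equiv> gen_hom_class TYPE('z) G S X"

text \<open>Isomorphism is equality of germs, so an isomorphism class is a fibre of
  \<open>germs\<close> over spaces with points in \<open>'z\<close>. The space X may live in another
  type, as sums do.\<close>

lemma cls_eq: "germs X \<noteq> {} \<Longrightarrow> cls X = {W. real_gen_hom G S W \<and> germs W = germs X}"
  using germs_iso[of X] by (auto simp: gen_hom_class_def)

lemma cls_cong: "germs X \<noteq> {} \<Longrightarrow> germs X = germs Y \<Longrightarrow> cls X = cls Y"
  using cls_eq[of X] cls_eq[of Y] by simp

lemma cls_in: "germs X \<noteq> {} \<Longrightarrow> cls X \<in> carrier Hom"
proof -
  assume X: "germs X \<noteq> {}"
  then obtain Z :: "('x, 'g, 's, 'z) gen_hom_data" where Z: "real_gen_hom G S Z" "germs Z = germs X"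
    by (rule germs_real_gen_hom)
  have "cls X = cls Z" by (rule cls_cong[OF X Z(2)[symmetric]])
  then show ?thesis using Z(1) by (auto simp: Hom_RG_def)
qed

lemma HomE:
  assumes "A \<in> carrier Hom"
  obtains Z :: "('x, 'g, 's, 'z) gen_hom_data" where "real_gen_hom G S Z" "A = cls Z" "germs Z \<noteq> {}"
proof -
  obtain Z :: "('x, 'g, 's, 'z) gen_hom_data" where "real_gen_hom G S Z" "A = cls Z"
    using assms by (auto simp: Hom_RG_def)
  then show ?thesis using that[of Z] real_gen_hom_germs[of Z] by simp
qed

text \<open>The union over representatives collapses because each class has a member in
  \<open>'z\<close> and the germ of a sum depends only on the germs of the summands. Allowing X and
  Y in other types lets the rule be iterated.\<close>

lemma mult_Hom:
  assumes "germs X \<noteq> {}" "germs Y \<noteq> {}"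
  shows "cls X \<otimes>\<^bsub>Hom\<^esub> cls Y = cls (gen_hom_sum S X Y)"
proof -
  obtain Z :: "('x, 'g, 's, 'z) gen_hom_data" where Z: "real_gen_hom G S Z" "germs Z = germs X"
    using assms(1) by (rule germs_real_gen_hom)
  obtain W :: "('x, 'g, 's, 'z) gen_hom_data" where W: "real_gen_hom G S W" "germs W = germs Y"
    using assms(2) by (rule germs_real_gen_hom)
  have ZW: "Z \<in> cls X" "W \<in> cls Y" using cls_eq[OF assms(1)] cls_eq[OF assms(2)] Z W by auto
  have "cls (gen_hom_sum S Z' W') = cls (gen_hom_sum S X Y)" if "Z' \<in> cls X" "W' \<in> cls Y" for Z' W'
  proof -
    have "germs X = germs Z'" "germs Y = germs W'"
      using that cls_eq[OF assms(1)] cls_eq[OF assms(2)] by auto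
    from cls_cong[OF germs_sum_ne[OF assms] germs_sum_cong[OF assms this]] show ?thesis ..
  qed
  then have "(\<Union>Z'\<in>cls X. \<Union>W'\<in>cls Y. cls (gen_hom_sum S Z' W')) = cls (gen_hom_sum S X Y)"
    using ZW by blast
  then show ?thesis by (simp add: Hom_RG_def)
qed

lemma one_Hom: "\<one>\<^bsub>Hom\<^esub> = cls (gen_hom_trivial G S)"
  by (simp add: Hom_RG_def)

lemma mult_opposite:
  assumes "germs X \<noteq> {}" shows "cls (gen_hom_opposite S X) \<otimes>\<^bsub>Hom\<^esub> cls X = \<one>\<^bsub>Hom\<^esub>"
  unfolding mult_Hom[OF germs_opposite(1)[OF assms] assms] one_Hom
  by (rule cls_cong[OF germs_sum_ne[OF germs_opposite(1)[OF assms] assms] germs_opposite(2)[OF assms]])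

lemma comm_group_Hom: "comm_group Hom"
proof (rule comm_groupI)
  show "\<one>\<^bsub>Hom\<^esub> \<in> carrier Hom" unfolding one_Hom by (rule cls_in[OF germs_trivial_ne])
  fix A assume "A \<in> carrier Hom"
  then obtain X :: "('x, 'g, 's, 'z) gen_hom_data" where X: "A = cls X" "germs X \<noteq> {}" by (rule HomE)
  show "\<one>\<^bsub>Hom\<^esub> \<otimes>\<^bsub>Hom\<^esub> A = A"
    unfolding one_Hom X(1) mult_Hom[OF germs_trivial_ne X(2)]
    by (rule cls_cong[OF germs_sum_ne[OF germs_trivial_ne X(2)] germs_sum_trivial[OF X(2)]])
  show "\<exists>A'\<in>carrier Hom. A' \<otimes>\<^bsub>Hom\<^esub> A = \<one>\<^bsub>Hom\<^esub>"
    using mult_opposite[OF X(2)] cls_in[OF germs_opposite(1)[OF X(2)]] X(1) by blast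
  fix B assume "B \<in> carrier Hom"
  then obtain Y :: "('x, 'g, 's, 'z) gen_hom_data" where Y: "B = cls Y" "germs Y \<noteq> {}" by (rule HomE)
  note XY = germs_sum_ne[OF X(2) Y(2)]
  show "A \<otimes>\<^bsub>Hom\<^esub> B \<in> carrier Hom" unfolding X(1) Y(1) mult_Hom[OF X(2) Y(2)] by (rule cls_in[OF XY])
  show "A \<otimes>\<^bsub>Hom\<^esub> B = B \<otimes>\<^bsub>Hom\<^esub> A"
    unfolding X(1) Y(1) mult_Hom[OF X(2) Y(2)] mult_Hom[OF Y(2) X(2)]
    by (rule cls_cong[OF XY germs_sum_commute[OF X(2) Y(2)]])
  fix C assume "C \<in> carrier Hom"
  then obtain W :: "('x, 'g, 's, 'z) gen_hom_data" where W: "C = cls W" "germs W \<noteq> {}" by (rule HomE)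
  show "A \<otimes>\<^bsub>Hom\<^esub> B \<otimes>\<^bsub>Hom\<^esub> C = A \<otimes>\<^bsub>Hom\<^esub> (B \<otimes>\<^bsub>Hom\<^esub> C)"
    unfolding X(1) Y(1) W(1) mult_Hom[OF X(2) Y(2)] mult_Hom[OF Y(2) W(2)] mult_Hom[OF XY W(2)]
      mult_Hom[OF X(2) germs_sum_ne[OF Y(2) W(2)]]
    by (rule cls_cong[OF germs_sum_ne[OF XY W(2)] germs_sum_assoc[OF X(2) Y(2) W(2)]])
qed

lemma inv_Hom: "germs X \<noteq> {} \<Longrightarrow> inv\<^bsub>Hom\<^esub> (cls X) = cls (gen_hom_opposite S X)"
  using group.inv_equality[OF comm_group.axioms(2)[OF comm_group_Hom] mult_opposite cls_in cls_in] germs_opposite(1)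
  by blast

section \<open>The group structure on Cech cohomology and the isomorphism\<close>

lemma germs_in:
  assumes "germs X \<noteq> {}" shows "germs X \<in> carrier Cech"
proof -
  obtain Z :: "('x, 'g, 's, 'z) gen_hom_data" where "real_gen_hom G S Z" "germs Z = germs X"
    using assms by (rule germs_real_gen_hom)
  then show ?thesis unfolding carrier_Cech by (intro CollectI exI[of _ Z]) simp
qed

lemma CechE:
  assumes "A \<in> carrier Cech"
  obtains Z :: "('x, 'g, 's, 'z) gen_hom_data" where "real_gen_hom G S Z" "A = germs Z" "germs Z \<noteq> {}"
proof -
  obtain Z :: "('x, 'g, 's, 'z) gen_hom_data" where "real_gen_hom G S Z" "A = germs Z"
    using assms unfolding carrier_Cech by blast
  then show ?thesis using that[of Z] real_gen_hom_germs[of Z] by simp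
qed

lemma comm_group_Cech: "comm_group Cech"
proof (rule comm_groupI)
  show "\<one>\<^bsub>Cech\<^esub> \<in> carrier Cech" unfolding one_Cech by (rule germs_in[OF germs_trivial_ne])
  fix A assume "A \<in> carrier Cech"
  then obtain X :: "('x, 'g, 's, 'z) gen_hom_data" where X: "A = germs X" "germs X \<noteq> {}" by (rule CechE)
  show "\<one>\<^bsub>Cech\<^esub> \<otimes>\<^bsub>Cech\<^esub> A = A"
    unfolding one_Cech X(1) mult_Cech[OF germs_trivial_ne X(2)] by (rule germs_sum_trivial[OF X(2)])
  have "germs (gen_hom_opposite S X) \<otimes>\<^bsub>Cech\<^esub> A = \<one>\<^bsub>Cech\<^esub>"
    unfolding one_Cech X(1) mult_Cech[OF germs_opposite(1)[OF X(2)] X(2)] by (rule germs_opposite(2)[OF X(2)])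
  then show "\<exists>A'\<in>carrier Cech. A' \<otimes>\<^bsub>Cech\<^esub> A = \<one>\<^bsub>Cech\<^esub>"
    using germs_in[OF germs_opposite(1)[OF X(2)]] by blast
  fix B assume "B \<in> carrier Cech"
  then obtain Y :: "('x, 'g, 's, 'z) gen_hom_data" where Y: "B = germs Y" "germs Y \<noteq> {}" by (rule CechE)
  note XY = germs_sum_ne[OF X(2) Y(2)]
  show "A \<otimes>\<^bsub>Cech\<^esub> B \<in> carrier Cech" unfolding X(1) Y(1) mult_Cech[OF X(2) Y(2)] by (rule germs_in[OF XY])
  show "A \<otimes>\<^bsub>Cech\<^esub> B = B \<otimes>\<^bsub>Cech\<^esub> A"
    unfolding X(1) Y(1) mult_Cech[OF X(2) Y(2)] mult_Cech[OF Y(2) X(2)] by (rule germs_sum_commute[OF X(2) Y(2)])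
  fix C assume "C \<in> carrier Cech"
  then obtain W :: "('x, 'g, 's, 'z) gen_hom_data" where W: "C = germs W" "germs W \<noteq> {}" by (rule CechE)
  show "A \<otimes>\<^bsub>Cech\<^esub> B \<otimes>\<^bsub>Cech\<^esub> C = A \<otimes>\<^bsub>Cech\<^esub> (B \<otimes>\<^bsub>Cech\<^esub> C)"
    unfolding X(1) Y(1) W(1) mult_Cech[OF X(2) Y(2)] mult_Cech[OF Y(2) W(2)] mult_Cech[OF XY W(2)]
      mult_Cech[OF X(2) germs_sum_ne[OF Y(2) W(2)]]
    by (rule germs_sum_assoc[OF X(2) Y(2) W(2)])
qed

lemma Cech_iso_Hom: "Cech \<cong> Hom"
proof -
  \<comment> \<open>An element of the direct limit is sent to the fibre of \<open>germs\<close> over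
    it, without choosing a representative. Injectivity holds because the fibres over elements of the
    Cech group are non-empty.\<close>
  define \<Phi> where "\<Phi> A = {W :: ('x, 'g, 's, 'z) gen_hom_data. real_gen_hom G S W \<and> germs W = A}" for A
  have \<Phi>: "\<Phi> (germs X) = cls X" if "germs X \<noteq> {}" for X :: "('x, 'g, 's, 'w) gen_hom_data"
    unfolding \<Phi>_def using cls_eq[OF that] by simp
  have "\<Phi> \<in> iso Cech Hom"
  proof (rule isoI)
    show "\<Phi> \<in> hom Cech Hom"
    proof (rule homI)
      fix A assume "A \<in> carrier Cech"
      then obtain X :: "('x, 'g, 's, 'z) gen_hom_data" where X: "A = germs X" "germs X \<noteq> {}" by (rule CechE)
      show "\<Phi> A \<in> carrier Hom" unfolding X(1) \<Phi>[OF X(2)] by (rule cls_in[OF X(2)])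
      fix B assume "B \<in> carrier Cech"
      then obtain Y :: "('x, 'g, 's, 'z) gen_hom_data" where Y: "B = germs Y" "germs Y \<noteq> {}" by (rule CechE)
      show "\<Phi> (A \<otimes>\<^bsub>Cech\<^esub> B) = \<Phi> A \<otimes>\<^bsub>Hom\<^esub> \<Phi> B"
        unfolding X(1) Y(1) mult_Cech[OF X(2) Y(2)]
        using \<Phi>[OF germs_sum_ne[OF X(2) Y(2)]] \<Phi>[OF X(2)] \<Phi>[OF Y(2)] mult_Hom[OF X(2) Y(2)] by simp
    qed
    have "inj_on \<Phi> (carrier Cech)"
    proof (rule inj_onI)
      fix A B assume "A \<in> carrier Cech" and B: "\<Phi> A = \<Phi> B"
      then obtain X :: "('x, 'g, 's, 'z) gen_hom_data" where X: "real_gen_hom G S X" "A = germs X" "germs X \<noteq> {}" by (elim CechE)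
      then have "X \<in> \<Phi> B" using B by (auto simp: \<Phi>_def)
      then show "A = B" using X by (simp add: \<Phi>_def)
    qed
    moreover have "\<Phi> ` carrier Cech = carrier Hom"
    proof (intro subset_antisym subsetI)
      fix A assume "A \<in> \<Phi> ` carrier Cech"
      then obtain B where B: "B \<in> carrier Cech" "A = \<Phi> B" by blast
      obtain X :: "('x, 'g, 's, 'z) gen_hom_data" where X: "B = germs X" "germs X \<noteq> {}" using B(1) by (rule CechE)
      show "A \<in> carrier Hom" unfolding B(2) X(1) \<Phi>[OF X(2)] by (rule cls_in[OF X(2)])
    next
      fix A assume "A \<in> carrier Hom"
      then obtain X :: "('x, 'g, 's, 'z) gen_hom_data" where "A = cls X" "germs X \<noteq> {}" by (rule HomE)
      then show "A \<in> \<Phi> ` carrier Cech" using \<Phi>[of X] germs_in[of X] by blast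
    qed
    ultimately show "bij_betw \<Phi> (carrier Cech) (carrier Hom)" by (simp add: bij_betw_def)
  qed
  then show ?thesis by (auto simp: is_iso_def)
qed

end

end

theorem proposition2p49:
  fixes G :: "('x, 'g) groupoid_data" and S :: "'s group_data"
    and \<iota> :: "'g \<Rightarrow> 'j" and \<kappa> :: "'x \<times> 's \<Rightarrow> 'z"
  assumes "real_groupoid G" and "abelian_real_group S"
    and "infinite (UNIV :: 'j set)" and "inj_on \<iota> (arrows G)"
    and "inj_on \<kappa> (objects G \<times> carrier S)"
  shows "comm_group (Cech_HR TYPE('j) 1 G S) \<and>
    comm_group (Hom_RG TYPE('z) G S) \<and>
    (\<forall>Z :: ('x, 'g, 's, 'z) gen_hom_data. real_gen_hom G S Z \<longrightarrow>
       inv\<^bsub>Hom_RG TYPE('z) G S\<^esub> (gen_hom_class TYPE('z) G S Z) =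
         gen_hom_class TYPE('z) G S (gen_hom_opposite S Z)) \<and>
    Cech_HR TYPE('j) 1 G S \<cong> Hom_RG TYPE('z) G S"
proof -
  interpret real_groupoid_with_coefficients G S
    using assms(1,2) by (rule real_groupoid_with_coefficients.intro)
  note a = assms(3-5)
  show ?thesis
    using comm_group_Cech[OF a] comm_group_Hom[OF a] Cech_iso_Hom[OF a]
      inv_Hom[OF a real_gen_hom_germs[OF a]] by blast
qed

end
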